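(* Let $\mathcal F$ be a hyperbolic singular holomorphic foliation by curves on a complex manifold $M$ with singular set $E\subset M$, let $g$ be a hermitian metric on $M$, and let $\eta:M\setminus E\to(0,\infty)$ be the modulus of uniformization of $\mathcal F$. Suppose that the space of uniformizations $\mathcal U$ is NCP. Suppose that for each $q\in E$ there exist a neighbourhood $U_q$ of $q$ in $M$ and a local $\mathcal F$-invariant hypersurface $\Sigma_q=\{f_q=0\}$ such that $q\in\Sigma_q\subset U_q$. Then $\eta$ is continuous on $$M\setminus\bigcup_{p\in\bigcup_{q\in E}\Sigma_q}L_p .$$
   Context: A singular holomorphic foliation by curves (shfc) $\mathcal F$ on a complex manifold $M$ with singular set $E$ is a foliation locally generated by holomorphic vector fields whose zero set is $E$, where $E\subset M$ is a complex analytic set of codimension at least $2$; it is a nonsingular holomorphic foliation by Riemann surfaces on $M\setminus E$. Leaves are the leaves on $M\setminus E$; $L_p$ is the leaf through $p\in M\setminus E$, and by convention $L_p=\{p\}$ for $p\in E$. $\mathcal F$ is hyperbolic if every leaf is a hyperbolic Riemann surface (universally covered by the unit disc $\mathbb D$). Modulus of uniformization: let $\mathcal O(\mathbb D,\mathcal F)$ be the set of holomorphic maps $f:\mathbb D\to M\setminus E$ whose image lies in a single leaf. For $z\in M\setminus E$, $\eta(z)=\sup\{|f'(0)|_g : f\in\mathcal O(\mathbb D,\mathcal F),\ f(0)=z\}$, where $|\cdot|_g$ is the length with respect to $g$. "$\eta$ is continuous on $A\subset M\setminus E$" means that $\eta:M\setminus E\to(0,\infty)$ is continuous at each point of $A$.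 $\mathcal U=\{\alpha\in\mathcal O(\mathbb D,\mathcal F): \alpha \text{ is a uniformization (universal covering map) of a leaf of }\mathcal F\}$. $\mathcal U$ is NCP (normal on compact parts) if for every $\mathcal H\subset\mathcal U$ with $\{\alpha(0):\alpha\in\mathcal H\}$ relatively compact in $M$, the family $\mathcal H$ is normal, i.e. every sequence in $\mathcal H$ has a subsequence converging uniformly on compact subsets of $\mathbb D$ to a holomorphic map $\mathbb D\to M$. A local $\mathcal F$-invariant hypersurface in $U_q$ is an analytic hypersurface $\Sigma_q=\{f_q=0\}$ of $U_q$, with $f_q$ holomorphic on $U_q$, such that for each $p\in\Sigma_q\setminus E$ the leaf through $p$ of the restricted foliation $\mathcal F|_{U_q}$ is contained in $\Sigma_q$. *)

theory Defs
  imports "HOL-Complex_Analysis.Complex_Analysis"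
begin

section \<open>Holomorphic functions of several variables, complex manifolds\<close>

definition holomorphic_fun_on :: "(complex^'n::finite \<Rightarrow> complex) \<Rightarrow> (complex^'n) set \<Rightarrow> bool" where
  "holomorphic_fun_on f S \<longleftrightarrow>
     (\<forall>x\<in>S. \<exists>a::complex^'n. (f has_derivative (\<lambda>v. \<Sum>i\<in>UNIV. a $ i * v $ i)) (at x))"

definition holomorphic_map_on ::
    "(complex^'n::finite \<Rightarrow> complex^'k::finite) \<Rightarrow> (complex^'n) set \<Rightarrow> bool" where
  "holomorphic_map_on f S \<longleftrightarrow> (\<forall>i. holomorphic_fun_on (\<lambda>x. f x $ i) S)"

definition biholomorphic_on :: "(complex^'n::finite \<Rightarrow> complex^'n) \<Rightarrow> (complex^'n) set \<Rightarrow> bool" where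
  "biholomorphic_on f S \<longleftrightarrow> open S \<and> open (f ` S) \<and> inj_on f S \<and>
     holomorphic_map_on f S \<and> holomorphic_map_on (inv_into S f) (f ` S)"

type_synonym ('m, 'n) chart = "'m set \<times> ('m \<Rightarrow> complex^'n)"

text \<open>The manifold is the whole type \<open>'m\<close>; its sort supplies the usual Hausdorff and
  second countability assumptions. The complex dimension is \<open>CARD('n)\<close>. A coordinate map
  is only meaningful on its domain.\<close>

definition complex_atlas ::
    "('m::{t2_space, second_countable_topology}, 'n::finite) chart set \<Rightarrow> bool" where
  "complex_atlas A \<longleftrightarrow>
     (\<forall>p. \<exists>(U, \<phi>)\<in>A. p \<in> U) \<and>
     (\<forall>(U, \<phi>)\<in>A. open U \<and> open (\<phi> ` U) \<and> homeomorphism U (\<phi> ` U) \<phi> (inv_into U \<phi>)) \<and>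
     (\<forall>(U, \<phi>)\<in>A. \<forall>(V, \<psi>)\<in>A. holomorphic_map_on (\<psi> \<circ> inv_into U \<phi>) (\<phi> ` (U \<inter> V)))"

text \<open>\<open>change_coords (U, \<phi>) (V, \<psi>) p v\<close>: coordinates with respect to \<open>\<psi>\<close> of the tangent vector
  at \<open>p \<in> U \<inter> V\<close> whose coordinates with respect to \<open>\<phi>\<close> are \<open>v\<close>.\<close>

definition change_coords ::
    "('m, 'n::finite) chart \<Rightarrow> ('m, 'n) chart \<Rightarrow> 'm \<Rightarrow> complex^'n \<Rightarrow> complex^'n" where
  "change_coords c d p =
     frechet_derivative (snd d \<circ> inv_into (fst c) (snd c)) (at (snd c p))"

definition holomorphic_fun_in ::
    "('m::topological_space, 'n::finite) chart set \<Rightarrow> 'm set \<Rightarrow> ('m \<Rightarrow> complex) \<Rightarrow> bool" where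
  "holomorphic_fun_in A W f \<longleftrightarrow>
     (\<forall>(U, \<phi>)\<in>A. holomorphic_fun_on (f \<circ> inv_into U \<phi>) (\<phi> ` (U \<inter> W)))"

definition holomorphic_curve_on ::
    "('m::topological_space, 'n::finite) chart set \<Rightarrow> complex set \<Rightarrow> (complex \<Rightarrow> 'm) \<Rightarrow> bool" where
  "holomorphic_curve_on A S f \<longleftrightarrow> continuous_on S f \<and>
     (\<forall>(U, \<phi>)\<in>A. \<forall>i. (\<lambda>z. \<phi> (f z) $ i) holomorphic_on {z \<in> S. f z \<in> U})"


section \<open>Analytic subsets\<close>

definition analytic_set :: "('m::topological_space, 'n::finite) chart set \<Rightarrow> 'm set \<Rightarrow> bool" where
  "analytic_set A Z \<longleftrightarrow> (\<forall>p. \<exists>W fs. open W \<and> p \<in> W \<and> finite fs \<and>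
     (\<forall>f\<in>fs. holomorphic_fun_in A W f) \<and> Z \<inter> W = {x\<in>W. \<forall>f\<in>fs. f x = 0})"

text \<open>\<open>Z\<close> is, near \<open>p \<in> Z\<close>, a complex submanifold of codimension \<open>k\<close>: in suitable holomorphic
  coordinates it is a coordinate subspace.\<close>

definition regular_point_of_codim ::
    "('m::topological_space, 'n::finite) chart set \<Rightarrow> 'm set \<Rightarrow> 'm \<Rightarrow> nat \<Rightarrow> bool" where
  "regular_point_of_codim A Z p k \<longleftrightarrow> p \<in> Z \<and>
     (\<exists>(U, \<phi>)\<in>A. \<exists>W \<psi> I. open W \<and> p \<in> W \<and> W \<subseteq> U \<and> biholomorphic_on \<psi> (\<phi> ` W) \<and>
        card (I :: 'n set) = k \<and>
        (\<psi> \<circ> \<phi>) ` (Z \<inter> W) = {y \<in> (\<psi> \<circ> \<phi>) ` W. \<forall>i\<in>I. y $ i = 0})"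

text \<open>The dimension of an analytic set is by definition the largest dimension it has at a regular
  point (regular points are dense).\<close>

definition codim_at_least ::
    "('m::topological_space, 'n::finite) chart set \<Rightarrow> 'm set \<Rightarrow> nat \<Rightarrow> bool" where
  "codim_at_least A Z k \<longleftrightarrow> (\<forall>p j. regular_point_of_codim A Z p j \<longrightarrow> k \<le> j)"


section \<open>Singular holomorphic foliations by curves\<close>

text \<open>A foliation is given by local generators: \<open>(c, W, X)\<close> stands for the vector field on the
  open set \<open>W\<close> whose value at \<open>p\<close> has the coordinates \<open>X p\<close> with respect to the chart \<open>c\<close>.
  Two families with the same directions off the singular set give the same foliation.\<close>

type_synonym ('m, 'n) generator = "('m, 'n) chart \<times> 'm set \<times> ('m \<Rightarrow> complex^'n)"

definition shfc ::
    "('m::topological_space, 'n::finite) chart set \<Rightarrow> 'm set \<Rightarrow> ('m, 'n) generator set \<Rightarrow> bool" where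
  "shfc A E F \<longleftrightarrow>
     analytic_set A E \<and> codim_at_least A E 2 \<and>
     (\<forall>p. \<exists>(c, W, X)\<in>F. p \<in> W) \<and>
     (\<forall>(c, W, X)\<in>F. c \<in> A \<and> open W \<and> W \<subseteq> fst c \<and>
        (\<forall>i. holomorphic_fun_in A W (\<lambda>p. X p $ i)) \<and> {p\<in>W. X p = 0} = E \<inter> W) \<and>
     (\<forall>(c, W, X)\<in>F. \<forall>(d, V, Y)\<in>F. \<forall>p\<in>W \<inter> V - E.
        \<exists>a. a \<noteq> 0 \<and> Y p = a *s change_coords c d p (X p))"

definition restrict_foliation ::
    "('m, 'n::finite) generator set \<Rightarrow> 'm set \<Rightarrow> ('m, 'n) generator set" where
  "restrict_foliation F V = (\<lambda>(c, W, X). (c, W \<inter> V, X)) ` F"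

definition plaque :: "'m set \<Rightarrow> ('m, 'n::finite) generator set \<Rightarrow> 'm set \<Rightarrow> bool" where
  "plaque E F P \<longleftrightarrow> (\<exists>((U, \<phi>), W, X)\<in>F. \<exists>\<gamma> r. 0 < r \<and> \<gamma> ` ball (0::complex) r \<subseteq> W - E \<and>
     (\<forall>t\<in>ball 0 r. \<forall>i. ((\<lambda>s. \<phi> (\<gamma> s) $ i) has_field_derivative X (\<gamma> t) $ i) (at t)) \<and>
     P = \<gamma> ` ball 0 r)"

text \<open>The leaf topology on the complement of \<open>E\<close>, for which the small integral curves are a basis;
  it is in general strictly finer than the topology of the manifold. The leaves are its
  connected components.\<close>

definition leaf_topology :: "'m set \<Rightarrow> ('m, 'n::finite) generator set \<Rightarrow> 'm topology" where
  "leaf_topology E F = topology_generated_by (Collect (plaque E F))"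

definition leaf :: "'m set \<Rightarrow> ('m, 'n::finite) generator set \<Rightarrow> 'm \<Rightarrow> 'm set" where
  "leaf E F p = (if p \<in> E then {p} else connected_component_of_set (leaf_topology E F) p)"

definition invariant_hypersurface ::
    "('m::topological_space, 'n::finite) chart set \<Rightarrow> 'm set \<Rightarrow> ('m, 'n) generator set
      \<Rightarrow> 'm set \<Rightarrow> 'm set \<Rightarrow> bool" where
  "invariant_hypersurface A E F U \<Sigma> \<longleftrightarrow>
     (\<exists>f. holomorphic_fun_in A U f \<and>
        (\<forall>V. open V \<and> V \<noteq> {} \<and> V \<subseteq> U \<longrightarrow> (\<exists>x\<in>V. f x \<noteq> 0)) \<and>
        \<Sigma> = {x\<in>U. f x = 0}) \<and>
     (\<forall>p\<in>\<Sigma> - E. leaf E (restrict_foliation F U) p \<subseteq> \<Sigma>)"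


section \<open>Uniformizations\<close>

text \<open>The analogue of \<^const>\<open>covering_space\<close> for abstract topologies. It is needed because a leaf
  carries the leaf topology, not the subspace topology.\<close>

definition covering_map_top :: "'a topology \<Rightarrow> 'b topology \<Rightarrow> ('a \<Rightarrow> 'b) \<Rightarrow> bool" where
  "covering_map_top X Y p \<longleftrightarrow>
     continuous_map X Y p \<and> p ` topspace X = topspace Y \<and>
     (\<forall>y\<in>topspace Y. \<exists>T. openin Y T \<and> y \<in> T \<and>
        (\<exists>\<V>. \<Union>\<V> = {x \<in> topspace X. p x \<in> T} \<and> (\<forall>V\<in>\<V>. openin X V) \<and> pairwise disjnt \<V> \<and>
           (\<forall>V\<in>\<V>. homeomorphic_map (subtopology X V) (subtopology Y T) p)))"

text \<open>Maps on the unit disc are total functions; only their values on \<open>ball 0 1\<close> matter.\<close>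

definition discs ::
    "('m::topological_space, 'n::finite) chart set \<Rightarrow> 'm set \<Rightarrow> ('m, 'n) generator set
      \<Rightarrow> (complex \<Rightarrow> 'm) set" where
  "discs A E F =
     {f. holomorphic_curve_on A (ball 0 1) f \<and> (\<exists>p\<in>-E. f ` ball 0 1 \<subseteq> leaf E F p)}"

text \<open>The covering is universal because the disc is simply connected.\<close>

definition uniformization_of ::
    "('m::topological_space, 'n::finite) chart set \<Rightarrow> 'm set \<Rightarrow> ('m, 'n) generator set
      \<Rightarrow> 'm \<Rightarrow> (complex \<Rightarrow> 'm) \<Rightarrow> bool" where
  "uniformization_of A E F p \<alpha> \<longleftrightarrow> \<alpha> \<in> discs A E F \<and>
     covering_map_top (top_of_set (ball 0 1)) (subtopology (leaf_topology E F) (leaf E F p)) \<alpha>"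

definition uniformizations ::
    "('m::topological_space, 'n::finite) chart set \<Rightarrow> 'm set \<Rightarrow> ('m, 'n) generator set
      \<Rightarrow> (complex \<Rightarrow> 'm) set" where
  "uniformizations A E F = {\<alpha>. \<exists>p\<in>-E. uniformization_of A E F p \<alpha>}"

definition hyperbolic_foliation ::
    "('m::topological_space, 'n::finite) chart set \<Rightarrow> 'm set \<Rightarrow> ('m, 'n) generator set \<Rightarrow> bool" where
  "hyperbolic_foliation A E F \<longleftrightarrow> (\<forall>p\<in>-E. \<exists>\<alpha>. uniformization_of A E F p \<alpha>)"

text \<open>Uniform convergence on compact sets is taken with respect to a metric inducing the topology of
  the manifold; since the limits below are continuous, the choice of the metric is irrelevant.\<close>

definition compactly_convergent_on ::
    "complex set \<Rightarrow> (nat \<Rightarrow> complex \<Rightarrow> 'm::topological_space) \<Rightarrow> (complex \<Rightarrow> 'm) \<Rightarrow> bool" where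
  "compactly_convergent_on S \<sigma> f \<longleftrightarrow>
     (\<exists>d. Metric_space UNIV d \<and> Metric_space.mtopology UNIV d = euclidean \<and>
        (\<forall>K. compact K \<and> K \<subseteq> S \<longrightarrow>
           (\<forall>\<epsilon>>0. \<forall>\<^sub>F k in sequentially. \<forall>z\<in>K. d (\<sigma> k z) (f z) < \<epsilon>)))"

definition normal_family ::
    "('m::topological_space, 'n::finite) chart set \<Rightarrow> (complex \<Rightarrow> 'm) set \<Rightarrow> bool" where
  "normal_family A H \<longleftrightarrow>
     (\<forall>\<sigma>. range \<sigma> \<subseteq> H \<longrightarrow>
        (\<exists>r f. strict_mono (r :: nat \<Rightarrow> nat) \<and> holomorphic_curve_on A (ball 0 1) f \<and>
           compactly_convergent_on (ball 0 1) (\<sigma> \<circ> r) f))"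

definition NCP ::
    "('m::topological_space, 'n::finite) chart set \<Rightarrow> (complex \<Rightarrow> 'm) set \<Rightarrow> bool" where
  "NCP A \<U> \<longleftrightarrow>
     (\<forall>H\<subseteq>\<U>. compact (closure ((\<lambda>\<alpha>. \<alpha> 0) ` H)) \<longrightarrow> normal_family A H)"


section \<open>Hermitian metrics and the modulus of uniformization\<close>

primrec Ck_on ::
    "nat \<Rightarrow> ('a::real_normed_vector \<Rightarrow> 'b::real_normed_vector) \<Rightarrow> 'a set \<Rightarrow> bool" where
  "Ck_on 0 = (\<lambda>f S. continuous_on S f)"
| "Ck_on (Suc k) = (\<lambda>f S. (\<forall>x\<in>S. f differentiable (at x)) \<and>
     (\<forall>v. Ck_on k (\<lambda>x. frechet_derivative f (at x) v) S))"

definition hermitian_inner_product :: "(complex^'n::finite \<Rightarrow> complex^'n \<Rightarrow> complex) \<Rightarrow> bool" where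
  "hermitian_inner_product B \<longleftrightarrow>
     (\<forall>a u v w. B (a *s u + v) w = a * B u w + B v w) \<and>
     (\<forall>v w. B w v = cnj (B v w)) \<and>
     (\<forall>v. v \<noteq> 0 \<longrightarrow> Re (B v v) > 0)"

text \<open>\<open>g c p\<close> is the inner product on the tangent space at \<open>p\<close>, in the coordinates of the chart
  \<open>c\<close>.\<close>

definition hermitian_metric ::
    "('m::topological_space, 'n::finite) chart set
      \<Rightarrow> (('m, 'n) chart \<Rightarrow> 'm \<Rightarrow> complex^'n \<Rightarrow> complex^'n \<Rightarrow> complex) \<Rightarrow> bool" where
  "hermitian_metric A g \<longleftrightarrow>
     (\<forall>c\<in>A. \<forall>p\<in>fst c. hermitian_inner_product (g c p)) \<and>
     (\<forall>(U, \<phi>)\<in>A. \<forall>v w k. Ck_on k (\<lambda>x. g (U, \<phi>) (inv_into U \<phi> x) v w) (\<phi> ` U)) \<and>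
     (\<forall>c\<in>A. \<forall>d\<in>A. \<forall>p\<in>fst c \<inter> fst d. \<forall>v w.
        g c p v w = g d p (change_coords c d p v) (change_coords c d p w))"

text \<open>The length of \<open>f'(0)\<close>, computed in some chart around \<open>f 0\<close>; by the transformation law of the
  metric it does not depend on the chart.\<close>

definition initial_speed ::
    "('m, 'n::finite) chart set \<Rightarrow> (('m, 'n) chart \<Rightarrow> 'm \<Rightarrow> complex^'n \<Rightarrow> complex^'n \<Rightarrow> complex)
      \<Rightarrow> (complex \<Rightarrow> 'm) \<Rightarrow> real" where
  "initial_speed A g f =
     (let c = (SOME c. c \<in> A \<and> f 0 \<in> fst c);
          v = (\<chi> i. deriv (\<lambda>t. snd c (f t) $ i) 0)
      in sqrt (Re (g c (f 0) v v)))"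

text \<open>For a hyperbolic foliation the supremum is over a nonempty bounded set (Schwarz lemma).\<close>

definition modulus_of_uniformization ::
    "('m::topological_space, 'n::finite) chart set \<Rightarrow> 'm set \<Rightarrow> ('m, 'n) generator set
      \<Rightarrow> (('m, 'n) chart \<Rightarrow> 'm \<Rightarrow> complex^'n \<Rightarrow> complex^'n \<Rightarrow> complex) \<Rightarrow> 'm \<Rightarrow> real" where
  "modulus_of_uniformization A E F g z =
     (SUP f\<in>{f \<in> discs A E F. f 0 = z}. initial_speed A g f)"

end

theory Submission
  imports Defs
begin

text \<open>
  By the Schwarz lemma, \<open>\<eta> (\<alpha> w) = |\<alpha>' w| (1 - |w|\<^sup>2)\<close> for every uniformization \<open>\<alpha>\<close>. Let \<open>z\<close> be a
  point of the asserted set and \<open>z\<^sub>n\<close> a sequence converging to \<open>z\<close>. By NCP the uniformizations at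
  \<open>z\<^sub>n\<close> subconverge. If the limit met \<open>E\<close> at \<open>q\<close>, Hurwitz' theorem applied to the equation of the
  invariant hypersurface would place a piece of the limit inside \<open>\<Sigma> q\<close>, and \<open>z\<close> would lie on a leaf
  through \<open>\<Sigma> q\<close>; so the limit is a disc in the leaf of \<open>z\<close>, which gives upper semicontinuity.

  For lower semicontinuity, let \<open>m\<close> be the lower semicontinuous envelope of \<open>\<eta>\<close>; it is positive because
  integral curves exist for a locally uniform time. Let \<open>\<alpha>\<close> uniformize the leaf of \<open>z\<close>, let \<open>r < 1\<close>, and
  let \<open>w\<close> maximize \<open>|\<alpha>' w| (r\<^sup>2 - |w|\<^sup>2) / m (\<alpha> w)\<close> over \<open>|w| \<le> r\<close>. A limit disc at \<open>\<alpha> w\<close> along a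
  sequence realizing \<open>m (\<alpha> w)\<close> is \<open>\<alpha> \<circ> h\<close> for a self-map \<open>h\<close> of the unit disc, and its hyperbolic
  derivative as a map into the disc of radius \<open>r\<close> has a local minimum at \<open>0\<close>. By the maximum principle
  for \<open>1 / h'\<close> this minimum is at least \<open>1\<close>, whence \<open>r \<eta> z \<le> m z\<close>.
\<close>

text \<open>NCP yields a limit disc \<open>f\<close> in the leaf of \<open>z\<close>, but nothing
  makes \<open>f\<close> a covering: it is \<open>\<alpha> \<circ> h\<close>, and a contracting
  \<open>h\<close> would let \<open>\<eta>\<close> drop along the sequence. This is the obstacle to
  lower semicontinuity. The value at the centre cannot exclude it, so the envelope is compared along
  the whole limit disc: \<open>m (f s)\<close> is at most the speed of \<open>f\<close> at
  \<open>s\<close> times \<open>1 - |s|\<^sup>2\<close>, with equality at \<open>s = 0\<close>. The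
  radius \<open>r < 1\<close> gives a compact disc on which the upper semicontinuous quotient has a
  maximum, the factor vanishing for \<open>|w| = r\<close> makes boundary maxima harmless, and at
  the end \<open>r\<close> tends to 1. A second obstacle: a member of \<open>discs\<close> is
  continuous only for the manifold topology and lies in a leaf only as a set, whereas lifting
  through \<open>\<alpha>\<close> requires continuity for the finer leaf topology. The proof
  therefore works with tangency to the foliation, which implies leaf continuity, passes to limits
  outside \<open>E\<close> and propagates by the identity theorem; a Baire argument provides it for
  discs.\<close>

no_notation fps_nth (infixl "$" 75)

section \<open>Holomorphic functions and vector fields in several variables\<close>

lemma norm_vector_scalar_mult: "norm (c *s v) = norm c * norm (v :: complex^'n::finite)"
  unfolding norm_vec_def by (simp add: L2_set_right_distrib norm_mult)

lemma norm_le_sum_norm_nth: "norm (v :: complex^'n::finite) \<le> (\<Sum>i\<in>UNIV. norm (v $ i))"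
  unfolding norm_vec_def by (rule L2_set_le_sum) simp

lemma bounded_linear_scalar_mult: "bounded_linear (\<lambda>h. h *s (v :: complex^'n::finite))"
  by (rule bounded_linear_intro[where K = "norm v"])
    (auto simp: vec_eq_iff algebra_simps norm_vector_scalar_mult)

lemma has_derivative_vecI:
  fixes f :: "'a::real_normed_vector \<Rightarrow> complex^'n::finite"
  assumes "bounded_linear f'"
    and "\<And>i. ((\<lambda>x. f x $ i) has_derivative (\<lambda>h. f' h $ i)) (at x within S)"
  shows "(f has_derivative f') (at x within S)"
  using assms unfolding has_derivative_def by (auto intro!: vec_tendstoI)

lemma has_derivative_curveI:
  fixes y :: "complex \<Rightarrow> complex^'n::finite"
  assumes "\<And>i. ((\<lambda>s. y s $ i) has_field_derivative v $ i) (at t)"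
  shows "(y has_derivative (\<lambda>h. h *s v)) (at t)"
  using assms
  by (intro has_derivative_vecI bounded_linear_scalar_mult)
     (simp add: has_field_derivative_def mult.commute[of _ "v $ _"])

lemma has_field_derivative_compose_curve:
  fixes y :: "complex \<Rightarrow> complex^'n::finite" and f :: "complex^'n \<Rightarrow> complex"
  assumes "(f has_derivative (\<lambda>v. \<Sum>i\<in>UNIV. a $ i * v $ i)) (at (y t))"
    and "\<And>i. ((\<lambda>s. y s $ i) has_field_derivative v $ i) (at t)"
  shows "((\<lambda>s. f (y s)) has_field_derivative (\<Sum>i\<in>UNIV. a $ i * v $ i)) (at t)"
proof -
  have "((\<lambda>s. f (y s)) has_derivative (\<lambda>h. \<Sum>i\<in>UNIV. a $ i * (h *s v) $ i)) (at t)"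
    using has_derivative_compose[OF has_derivative_curveI[OF assms(2)] assms(1)] .
  also have "(\<lambda>h. \<Sum>i\<in>UNIV. a $ i * (h *s v) $ i) = (*) (\<Sum>i\<in>UNIV. a $ i * v $ i)"
    by (auto simp: sum_distrib_left sum_distrib_right algebra_simps)
  finally show ?thesis by (simp add: has_field_derivative_def)
qed

lemma holomorphic_on_compose_curve:
  fixes y :: "complex \<Rightarrow> complex^'n::finite"
  assumes f: "holomorphic_fun_on f \<Omega>" and S: "open S" "y ` S \<subseteq> \<Omega>"
    and y: "\<And>i. (\<lambda>s. y s $ i) holomorphic_on S"
  shows "(\<lambda>s. f (y s)) holomorphic_on S"
proof -
  have "(\<lambda>s. f (y s)) field_differentiable at t" if "t \<in> S" for t
  proof -
    have "y t \<in> \<Omega>" using S(2) that by auto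
    from bspec[OF f[unfolded holomorphic_fun_on_def] this]
    obtain a where a: "(f has_derivative (\<lambda>v. \<Sum>i\<in>UNIV. a $ i * v $ i)) (at (y t))" ..
    define v where "v = (\<chi> i. deriv (\<lambda>s. y s $ i) t)"
    have v: "\<And>i. ((\<lambda>s. y s $ i) has_field_derivative v $ i) (at t)"
      using holomorphic_derivI[OF y S(1) that] by (simp add: v_def)
    show ?thesis
      unfolding field_differentiable_def
      using has_field_derivative_compose_curve[of f a y t v, OF a v] by (rule exI)
  qed
  then show ?thesis
    by (simp add: S(1) holomorphic_on_open field_differentiable_def)
qed

lemma holomorphic_fun_on_imp_continuous_on: "holomorphic_fun_on f S \<Longrightarrow> continuous_on S f"
  unfolding holomorphic_fun_on_def
  by (meson continuous_at_imp_continuous_on has_derivative_continuous)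

text \<open>\<open>holomorphic_fun_on\<close> grants a complex linear derivative at each point but
  says nothing about its continuity, so the Lipschitz constant comes from Cauchy's estimate on the
  complex line through the two points.\<close>

lemma holomorphic_fun_on_locally_lipschitz:
  fixes f :: "complex^'n::finite \<Rightarrow> complex"
  assumes f: "holomorphic_fun_on f \<Omega>" and \<Omega>: "open \<Omega>" "x0 \<in> \<Omega>"
  obtains \<delta> L where "0 < \<delta>" "0 \<le> L" "ball x0 \<delta> \<subseteq> \<Omega>"
    "\<And>x y. \<lbrakk>x \<in> ball x0 \<delta>; y \<in> ball x0 \<delta>\<rbrakk> \<Longrightarrow> cmod (f x - f y) \<le> L * norm (x - y)"
proof -
  obtain e where e: "0 < e" "cball x0 (8 * e) \<subseteq> \<Omega>"
  proof -
    obtain e where "0 < e" "cball x0 e \<subseteq> \<Omega>"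
      using \<Omega> open_contains_cball by blast
    then show ?thesis by (intro that[of "e/8"]) auto
  qed
  \<comment> \<open>The radii: points of the line stay within \<open>e + 6 * e\<close> of
    \<open>x0\<close>, circles of radius \<open>e\<close> about parameters in
    \<open>ball 0 (3 * e)\<close> stay in \<open>ball 0 (6 * e)\<close>, and the two points are less
    than \<open>2 * e\<close> apart.\<close>
  have "compact (f ` cball x0 (8 * e))"
    using e by (intro compact_continuous_image continuous_on_subset[OF
        holomorphic_fun_on_imp_continuous_on[OF f]]) auto
  then obtain B where B: "0 < B" "\<And>x. x \<in> cball x0 (8 * e) \<Longrightarrow> cmod (f x) \<le> B"
    using compact_imp_bounded bounded_pos by (metis (no_types, lifting) imageI)
  have "cmod (f y - f x) \<le> (B / e) * norm (y - x)" if x: "x \<in> ball x0 e" and y: "y \<in> ball x0 e" for x y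
  proof (cases "x = y")
    case False
    define u where "u = (1 / norm (y - x)) *\<^sub>R (y - x)"
    have u: "norm u = 1" using False by (simp add: u_def)
    define l where "l = (\<lambda>\<zeta>. x + \<zeta> *s u)"
    define G where "G = (\<lambda>\<zeta>. f (l \<zeta>))"
    have l: "l \<zeta> \<in> cball x0 (8 * e)" if "cmod \<zeta> \<le> 6 * e" for \<zeta>
    proof -
      have "dist x0 (l \<zeta>) \<le> dist x0 x + norm (\<zeta> *s u)"
        unfolding l_def by (metis add_diff_cancel_left' dist_norm dist_triangle norm_minus_commute)
      also have "\<dots> \<le> e + 6 * e" using x that u by (simp add: norm_vector_scalar_mult)
      finally show ?thesis using e by simp
    qed
    have hol: "G holomorphic_on ball 0 (6 * e)"
      unfolding G_def
    proof (rule holomorphic_on_compose_curve[OF f])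
      show "l ` ball 0 (6 * e) \<subseteq> \<Omega>" using l e by force
    qed (auto simp: l_def intro!: holomorphic_intros)
    have d: "cmod (deriv G \<zeta>) \<le> B / e" if "\<zeta> \<in> ball 0 (3 * e)" for \<zeta>
    proof -
      have sub: "cball \<zeta> e \<subseteq> ball 0 (6 * e)"
      proof
        fix \<xi> assume "\<xi> \<in> cball \<zeta> e"
        then show "\<xi> \<in> ball 0 (6 * e)"
          using that norm_triangle_ineq[of \<zeta> "\<xi> - \<zeta>"] e by (auto simp: dist_norm norm_minus_commute)
      qed
      have "cmod ((deriv ^^ 1) G \<zeta>) \<le> fact 1 * B / e ^ 1"
      proof (rule Cauchy_inequality)
        show "G holomorphic_on ball \<zeta> e" "continuous_on (cball \<zeta> e) G"
          using hol sub holomorphic_on_subset ball_subset_cball holomorphic_on_imp_continuous_on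
          by (metis order_trans, metis)
        show "cmod (G \<xi>) \<le> B" if "cmod (\<zeta> - \<xi>) = e" for \<xi>
        proof -
          have "\<xi> \<in> cball \<zeta> e" using that by (simp add: dist_norm)
          then have "cmod \<xi> \<le> 6 * e" using sub by force
          then show ?thesis unfolding G_def by (rule B(2)[OF l])
        qed
      qed (use e in auto)
      then show ?thesis by simp
    qed
    have n: "cmod (of_real (norm (y - x))) < 3 * e"
    proof -
      have "norm (y - x) \<le> dist y x0 + dist x0 x" by (metis dist_norm dist_triangle)
      then show ?thesis using x y e by (simp add: dist_commute)
    qed
    have "cmod (G (of_real (norm (y - x))) - G 0) \<le> (B / e) * cmod (of_real (norm (y - x)) - 0)"
    proof (rule field_differentiable_bound[of "ball 0 (3 * e)" G "deriv G"])
      show "(G has_field_derivative deriv G z) (at z within ball 0 (3 * e))"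
        if "z \<in> ball 0 (3 * e)" for z
        using that e by (intro has_field_derivative_at_within[OF holomorphic_derivI[OF hol]]) auto
    qed (use d n e in auto)
    moreover have "l (of_real (norm (y - x))) = y" "l 0 = x"
      using False by (auto simp: l_def u_def vec_eq_iff scaleR_conv_of_real[of _ "_ :: complex"])
    ultimately show ?thesis by (simp add: G_def)
  qed auto
  note lip = this
  show ?thesis
  proof (rule that[of e "B / e"])
    show "ball x0 e \<subseteq> \<Omega>"
      using e by (auto simp: subset_iff)
    show "cmod (f x - f y) \<le> B / e * norm (x - y)" if "x \<in> ball x0 e" "y \<in> ball x0 e" for x y
      by (rule lip[OF that(2,1)])
    show "0 < e" "0 \<le> B / e" using e B(1) by simp_all
  qed
qed

lemma holomorphic_field_locally_lipschitz:
  fixes X :: "complex^'n::finite \<Rightarrow> complex^'n"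
  assumes X: "holomorphic_map_on X \<Omega>" and \<Omega>: "open \<Omega>" "x0 \<in> \<Omega>"
  obtains \<delta> L where "0 < \<delta>" "0 < L" "ball x0 \<delta> \<subseteq> \<Omega>"
    "\<And>x y i. \<lbrakk>x \<in> ball x0 \<delta>; y \<in> ball x0 \<delta>\<rbrakk> \<Longrightarrow> cmod (X x $ i - X y $ i) \<le> L * norm (x - y)"
proof -
  have "\<forall>i. \<exists>\<delta> L. 0 < \<delta> \<and> 0 \<le> L \<and> ball x0 \<delta> \<subseteq> \<Omega> \<and>
    (\<forall>x\<in>ball x0 \<delta>. \<forall>y\<in>ball x0 \<delta>. cmod (X x $ i - X y $ i) \<le> L * norm (x - y))"
  proof
    fix i
    have "holomorphic_fun_on (\<lambda>x. X x $ i) \<Omega>" using X by (simp add: holomorphic_map_on_def)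
    from holomorphic_fun_on_locally_lipschitz[OF this \<Omega>]
    show "\<exists>\<delta> L. 0 < \<delta> \<and> 0 \<le> L \<and> ball x0 \<delta> \<subseteq> \<Omega> \<and>
      (\<forall>x\<in>ball x0 \<delta>. \<forall>y\<in>ball x0 \<delta>. cmod (X x $ i - X y $ i) \<le> L * norm (x - y))" by metis
  qed
  then obtain \<delta> L where *: "\<And>i. 0 < \<delta> i" "\<And>i. 0 \<le> L i" "\<And>i. ball x0 (\<delta> i) \<subseteq> \<Omega>"
    "\<And>i x y. \<lbrakk>x \<in> ball x0 (\<delta> i); y \<in> ball x0 (\<delta> i)\<rbrakk> \<Longrightarrow> cmod (X x $ i - X y $ i) \<le> L i * norm (x - y)"
    by metis
  define d where "d = Min (range \<delta>)"
  \<comment> \<open>The summand 1 makes the constant strictly positive, since later time bounds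
    divide by it.\<close>
  define K where "K = (\<Sum>i\<in>UNIV. L i) + 1"
  have d: "0 < d" "\<And>i. d \<le> \<delta> i" using *(1) by (auto simp: d_def)
  have "L i \<le> (\<Sum>i\<in>UNIV. L i)" for i
    by (rule member_le_sum) (use *(2) in auto)
  moreover have "0 \<le> (\<Sum>i\<in>UNIV. L i)" by (rule sum_nonneg) (rule *(2))
  ultimately have K: "0 < K" "\<And>i. L i \<le> K"
    by (simp_all add: K_def add_increasing2)
  show ?thesis
  proof (rule that[OF d(1) K(1)])
    show "ball x0 d \<subseteq> \<Omega>" using *(3) d(2) by (meson order_trans subset_ball)
    fix x y i assume "x \<in> ball x0 d" "y \<in> ball x0 d"
    then have "cmod (X x $ i - X y $ i) \<le> L i * norm (x - y)"
      using *(4) d(2)[of i] by (metis mem_ball order_less_le_trans)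
    also have "\<dots> \<le> K * norm (x - y)" using K(2) by (simp add: mult_right_mono)
    finally show "cmod (X x $ i - X y $ i) \<le> K * norm (x - y)" .
  qed
qed


section \<open>Holomorphic differential equations: local uniqueness and existence\<close>

lemma curve_mean_value:
  fixes w :: "complex \<Rightarrow> complex^'n::finite"
  assumes d: "\<And>t i. t \<in> ball s0 e \<Longrightarrow> ((\<lambda>s. w s $ i) has_field_derivative w' t i) (at t)"
    and K: "\<And>t i. t \<in> ball s0 e \<Longrightarrow> cmod (w' t i) \<le> K"
    and s: "s \<in> ball s0 e"
  shows "norm (w s - w s0) \<le> real CARD('n) * K * cmod (s - s0)"
proof -
  have "cmod (w s $ i - w s0 $ i) \<le> K * cmod (s - s0)" for i
    by (rule field_differentiable_bound[of "ball s0 e" "\<lambda>s. w s $ i" "\<lambda>t. w' t i"])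
      (use s K d[THEN has_field_derivative_at_within] le_less_trans[OF zero_le_dist] in auto)
  \<comment> \<open>The one-variable bound holds in each coordinate; estimating the norm by the sum
    of the coordinates costs the factor \<open>CARD('n)\<close>.\<close>
  then have "(\<Sum>i\<in>UNIV. norm ((w s - w s0) $ i)) \<le> (\<Sum>i\<in>(UNIV::'n set). K * cmod (s - s0))"
    by (intro sum_mono) simp
  then show ?thesis
    using norm_le_sum_norm_nth[of "w s - w s0"] by simp
qed

lemma continuous_on_curve:
  fixes y :: "complex \<Rightarrow> complex^'n::finite"
  assumes "\<And>t i. t \<in> S \<Longrightarrow> ((\<lambda>s. y s $ i) has_field_derivative y' t i) (at t)"
  shows "continuous_on S y"
proof -
  have "continuous_on S (\<lambda>s. \<chi> i. y s $ i)"
    using assms by (intro continuous_on_vec_lambda DERIV_continuous_on)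
      (blast intro: has_field_derivative_at_within)
  then show ?thesis by simp
qed

lemma holomorphic_primitive_ball:
  assumes "f holomorphic_on ball s0 r"
  obtains P where "P s0 = (c::complex)" "\<And>t. t \<in> ball s0 r \<Longrightarrow> (P has_field_derivative f t) (at t)"
proof -
  obtain P where P: "\<And>x. x \<in> ball s0 r \<Longrightarrow> (P has_field_derivative f x) (at x within ball s0 r)"
    using holomorphic_convex_primitive'[OF convex_ball open_ball assms] by blast
  have "((\<lambda>t. P t - P s0 + c) has_field_derivative f t) (at t)" if "t \<in> ball s0 r" for t
  proof -
    have "(P has_field_derivative f t) (at t)"
      using P[OF that] that by (simp add: at_within_open[OF _ open_ball])
    then show ?thesis
      by (auto intro!: derivative_eq_intros)
  qed
  then show ?thesis by (intro that[of "\<lambda>t. P t - P s0 + c"]) auto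
qed

text \<open>The scalar factor \<open>u\<close> is there in order to compare an arbitrary tangent
  curve with a reparametrized integral curve. If \<open>D\<close> is the supremum of the distance of
  the two solutions on a small ball, the Lipschitz bound and the mean value inequality give
  \<open>D \<le> D / 2\<close>.\<close>

lemma holomorphic_ode_unique:
  fixes X :: "complex^'n::finite \<Rightarrow> complex^'n"
  assumes X: "holomorphic_map_on X \<Omega>" "open \<Omega>"
    and S: "open S" "s0 \<in> S"
    and u: "continuous_on S u"
    and y1: "y1 ` S \<subseteq> \<Omega>" "\<And>t i. t \<in> S \<Longrightarrow> ((\<lambda>s. y1 s $ i) has_field_derivative u t * X (y1 t) $ i) (at t)"
    and y2: "y2 ` S \<subseteq> \<Omega>" "\<And>t i. t \<in> S \<Longrightarrow> ((\<lambda>s. y2 s $ i) has_field_derivative u t * X (y2 t) $ i) (at t)"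
    and eq: "y1 s0 = y2 s0"
  obtains e where "0 < e" "ball s0 e \<subseteq> S" "\<And>s. s \<in> ball s0 e \<Longrightarrow> y1 s = y2 s"
proof -
  have "y1 s0 \<in> \<Omega>" using y1(1) S(2) by auto
  then obtain \<delta> L where L: "0 < \<delta>" "0 < L" "ball (y1 s0) \<delta> \<subseteq> \<Omega>"
    "\<And>x y i. \<lbrakk>x \<in> ball (y1 s0) \<delta>; y \<in> ball (y1 s0) \<delta>\<rbrakk> \<Longrightarrow> cmod (X x $ i - X y $ i) \<le> L * norm (x - y)"
    using holomorphic_field_locally_lipschitz[OF X] by metis
  have c: "continuous_on S y1" "continuous_on S y2"
    by (rule continuous_on_curve[OF y1(2)], assumption) (rule continuous_on_curve[OF y2(2)], assumption)
  let ?T = "(y1 -` ball (y1 s0) \<delta> \<inter> S) \<inter> (y2 -` ball (y1 s0) \<delta> \<inter> S)"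
  have "open (y1 -` ball (y1 s0) \<delta> \<inter> S)" "open (y2 -` ball (y1 s0) \<delta> \<inter> S)"
    using c S(1) by (simp_all add: continuous_on_open_vimage)
  then have "open ?T" by (rule open_Int)
  moreover have "s0 \<in> ?T" using S(2) L(1) eq by simp
  ultimately obtain e1 where e1: "0 < e1" "cball s0 e1 \<subseteq> ?T"
    by (rule open_contains_cball[THEN iffD1, THEN bspec, THEN exE]) auto
  have "compact (u ` cball s0 e1)"
    using e1 by (intro compact_continuous_image continuous_on_subset[OF u]) auto
  then obtain M where M: "0 < M" "\<And>s. s \<in> cball s0 e1 \<Longrightarrow> cmod (u s) \<le> M"
    using compact_imp_bounded bounded_pos by (metis (no_types, lifting) imageI)
  define N where "N = real CARD('n)"
  have N: "0 < N" by (simp add: N_def)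
  \<comment> \<open>The second bound turns the mean value estimate into a contraction:
    \<open>N * M * L * e \<le> 1 / 2\<close>.\<close>
  define e where "e = min e1 (1 / (2 * N * M * L))"
  have e: "0 < e" "ball s0 e \<subseteq> cball s0 e1" using e1 N M L(2) by (auto simp: e_def)
  define W where "W = (\<lambda>s. norm (y1 s - y2 s))"
  define D where "D = (SUP s\<in>ball s0 e. W s)"
  have yb: "y1 s \<in> ball (y1 s0) \<delta>" "y2 s \<in> ball (y1 s0) \<delta>" "s \<in> S" if "s \<in> ball s0 e" for s
    using e1(2) e(2) that by blast+
  have "W s \<le> 2 * \<delta>" if "s \<in> ball s0 e" for s
    using yb[OF that] norm_triangle_ineq4[of "y1 s - y1 s0" "y2 s - y1 s0"]
    by (simp add: W_def dist_norm norm_minus_commute)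
  then have bdd: "bdd_above (W ` ball s0 e)" by (rule bdd_aboveI2)
  have WD: "W s \<le> D" if "s \<in> ball s0 e" for s
    unfolding D_def by (rule cSUP_upper[OF that bdd])
  have D0: "0 \<le> D" using WD[of s0] e by (simp add: W_def eq)
  have half: "W s \<le> D / 2" if s: "s \<in> ball s0 e" for s
  proof -
    have "norm ((y1 s - y2 s) - (y1 s0 - y2 s0)) \<le> real CARD('n) * (M * (L * D)) * cmod (s - s0)"
    proof (rule curve_mean_value[where w = "\<lambda>s. y1 s - y2 s" and e = e
          and w' = "\<lambda>t i. u t * X (y1 t) $ i - u t * X (y2 t) $ i"])
      fix t i assume t: "t \<in> ball s0 e"
      show "((\<lambda>s. (y1 s - y2 s) $ i) has_field_derivative u t * X (y1 t) $ i - u t * X (y2 t) $ i) (at t)"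
        using DERIV_diff[OF y1(2)[OF yb(3)[OF t]] y2(2)[OF yb(3)[OF t]]] by simp
      have "cmod (X (y1 t) $ i - X (y2 t) $ i) \<le> L * D"
        using L(4)[OF yb(1,2)[OF t]] WD[OF t] L(2) unfolding W_def
        by (meson mult_left_mono order_trans less_imp_le)
      then have "cmod (u t) * cmod (X (y1 t) $ i - X (y2 t) $ i) \<le> M * (L * D)"
        using M e t by (intro mult_mono) auto
      then show "cmod (u t * X (y1 t) $ i - u t * X (y2 t) $ i) \<le> M * (L * D)"
        by (simp add: norm_mult[symmetric] right_diff_distrib)
    qed (rule s)
    also have "\<dots> \<le> N * (M * (L * D)) * (1 / (2 * N * M * L))"
      unfolding N_def[symmetric]
      using s N M L D0 by (intro mult_left_mono) (auto simp: dist_norm norm_minus_commute e_def)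
    also have "\<dots> = D / 2" using N M L by (simp add: field_simps)
    finally show ?thesis by (simp add: W_def eq)
  qed
  have "D \<le> D / 2"
    unfolding D_def by (rule cSUP_least) (use e half in \<open>auto simp: D_def\<close>)
  then have "D = 0" using D0 by simp
  show ?thesis
  proof (rule that[of e])
    show "ball s0 e \<subseteq> S" using e e1 by auto
    fix s assume "s \<in> ball s0 e"
    then have "W s \<le> 0" using WD \<open>D = 0\<close> by metis
    then show "y1 s = y2 s" by (simp add: W_def)
  qed (rule e)
qed


text \<open>Picard iteration. The time \<open>r\<close> is common to all initial points near
  \<open>x0\<close>; this uniformity later bounds the modulus from below on a neighbourhood.\<close>

lemma holomorphic_ode_existence:
  fixes X :: "complex^'n::finite \<Rightarrow> complex^'n"
  assumes X: "holomorphic_map_on X \<Omega>" "open \<Omega>" and x0: "x0 \<in> \<Omega>"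
  obtains \<delta> r where "0 < \<delta>" "0 < r" "ball x0 \<delta> \<subseteq> \<Omega>"
    "\<And>x. x \<in> ball x0 \<delta> \<Longrightarrow> \<exists>\<gamma>. \<gamma> 0 = x \<and> \<gamma> ` ball 0 r \<subseteq> \<Omega> \<and>
       (\<forall>t\<in>ball 0 r. \<forall>i. ((\<lambda>s. \<gamma> s $ i) has_field_derivative X (\<gamma> t) $ i) (at t))"
proof -
  obtain d L where L: "0 < d" "0 < L" "ball x0 d \<subseteq> \<Omega>"
    "\<And>x y i. \<lbrakk>x \<in> ball x0 d; y \<in> ball x0 d\<rbrakk> \<Longrightarrow> cmod (X x $ i - X y $ i) \<le> L * norm (x - y)"
    using holomorphic_field_locally_lipschitz[OF X x0] by metis
  define B where "B = L * d + norm (X x0) + 1"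
  define N where "N = real CARD('n)"
  have N: "0 < N" by (simp add: N_def)
  have B0: "0 < B" using L(1,2) by (simp add: B_def add_nonneg_pos)
  have B: "cmod (X x $ i) \<le> B" if "x \<in> ball x0 d" for x i
  proof -
    have "cmod (X x $ i) \<le> cmod (X x $ i - X x0 $ i) + cmod (X x0 $ i)"
      by (metis diff_add_cancel norm_triangle_ineq)
    also have "\<dots> \<le> L * norm (x - x0) + norm (X x0)"
      using L(4)[OF that, of x0 i] L(1) Finite_Cartesian_Product.norm_nth_le[of "X x0" i] by simp
    also have "\<dots> \<le> B"
      using that L(2) by (simp add: B_def dist_norm norm_minus_commute mult_left_mono add_increasing2)
    finally show ?thesis .
  qed
  \<comment> \<open>The first bound keeps every iterate within \<open>d / 4\<close> of its starting
    point, the second halves the distance of consecutive iterates.\<close>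
  define r where "r = min (d / (4 * N * B)) (1 / (2 * N * L))"
  have r: "0 < r" using L N B0 by (simp add: r_def)
  have rB: "N * B * t \<le> d / 4" if "t < r" for t
  proof -
    have "N * B * t \<le> N * B * (d / (4 * N * B))"
      using that N B0 by (intro mult_left_mono) (auto simp: r_def)
    then show ?thesis using N B0 by simp
  qed
  have rL: "N * L * t \<le> 1 / 2" if "t < r" for t
  proof -
    have "N * L * t \<le> N * L * (1 / (2 * N * L))"
      using that N L by (intro mult_left_mono) (auto simp: r_def)
    then show ?thesis using N L by simp
  qed
  have main: "\<exists>\<gamma>. \<gamma> 0 = x \<and> \<gamma> ` ball 0 r \<subseteq> \<Omega> \<and>
       (\<forall>t\<in>ball 0 r. \<forall>i. ((\<lambda>s. \<gamma> s $ i) has_field_derivative X (\<gamma> t) $ i) (at t))"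
    if x: "x \<in> ball x0 (d / 4)" for x
  proof -
    have sub: "cball x (d / 4) \<subseteq> ball x0 d"
    proof
      fix y assume "y \<in> cball x (d / 4)"
      then show "y \<in> ball x0 d" using x L(1) dist_triangle[of x0 y x] by (simp add: dist_commute)
    qed
    define good where "good = (\<lambda>y. y 0 = x \<and> y ` ball 0 r \<subseteq> cball x (d / 4) \<and> (\<forall>i. (\<lambda>s. y s $ i) holomorphic_on ball 0 r))"
    \<comment> \<open>The Picard step as a relation: the coordinates of \<open>y'\<close> are
      primitives of \<open>X\<close> along \<open>y\<close>, and the starting value is fixed by
      \<open>good\<close>.\<close>
    define nxt where "nxt = (\<lambda>y y'. \<forall>t\<in>ball 0 r. \<forall>i. ((\<lambda>s. y' s $ i) has_field_derivative X (y t) $ i) (at t))"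
    have step: "\<exists>y'. good y' \<and> nxt y y'" if y: "good y" for y
    proof -
      have hol: "(\<lambda>s. X (y s) $ i) holomorphic_on ball 0 r" for i
      proof (rule holomorphic_on_compose_curve[where f = "\<lambda>x. X x $ i" and \<Omega> = \<Omega> and y = y])
        show "holomorphic_fun_on (\<lambda>x. X x $ i) \<Omega>" using X(1) unfolding holomorphic_map_on_def ..
        show "y ` ball 0 r \<subseteq> \<Omega>" using y sub L(3) by (auto simp: good_def)
      qed (use y in \<open>auto simp: good_def\<close>)
      have "\<exists>P. P 0 = x $ i \<and> (\<forall>t\<in>ball 0 r. (P has_field_derivative X (y t) $ i) (at t))" for i
        using holomorphic_primitive_ball[OF hol] by metis
      then obtain P where P: "\<And>i. P i 0 = x $ i"
        "\<And>i t. t \<in> ball 0 r \<Longrightarrow> (P i has_field_derivative X (y t) $ i) (at t)"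
        by metis
      define y' where "y' = (\<lambda>t. \<chi> i. P i t)"
      have y'0: "y' 0 = x" by (simp add: y'_def P(1) vec_eq_iff)
      have n: "nxt y y'" by (simp add: nxt_def y'_def P(2))
      have "dist x (y' t) \<le> d / 4" if t: "t \<in> ball 0 r" for t
      proof -
        have "norm (y' t - y' 0) \<le> real CARD('n) * B * cmod (t - 0)"
        proof (rule curve_mean_value[OF _ _ t])
          fix t :: complex and i :: 'n assume t: "t \<in> ball 0 r"
          show "((\<lambda>s. y' s $ i) has_field_derivative X (y t) $ i) (at t)"
            using n t by (simp add: nxt_def)
          have "y t \<in> ball x0 d" using t y sub unfolding good_def by blast
          then show "cmod (X (y t) $ i) \<le> B" by (rule B)
        qed
        also have "\<dots> \<le> d / 4" using rB[of "cmod t"] t by (simp add: N_def)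
        finally show ?thesis by (simp add: y'0 dist_norm norm_minus_commute)
      qed
      moreover have "(\<lambda>s. y' s $ i) holomorphic_on ball 0 r" for i
        using n unfolding nxt_def by (auto simp: holomorphic_on_open)
      ultimately have "good y'" using y'0 by (auto simp: good_def)
      then show ?thesis using n by blast
    qed
    have "good (\<lambda>_. x)" using L(1) by (auto simp: good_def)
    then obtain Y where Y0: "Y 0 = (\<lambda>_. x)" and Y: "\<And>k. good (Y k)" "\<And>k. nxt (Y k) (Y (Suc k))"
      using dependent_nat_choice[of "\<lambda>k y. good y \<and> (k = 0 \<longrightarrow> y = (\<lambda>_. x))" "\<lambda>k. nxt"] step
      by (metis nat.distinct(1))
    have Yb: "Y k t \<in> ball x0 d" if "t \<in> ball 0 r" for k t
      using Y(1)[of k] that sub unfolding good_def by blast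
    have diff: "norm (Y (Suc k) t - Y k t) \<le> d * (1 / 2) ^ k" if t: "t \<in> ball 0 r" for k t
      using t
    proof (induction k arbitrary: t)
      case 0
      have "Y (Suc 0) t \<in> cball x (d / 4)" using Y(1)[of "Suc 0"] 0 unfolding good_def by blast
      then show ?case using L(1) by (simp add: Y0 dist_norm norm_minus_commute)
    next
      case (Suc k)
      have "norm ((Y (Suc (Suc k)) t - Y (Suc k) t) - (Y (Suc (Suc k)) 0 - Y (Suc k) 0))
        \<le> real CARD('n) * (L * (d * (1 / 2) ^ k)) * cmod (t - 0)"
      proof (rule curve_mean_value[where w = "\<lambda>t. Y (Suc (Suc k)) t - Y (Suc k) t", OF _ _ Suc.prems])
        fix s :: complex and i :: 'n assume s: "s \<in> ball 0 r"
        have "((\<lambda>s. Y (Suc (Suc k)) s $ i) has_field_derivative X (Y (Suc k) s) $ i) (at s)"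
             "((\<lambda>s. Y (Suc k) s $ i) has_field_derivative X (Y k s) $ i) (at s)"
          using Y(2)[of "Suc k"] Y(2)[of k] s by (simp_all add: nxt_def)
        from DERIV_diff[OF this]
        show "((\<lambda>s. (Y (Suc (Suc k)) s - Y (Suc k) s) $ i) has_field_derivative
                X (Y (Suc k) s) $ i - X (Y k s) $ i) (at s)" by simp
        show "cmod (X (Y (Suc k) s) $ i - X (Y k s) $ i) \<le> L * (d * (1 / 2) ^ k)"
          using L(4)[OF Yb[OF s] Yb[OF s]] Suc.IH[OF s] L(2)
          by (meson mult_left_mono order_trans less_imp_le)
      qed
      also have "\<dots> = (N * L * cmod t) * (d * (1 / 2) ^ k)" by (simp add: N_def)
      also have "\<dots> \<le> (1 / 2) * (d * (1 / 2) ^ k)"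
        using rL[of "cmod t"] Suc.prems L(1) by (intro mult_right_mono) auto
      also have "Y (Suc (Suc k)) 0 - Y (Suc k) 0 = 0"
        using Y(1) by (simp add: good_def)
      finally show ?case by simp
    qed
    \<comment> \<open>The increments are dominated by a geometric series; since \<open>Y 0\<close>
      is constantly \<open>x\<close>, telescoping turns the M-test into uniform convergence of the
      iterates.\<close>
    have "\<exists>g. uniform_limit (ball 0 r) (\<lambda>n t. Y n t $ i) g sequentially" for i
    proof -
      have "uniformly_convergent_on (ball 0 r) (\<lambda>n t. \<Sum>k<n. (Y (Suc k) t $ i - Y k t $ i))"
      proof (rule Weierstrass_m_test')
        show "norm (Y (Suc k) t $ i - Y k t $ i) \<le> d * (1 / 2) ^ k" if "t \<in> ball 0 r" for k t
          using order_trans[OF Finite_Cartesian_Product.norm_nth_le[of "Y (Suc k) t - Y k t" i] diff[OF that]] by simp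
        show "summable (\<lambda>k. d * (1 / 2) ^ k)" by (intro summable_mult summable_geometric) simp
      qed
      then obtain g where "uniform_limit (ball 0 r) (\<lambda>n t. Y n t $ i - x $ i) g sequentially"
        unfolding uniformly_convergent_on_def sum_lessThan_telescope[of "\<lambda>k. Y k _ $ i"] Y0 by blast
      from uniform_limit_add[OF this uniform_limit_const[of "\<lambda>_. x $ i"]]
      show ?thesis by auto
    qed
    then obtain g where g: "\<And>i. uniform_limit (ball 0 r) (\<lambda>n t. Y n t $ i) (g i) sequentially"
      by metis
    define \<gamma> where "\<gamma> = (\<lambda>t. \<chi> i. g i t)"
    have lim: "(\<lambda>n. Y n t) \<longlonglongrightarrow> \<gamma> t" if "t \<in> ball 0 r" for t
      by (rule vec_tendstoI) (use tendsto_uniform_limitI[OF g that] in \<open>simp add: \<gamma>_def\<close>)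
    have "\<gamma> 0 = x"
    proof -
      have "(\<lambda>n. Y n 0) \<longlonglongrightarrow> x" using Y(1) by (simp add: good_def)
      then show ?thesis using lim[of 0] r LIMSEQ_unique by auto
    qed
    moreover have \<gamma>b: "\<gamma> t \<in> cball x (d / 4)" if t: "t \<in> ball 0 r" for t
    proof (rule closed_sequentially[OF closed_cball _ lim[OF t]])
      show "Y n t \<in> cball x (d / 4)" for n using Y(1)[of n] t unfolding good_def by blast
    qed
    moreover have "((\<lambda>s. \<gamma> s $ i) has_field_derivative X (\<gamma> t) $ i) (at t)" if t: "t \<in> ball 0 r" for t i
    proof -
      \<comment> \<open>The shifted sequence is used because the derivative of iterate
        \<open>Suc n\<close> is \<open>X\<close> along iterate \<open>n\<close>. Its limit is the
        derivative of the limit, and continuity of \<open>X\<close> identifies it.\<close>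
      have "\<exists>g'. \<forall>t\<in>ball 0 r. (g i has_field_derivative g' t) (at t) \<and> (\<lambda>n. X (Y n t) $ i) \<longlonglongrightarrow> g' t"
      proof (rule has_complex_derivative_uniform_sequence[where f = "\<lambda>n t. Y (Suc n) t $ i"])
        show "((\<lambda>t. Y (Suc n) t $ i) has_field_derivative X (Y n t) $ i) (at t)" if "t \<in> ball 0 r" for n t
          using Y(2)[of n] that by (simp add: nxt_def)
        have u: "uniform_limit (ball 0 r) (\<lambda>n t. Y (Suc n) t $ i) (g i) sequentially"
          using filterlim_compose[OF g[of i] filterlim_Suc] .
        show "\<exists>d>0. cball t d \<subseteq> ball 0 r \<and> uniform_limit (cball t d) (\<lambda>n t. Y (Suc n) t $ i) (g i) sequentially"
          if t: "t \<in> ball 0 r" for t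
        proof -
          obtain d where "0 < d" "cball t d \<subseteq> ball 0 r"
            using open_contains_cball[of "ball 0 r"] t open_ball by metis
          then show ?thesis using uniform_limit_on_subset[OF u] by blast
        qed
      qed simp
      then obtain g' where g': "(g i has_field_derivative g') (at t)" "(\<lambda>n. X (Y n t) $ i) \<longlonglongrightarrow> g'"
        using t by blast
      have "\<gamma> t \<in> \<Omega>" using \<gamma>b[OF t] sub L(3) by auto
      moreover have "continuous_on \<Omega> (\<lambda>x. X x $ i)"
        using X holomorphic_fun_on_imp_continuous_on by (auto simp: holomorphic_map_on_def)
      ultimately have "isCont (\<lambda>x. X x $ i) (\<gamma> t)"
        using X(2) by (simp add: continuous_on_eq_continuous_at)
      from isCont_tendsto_compose[OF this lim[OF t]] have "(\<lambda>n. X (Y n t) $ i) \<longlonglongrightarrow> X (\<gamma> t) $ i" .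
      then have "g' = X (\<gamma> t) $ i" using g'(2) LIMSEQ_unique by blast
      then show ?thesis using g'(1) by (simp add: \<gamma>_def)
    qed
    ultimately show ?thesis using sub L(3) by (intro exI[of _ \<gamma>]) blast
  qed
  show ?thesis
  proof (rule that[of "d / 4" r])
    show "ball x0 (d / 4) \<subseteq> \<Omega>" using L(1,3) by (auto simp: subset_iff)
  qed (use L(1) r main in auto)
qed


section \<open>Charts and velocities of holomorphic curves\<close>

definition velocity :: "('m, 'n::finite) chart \<Rightarrow> (complex \<Rightarrow> 'm) \<Rightarrow> complex \<Rightarrow> complex^'n" where
  "velocity c f s = (\<chi> i. deriv (\<lambda>t. snd c (f t) $ i) s)"

lemma velocity_cong:
  assumes "open S" "s \<in> S" "\<And>t. t \<in> S \<Longrightarrow> f t = g t"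
  shows "velocity c f s = velocity c g s"
proof -
  have "eventually (\<lambda>t. t \<in> S) (nhds s)" using assms eventually_nhds by blast
  then have "eventually (\<lambda>t. snd c (f t) $ i = snd c (g t) $ i) (nhds s)" for i
    by (rule eventually_mono) (simp add: assms(3))
  from deriv_cong_ev[OF this refl] show ?thesis by (simp add: velocity_def)
qed

lemma holomorphic_curve_on_subset:
  assumes "holomorphic_curve_on A S f" "T \<subseteq> S"
  shows "holomorphic_curve_on A T f"
proof -
  have "(\<lambda>z. \<phi> (f z) $ i) holomorphic_on {z \<in> T. f z \<in> U}" if "(U, \<phi>) \<in> A" for U \<phi> i
  proof (rule holomorphic_on_subset)
    show "(\<lambda>z. \<phi> (f z) $ i) holomorphic_on {z \<in> S. f z \<in> U}"
      using assms(1) that by (auto simp: holomorphic_curve_on_def)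
  qed (use assms in auto)
  then show ?thesis
    using assms unfolding holomorphic_curve_on_def by (auto intro: continuous_on_subset)
qed

lemma holomorphic_curve_on_compose:
  assumes f: "holomorphic_curve_on A S f" and h: "h holomorphic_on T" "h ` T \<subseteq> S"
  shows "holomorphic_curve_on A T (f \<circ> h)"
proof -
  have "continuous_on T (f \<circ> h)"
    using f h by (intro continuous_on_compose holomorphic_on_imp_continuous_on)
      (auto simp: holomorphic_curve_on_def intro: continuous_on_subset)
  moreover have "(\<lambda>z. \<phi> ((f \<circ> h) z) $ i) holomorphic_on {z \<in> T. (f \<circ> h) z \<in> U}"
    if "(U, \<phi>) \<in> A" for U \<phi> i
  proof -
    have 1: "(\<lambda>z. \<phi> (f z) $ i) holomorphic_on {z \<in> S. f z \<in> U}"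
      using f that by (auto simp: holomorphic_curve_on_def)
    have "h holomorphic_on {z \<in> T. (f \<circ> h) z \<in> U}"
      by (rule holomorphic_on_subset[OF h(1)]) auto
    then have "((\<lambda>z. \<phi> (f z) $ i) \<circ> h) holomorphic_on {z \<in> T. (f \<circ> h) z \<in> U}"
      by (rule holomorphic_on_compose_gen[OF _ 1]) (use h(2) in auto)
    then show ?thesis by (simp add: o_def)
  qed
  ultimately show ?thesis unfolding holomorphic_curve_on_def by auto
qed

locale atlas =
  fixes A :: "('m::{t2_space, second_countable_topology}, 'n::finite) chart set"
  assumes atlas: "complex_atlas A"
begin

lemma ex_chart: obtains c where "c \<in> A" "p \<in> fst c"
proof -
  have "\<exists>(U, \<phi>)\<in>A. p \<in> U"
    using atlas unfolding complex_atlas_def by simp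
  then show ?thesis using that by auto
qed

context
  fixes c assumes c: "c \<in> A"
begin

lemma chart_homeomorphism: "homeomorphism (fst c) (snd c ` fst c) (snd c) (inv_into (fst c) (snd c))"
  and chart_open: "open (fst c)"
  and chart_open_image: "open (snd c ` fst c)"
proof -
  obtain U \<phi> where "c = (U, \<phi>)" by (cases c)
  then show "homeomorphism (fst c) (snd c ` fst c) (snd c) (inv_into (fst c) (snd c))"
    "open (fst c)" "open (snd c ` fst c)"
    using atlas c unfolding complex_atlas_def by auto
qed

lemma chart_continuous: "continuous_on (fst c) (snd c)"
  and chart_inv_continuous: "continuous_on (snd c ` fst c) (inv_into (fst c) (snd c))"
  and chart_inv: "p \<in> fst c \<Longrightarrow> inv_into (fst c) (snd c) (snd c p) = p"
  using chart_homeomorphism unfolding homeomorphism_def by auto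

lemma chart_inj: "inj_on (snd c) (fst c)"
  by (metis chart_inv inj_onI)

lemma chart_image_open:
  assumes "open W" "W \<subseteq> fst c"
  shows "open (snd c ` W)"
proof -
  have "openin (top_of_set (snd c ` fst c)) (snd c ` W)"
    by (rule homeomorphism_imp_open_map[OF chart_homeomorphism])
      (use assms chart_open in \<open>auto simp: openin_open_eq\<close>)
  then show ?thesis using chart_open_image openin_open_trans by blast
qed

lemma curve_in_chart_open:
  assumes "holomorphic_curve_on A S f" "open S" "open W"
  shows "open {z \<in> S. f z \<in> W}"
proof -
  have "open (f -` W \<inter> S)"
    using assms by (simp add: continuous_on_open_vimage holomorphic_curve_on_def)
  also have "f -` W \<inter> S = {z \<in> S. f z \<in> W}" by auto
  finally show ?thesis .
qed

lemma curve_coord_holomorphic: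
  assumes "holomorphic_curve_on A S f" "f ` S \<subseteq> fst c"
  shows "(\<lambda>z. snd c (f z) $ i) holomorphic_on S"
proof -
  obtain U \<phi> where c': "c = (U, \<phi>)" by (cases c)
  then have "(\<lambda>z. \<phi> (f z) $ i) holomorphic_on {z \<in> S. f z \<in> U}"
    using assms(1) c by (auto simp: holomorphic_curve_on_def)
  also have "{z \<in> S. f z \<in> U} = S" using assms(2) c' by auto
  finally show ?thesis using c' by simp
qed

lemma curve_has_velocity:
  assumes "holomorphic_curve_on A S f" "open S" "s \<in> S" "f s \<in> fst c"
  shows "((\<lambda>z. snd c (f z) $ i) has_field_derivative velocity c f s $ i) (at s)"
proof -
  let ?T = "{z \<in> S. f z \<in> fst c}"
  have "(\<lambda>z. snd c (f z) $ i) holomorphic_on ?T"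
    by (rule curve_coord_holomorphic, rule holomorphic_curve_on_subset[OF assms(1)]) auto
  moreover have "open ?T" by (rule curve_in_chart_open) (use assms chart_open in auto)
  ultimately show ?thesis
    using assms by (auto simp: velocity_def intro!: holomorphic_derivI)
qed

lemma velocity_eqI:
  assumes "\<And>i. ((\<lambda>z. snd c (f z) $ i) has_field_derivative v $ i) (at s)"
  shows "velocity c f s = v"
  using assms by (simp add: velocity_def vec_eq_iff DERIV_imp_deriv)

lemma velocity_compose:
  assumes f: "holomorphic_curve_on A S f" "open S" "h s \<in> S" "f (h s) \<in> fst c"
    and h: "(h has_field_derivative h') (at s)"
  shows "velocity c (f \<circ> h) s = h' *s velocity c f (h s)"
proof (rule velocity_eqI)
  fix i
  show "((\<lambda>z. snd c ((f \<circ> h) z) $ i) has_field_derivative (h' *s velocity c f (h s)) $ i) (at s)"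
    using DERIV_chain2[OF curve_has_velocity[OF f] h, of i] by (simp add: mult.commute)
qed

lemma holomorphic_fun_in_chart:
  assumes "holomorphic_fun_in A W f" "W \<subseteq> fst c"
  shows "holomorphic_fun_on (f \<circ> inv_into (fst c) (snd c)) (snd c ` W)"
proof -
  obtain U \<phi> where c': "c = (U, \<phi>)" by (cases c)
  moreover have "U \<inter> W = W" using assms c' by auto
  ultimately show ?thesis using assms(1) c unfolding holomorphic_fun_in_def by fastforce
qed

end

lemma holomorphic_fun_in_subset:
  "\<lbrakk>holomorphic_fun_in A W f; V \<subseteq> W\<rbrakk> \<Longrightarrow> holomorphic_fun_in A V f"
  unfolding holomorphic_fun_in_def holomorphic_fun_on_def by (auto; blast)

lemma holomorphic_fun_in_imp_continuous_on:
  assumes f: "holomorphic_fun_in A W f" and W: "open W"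
  shows "continuous_on W f"
proof (rule continuous_at_imp_continuous_on, rule ballI)
  fix p assume p: "p \<in> W"
  obtain c where c: "c \<in> A" "p \<in> fst c" by (rule ex_chart)
  have o: "open (W \<inter> fst c)" using W chart_open[OF c(1)] by auto
  have "continuous_on (snd c ` (W \<inter> fst c)) (f \<circ> inv_into (fst c) (snd c))"
    by (intro holomorphic_fun_on_imp_continuous_on holomorphic_fun_in_chart[OF c(1)]
        holomorphic_fun_in_subset[OF f]) auto
  then have "continuous_on (W \<inter> fst c) ((f \<circ> inv_into (fst c) (snd c)) \<circ> snd c)"
    by (rule continuous_on_compose[OF continuous_on_subset[OF chart_continuous[OF c(1)]], rotated]) auto
  then have "continuous_on (W \<inter> fst c) f"
    by (rule continuous_on_eq) (simp add: chart_inv[OF c(1)])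
  then show "isCont f p" using o p c(2) by (simp add: continuous_on_eq_continuous_at)
qed

lemma holomorphic_fun_in_curve:
  assumes g: "holomorphic_fun_in A W g" "open W"
    and f: "holomorphic_curve_on A S f" "open S" "f ` S \<subseteq> W"
  shows "(\<lambda>s. g (f s)) holomorphic_on S"
proof -
  have "(\<lambda>s. g (f s)) field_differentiable at t" if t: "t \<in> S" for t
  proof -
    obtain c where c: "c \<in> A" "f t \<in> fst c" by (rule ex_chart)
    let ?T = "{z \<in> S. f z \<in> fst c}"
    let ?g = "g \<circ> inv_into (fst c) (snd c)"
    have T: "open ?T" "t \<in> ?T" using curve_in_chart_open[OF c(1) f(1,2) chart_open[OF c(1)]] t c by auto
    have "(\<lambda>s. ?g (snd c (f s))) holomorphic_on ?T"
    proof (rule holomorphic_on_compose_curve[where f = ?g and y = "\<lambda>s. snd c (f s)"])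
      show "holomorphic_fun_on ?g (snd c ` (W \<inter> fst c))"
        by (intro holomorphic_fun_in_chart[OF c(1)] holomorphic_fun_in_subset[OF g(1)]) auto
      show "(\<lambda>s. snd c (f s) $ i) holomorphic_on ?T" for i
        by (rule curve_coord_holomorphic[OF c(1)], rule holomorphic_curve_on_subset[OF f(1)]) auto
    qed (use T f in auto)
    then have "(\<lambda>s. g (f s)) holomorphic_on ?T"
      by (rule holomorphic_transform) (simp add: chart_inv[OF c(1)])
    then show ?thesis using T by (simp add: holomorphic_on_imp_differentiable_at)
  qed
  then show ?thesis
    by (simp add: f(2) holomorphic_on_open field_differentiable_def)
qed

text \<open>\<open>change_coords\<close> is a \<open>frechet_derivative\<close> of a vector-valued
  map, whereas the atlas supplies a derivative for each coordinate separately. Assembling these rows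
  into a Jacobian matrix and using uniqueness of derivatives identifies the two.\<close>

lemma transition_derivative:
  assumes c: "c \<in> A" and d: "d \<in> A" and p: "p \<in> fst c" "p \<in> fst d"
  obtains M :: "complex^'n^'n"
  where "\<And>i. ((\<lambda>x. snd d (inv_into (fst c) (snd c) x) $ i) has_derivative (\<lambda>v. \<Sum>j\<in>UNIV. M $ i $ j * v $ j)) (at (snd c p))"
    and "\<And>v. change_coords c d p v = M *v v"
proof -
  let ?T = "snd d \<circ> inv_into (fst c) (snd c)"
  have "holomorphic_map_on ?T (snd c ` (fst c \<inter> fst d))"
    using atlas c d unfolding complex_atlas_def by fastforce
  then have "\<forall>i. \<exists>a::complex^'n. ((\<lambda>x. ?T x $ i) has_derivative (\<lambda>v. \<Sum>j\<in>UNIV. a $ j * v $ j)) (at (snd c p))"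
    using p unfolding holomorphic_map_on_def holomorphic_fun_on_def by blast
  then obtain a where a: "\<And>i. ((\<lambda>x. ?T x $ i) has_derivative (\<lambda>v. \<Sum>j\<in>UNIV. a i $ j * v $ j)) (at (snd c p))"
    by (rule choice[THEN exE]) blast
  let ?D = "\<lambda>v. \<chi> i. \<Sum>j\<in>UNIV. a i $ j * v $ j"
  have "bounded_linear ?D"
  proof (rule bounded_linear_intro[where K = "\<Sum>i\<in>UNIV. \<Sum>j\<in>UNIV. norm (a i $ j)"])
    fix v
    have "norm (?D v) \<le> (\<Sum>i\<in>UNIV. norm (\<Sum>j\<in>UNIV. a i $ j * v $ j))"
      using norm_le_sum_norm_nth[of "?D v"] by simp
    also have "\<dots> \<le> (\<Sum>i\<in>UNIV. \<Sum>j\<in>UNIV. norm (a i $ j) * norm v)"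
      by (intro sum_mono order_trans[OF norm_sum])
        (auto simp: norm_mult intro!: sum_mono mult_left_mono Finite_Cartesian_Product.norm_nth_le)
    finally show "norm (?D v) \<le> norm v * (\<Sum>i\<in>UNIV. \<Sum>j\<in>UNIV. norm (a i $ j))"
      by (simp add: sum_distrib_left sum_distrib_right mult.commute)
  qed (auto simp: vec_eq_iff sum.distrib algebra_simps sum_distrib_left scaleR_conv_of_real[of _ "_ :: complex"])
  then have "(?T has_derivative ?D) (at (snd c p))"
    by (rule has_derivative_vecI) (use a in simp)
  then have "?D = frechet_derivative ?T (at (snd c p))" by (rule frechet_derivative_at)
  then have "change_coords c d p v = ?D v" for v unfolding change_coords_def by (rule fun_cong[OF sym])
  then have "\<And>v. change_coords c d p v = (\<chi> i. a i) *v v"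
    by (simp add: matrix_vector_mult_def)
  then show ?thesis using a by (intro that[of "\<chi> i. a i"]) (simp_all add: o_def)
qed

lemma change_coords_scale:
  assumes "c \<in> A" "d \<in> A" "p \<in> fst c" "p \<in> fst d"
  shows "change_coords c d p (k *s v) = k *s change_coords c d p v"
proof -
  obtain M :: "complex^'n^'n" where "\<And>v. change_coords c d p v = M *v v"
    by (rule transition_derivative[OF assms]) (rule that)
  then show ?thesis by (simp add: vec_eq_iff matrix_vector_mult_def sum_distrib_left algebra_simps)
qed

lemma velocity_change_coords:
  assumes f: "holomorphic_curve_on A S f" "open S" "s \<in> S"
    and c: "c \<in> A" "f s \<in> fst c" and d: "d \<in> A" "f s \<in> fst d"
  shows "velocity d f s = change_coords c d (f s) (velocity c f s)"
proof -
  let ?T = "\<lambda>x. snd d (inv_into (fst c) (snd c) x)"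
  let ?S = "{z \<in> S. f z \<in> fst c}"
  obtain M :: "complex^'n^'n"
    where a: "\<And>i. ((\<lambda>x. ?T x $ i) has_derivative (\<lambda>v. \<Sum>j\<in>UNIV. M $ i $ j * v $ j)) (at (snd c (f s)))"
      and ch: "\<And>v. change_coords c d (f s) v = M *v v"
    by (rule transition_derivative[OF c(1) d(1) c(2) d(2)]) (rule that)
  have S: "open ?S" "s \<in> ?S" using curve_in_chart_open[OF c(1) f(1,2) chart_open[OF c(1)]] f c by auto
  have "((\<lambda>t. ?T (snd c (f t)) $ i) has_field_derivative (\<Sum>j\<in>UNIV. M $ i $ j * velocity c f s $ j)) (at s)" for i
    by (rule has_field_derivative_compose_curve[where f = "\<lambda>x. ?T x $ i" and y = "\<lambda>t. snd c (f t)"])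
      (rule a, rule curve_has_velocity[OF c(1) f c(2)])
  then have "((\<lambda>t. snd d (f t) $ i) has_field_derivative (\<Sum>j\<in>UNIV. M $ i $ j * velocity c f s $ j)) (at s)" for i
    by (rule has_field_derivative_transform_within_open[OF _ S]) (simp add: chart_inv[OF c(1)])
  then show ?thesis
    unfolding ch by (intro velocity_eqI[OF d(1)]) (simp add: matrix_vector_mult_def)
qed

text \<open>Holomorphy in the one chart \<open>c\<close> carries over to every other chart by the
  chain rule for the transition map.\<close>

lemma holomorphic_curve_onI_chart:
  assumes c: "c \<in> A" and S: "open S"
    and y: "\<And>i. (\<lambda>s. y s $ i) holomorphic_on S" "y ` S \<subseteq> snd c ` fst c"
    and f: "\<And>s. s \<in> S \<Longrightarrow> f s = inv_into (fst c) (snd c) (y s)"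
  shows "holomorphic_curve_on A S f"
proof -
  let ?i = "inv_into (fst c) (snd c)"
  have "continuous_on S y"
    by (rule continuous_on_curve[of S y "\<lambda>t i. deriv (\<lambda>s. y s $ i) t"])
      (rule holomorphic_derivI[OF y(1) S])
  then have "continuous_on S (?i \<circ> y)"
    by (rule continuous_on_compose[OF _ continuous_on_subset[OF chart_inv_continuous[OF c] y(2)]])
  then have cf: "continuous_on S f" by (rule continuous_on_eq) (simp add: f)
  have "(\<lambda>z. snd d (f z) $ i) field_differentiable at t"
    if d: "d \<in> A" "t \<in> S" "f t \<in> fst d" for d t i
  proof -
    have "y t \<in> snd c ` fst c" using y(2) d by auto
    then have p: "f t \<in> fst c" "snd c (f t) = y t" using f[OF d(2)] by (auto simp: inv_into_into f_inv_into_f)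
    obtain M :: "complex^'n^'n"
      where a: "\<And>i. ((\<lambda>x. snd d (?i x) $ i) has_derivative (\<lambda>v. \<Sum>j\<in>UNIV. M $ i $ j * v $ j)) (at (snd c (f t)))"
      by (rule transition_derivative[OF c d(1) p(1) d(3)]) (rule that)
    define v where "v = (\<chi> i. deriv (\<lambda>s. y s $ i) t)"
    have v: "\<And>i. ((\<lambda>s. y s $ i) has_field_derivative v $ i) (at t)"
      using holomorphic_derivI[OF y(1) S d(2)] by (simp add: v_def)
    have "((\<lambda>z. snd d (?i (y z)) $ i) has_field_derivative (\<Sum>j\<in>UNIV. M $ i $ j * v $ j)) (at t)"
      by (rule has_field_derivative_compose_curve[where f = "\<lambda>x. snd d (?i x) $ i" and y = y, OF _ v])
        (use a p in simp)
    then have "((\<lambda>z. snd d (f z) $ i) has_field_derivative (\<Sum>j\<in>UNIV. M $ i $ j * v $ j)) (at t)"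
      by (rule has_field_derivative_transform_within_open[OF _ S d(2)]) (simp add: f)
    then show ?thesis by (auto simp: field_differentiable_def)
  qed
  then show ?thesis
    using cf unfolding holomorphic_curve_on_def holomorphic_on_def
    by (fastforce intro: field_differentiable_at_within)
qed

end


section \<open>Integral curves and tangent curves\<close>

text \<open>The condition inside \<open>plaque\<close> with the parametrization kept, because curves
  in a plaque are compared through their times.\<close>

definition integral_curve ::
    "'m set \<Rightarrow> ('m, 'n::finite) chart \<Rightarrow> 'm set \<Rightarrow> ('m \<Rightarrow> complex^'n) \<Rightarrow> (complex \<Rightarrow> 'm) \<Rightarrow> real \<Rightarrow> bool" where
  "integral_curve E c W X \<gamma> r \<longleftrightarrow> 0 < r \<and> \<gamma> ` ball 0 r \<subseteq> W - E \<and>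
     (\<forall>t\<in>ball 0 r. \<forall>i. ((\<lambda>s. snd c (\<gamma> s) $ i) has_field_derivative X (\<gamma> t) $ i) (at t))"

text \<open>The factor \<open>u\<close> may be 0, so critical points and constant curves count as
  tangent. In contrast to lying in a leaf, this is a condition on coordinates that can be tested in
  limits and by the identity theorem.\<close>

definition tangent_at :: "('m, 'n::finite) generator set \<Rightarrow> (complex \<Rightarrow> 'm) \<Rightarrow> complex \<Rightarrow> bool" where
  "tangent_at F f s \<longleftrightarrow> (\<forall>(c, W, X)\<in>F. f s \<in> W \<longrightarrow> (\<exists>u. velocity c f s = u *s X (f s)))"

definition tangent_curve ::
    "('m::topological_space, 'n::finite) chart set \<Rightarrow> 'm set \<Rightarrow> ('m, 'n) generator set \<Rightarrow> complex set
      \<Rightarrow> (complex \<Rightarrow> 'm) \<Rightarrow> bool" where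
  "tangent_curve A E F S f \<longleftrightarrow>
     holomorphic_curve_on A S f \<and> f ` S \<inter> E = {} \<and> (\<forall>s\<in>S. tangent_at F f s)"

lemma plaque_restrict_iff:
  "plaque E (restrict_foliation F V) P \<longleftrightarrow>
    (\<exists>c W X \<gamma> r. (c, W, X) \<in> F \<and> integral_curve E c (W \<inter> V) X \<gamma> r \<and> P = \<gamma> ` ball 0 r)"
  unfolding plaque_def restrict_foliation_def integral_curve_def bex_simps
  by (simp add: Bex_def image_iff split_beta)

lemma restrict_foliation_UNIV [simp]: "restrict_foliation F UNIV = F"
  by (auto simp: restrict_foliation_def)

lemma integral_curve_subset:
  "\<lbrakk>integral_curve E c W X \<gamma> r; 0 < r'; r' \<le> r\<rbrakk> \<Longrightarrow> integral_curve E c W X \<gamma> r'"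
  unfolding integral_curve_def by (auto simp: image_subset_iff)

lemma integral_curve_mono:
  "\<lbrakk>integral_curve E c W X \<gamma> r; W \<subseteq> W'\<rbrakk> \<Longrightarrow> integral_curve E c W' X \<gamma> r"
  unfolding integral_curve_def by auto

lemma integral_curveD:
  assumes "integral_curve E c W X \<gamma> r" "t \<in> ball 0 r"
  shows "\<gamma> t \<in> W" "\<gamma> t \<notin> E" "((\<lambda>s. snd c (\<gamma> s) $ i) has_field_derivative X (\<gamma> t) $ i) (at t)"
proof -
  have *: "\<gamma> ` ball 0 r \<subseteq> W - E"
      "\<forall>t\<in>ball 0 r. \<forall>i. ((\<lambda>s. snd c (\<gamma> s) $ i) has_field_derivative X (\<gamma> t) $ i) (at t)"
    using assms(1) unfolding integral_curve_def by (rule conjunct2[THEN conjunct1], rule conjunct2[THEN conjunct2])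
  have "\<gamma> t \<in> W - E" using *(1) imageI[OF assms(2)] by (rule subsetD)
  then show "\<gamma> t \<in> W" "\<gamma> t \<notin> E" by simp_all
  from bspec[OF *(2) assms(2)]
  show "((\<lambda>s. snd c (\<gamma> s) $ i) has_field_derivative X (\<gamma> t) $ i) (at t)" ..
qed

lemma holomorphic_onI_DERIV:
  "(\<And>t. t \<in> S \<Longrightarrow> (f has_field_derivative f' t) (at t)) \<Longrightarrow> f holomorphic_on S"
  unfolding holomorphic_on_def field_differentiable_def
  using has_field_derivative_at_within by metis

lemma tangent_curve_subset:
  "\<lbrakk>tangent_curve A E F S f; T \<subseteq> S\<rbrakk> \<Longrightarrow> tangent_curve A E F T f"
  unfolding tangent_curve_def using holomorphic_curve_on_subset[of A S f T] by auto

locale foliation = atlas A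
  for A :: "('m::{t2_space, second_countable_topology}, 'n::finite) chart set" +
  fixes E :: "'m set" and F :: "('m, 'n) generator set"
  assumes shfc: "shfc A E F"
begin

lemma ex_generator: obtains c W X where "(c, W, X) \<in> F" "p \<in> W"
proof -
  have "\<exists>(c, W, X)\<in>F. p \<in> W" using shfc unfolding shfc_def by simp
  then show ?thesis using that by auto
qed

lemma generator:
  assumes "(c, W, X) \<in> F"
  shows "c \<in> A" "open W" "W \<subseteq> fst c" "holomorphic_fun_in A W (\<lambda>p. X p $ i)"
    and "p \<in> W \<Longrightarrow> X p = 0 \<longleftrightarrow> p \<in> E"
proof -
  have "\<forall>(c, W, X)\<in>F. c \<in> A \<and> open W \<and> W \<subseteq> fst c \<and>
        (\<forall>i. holomorphic_fun_in A W (\<lambda>p. X p $ i)) \<and> {p\<in>W. X p = 0} = E \<inter> W"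
    using shfc unfolding shfc_def by simp
  from bspec[OF this assms]
  show "c \<in> A" "open W" "W \<subseteq> fst c" "holomorphic_fun_in A W (\<lambda>p. X p $ i)"
    and "p \<in> W \<Longrightarrow> X p = 0 \<longleftrightarrow> p \<in> E" by auto
qed

lemma generator_change:
  assumes G: "(c, W, X) \<in> F" and H: "(d, V, Y) \<in> F" and p: "p \<in> W" "p \<in> V" "p \<notin> E"
  obtains a where "a \<noteq> 0" "Y p = a *s change_coords c d p (X p)"
proof -
  have "\<forall>(c, W, X)\<in>F. \<forall>(d, V, Y)\<in>F. \<forall>p\<in>W \<inter> V - E.
        \<exists>a. a \<noteq> 0 \<and> Y p = a *s change_coords c d p (X p)"
    using shfc unfolding shfc_def by simp
  from bspec[OF this G] have "\<forall>(d, V, Y)\<in>F. \<forall>p\<in>W \<inter> V - E.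
        \<exists>a. a \<noteq> 0 \<and> Y p = a *s change_coords c d p (X p)" by simp
  from bspec[OF this H] show ?thesis using p that by auto
qed

lemma generator_map:
  assumes G: "(c, W, X) \<in> F" and V: "V \<subseteq> W"
  shows "holomorphic_map_on (X \<circ> inv_into (fst c) (snd c)) (snd c ` V)"
  unfolding holomorphic_map_on_def
proof
  fix i
  have "holomorphic_fun_on ((\<lambda>p. X p $ i) \<circ> inv_into (fst c) (snd c)) (snd c ` V)"
    by (rule holomorphic_fun_in_chart[OF generator(1)[OF G]])
      (use holomorphic_fun_in_subset[OF generator(4)[OF G] V] generator(3)[OF G] V in auto)
  then show "holomorphic_fun_on (\<lambda>x. (X \<circ> inv_into (fst c) (snd c)) x $ i) (snd c ` V)"
    by (simp add: o_def)
qed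

lemma closed_singular_set: "closed E"
proof -
  have "\<exists>T. open T \<and> p \<in> T \<and> T \<subseteq> - E" if p: "p \<notin> E" for p
  proof -
    have "analytic_set A E" using shfc by (simp add: shfc_def)
    then have "\<exists>W fs. open W \<and> p \<in> W \<and> finite fs \<and>
        (\<forall>f\<in>fs. holomorphic_fun_in A W f) \<and> E \<inter> W = {x\<in>W. \<forall>f\<in>fs. f x = 0}"
      unfolding analytic_set_def by (rule spec)
    then obtain W fs where W: "open W" "p \<in> W" "\<forall>f\<in>fs. holomorphic_fun_in A W f"
      "E \<inter> W = {x\<in>W. \<forall>f\<in>fs. f x = 0}"
      by (elim exE conjE) (rule that)
    then obtain f where f: "f \<in> fs" "f p \<noteq> 0" using p by auto
    have "continuous_on W f" by (rule holomorphic_fun_in_imp_continuous_on[OF bspec[OF W(3) f(1)] W(1)])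
    then have "open (W \<inter> f -` (- {0}))" by (rule continuous_open_preimage[OF _ W(1)]) auto
    moreover have "W \<inter> f -` (- {0}) \<subseteq> - E" using W(4) f(1) by blast
    moreover have "p \<in> W \<inter> f -` (- {0})" using W(2) f(2) by simp
    ultimately show ?thesis by blast
  qed
  then have "\<forall>p\<in>- E. \<exists>T. open T \<and> p \<in> T \<and> T \<subseteq> - E" by blast
  then have "open (- E)" by (rule open_subopen[THEN iffD2])
  then show ?thesis by (simp add: closed_def)
qed

lemma integral_curve_holomorphic:
  assumes c: "c \<in> A" and W: "W \<subseteq> fst c" and \<gamma>: "integral_curve E c W X \<gamma> r"
  shows "holomorphic_curve_on A (ball 0 r) \<gamma>"
    and "t \<in> ball 0 r \<Longrightarrow> velocity c \<gamma> t = X (\<gamma> t)"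
proof -
  have d: "((\<lambda>s. snd c (\<gamma> s) $ i) has_field_derivative X (\<gamma> t) $ i) (at t)" if "t \<in> ball 0 r" for t i
    by (rule integral_curveD(3)[OF \<gamma> that])
  have sub: "\<gamma> ` ball 0 r \<subseteq> fst c" using integral_curveD(1)[OF \<gamma>] W by blast
  show "holomorphic_curve_on A (ball 0 r) \<gamma>"
  proof (rule holomorphic_curve_onI_chart[OF c open_ball, of "\<lambda>s. snd c (\<gamma> s)"])
    show "(\<lambda>s. snd c (\<gamma> s) $ i) holomorphic_on ball 0 r" for i
      by (rule holomorphic_onI_DERIV) (rule d)
    show "(\<lambda>s. snd c (\<gamma> s)) ` ball 0 r \<subseteq> snd c ` fst c" using sub by auto
    show "\<gamma> s = inv_into (fst c) (snd c) (snd c (\<gamma> s))" if "s \<in> ball 0 r" for s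
      using sub that by (subst chart_inv[OF c]) auto
  qed
  show "velocity c \<gamma> t = X (\<gamma> t)" if "t \<in> ball 0 r"
    by (rule velocity_eqI[OF c]) (rule d[OF that])
qed

text \<open>One generator suffices: off \<open>E\<close>, any other one differs from it by the
  coordinate change and a nonzero factor, and velocities change coordinates in the same way.\<close>

lemma tangent_atI:
  assumes f: "holomorphic_curve_on A S f" "open S" "s \<in> S" "f s \<notin> E"
    and G: "(c, W, X) \<in> F" "f s \<in> W" "velocity c f s = u *s X (f s)"
  shows "tangent_at F f s"
proof -
  have "\<exists>u. velocity d f s = u *s Y (f s)" if H: "(d, V, Y) \<in> F" "f s \<in> V" for d V Y
  proof -
    have cd: "c \<in> A" "f s \<in> fst c" "d \<in> A" "f s \<in> fst d"
      using generator(1,3)[OF G(1)] generator(1,3)[OF H(1)] G(2) H(2) by auto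
    obtain a where a: "a \<noteq> 0" "Y (f s) = a *s change_coords c d (f s) (X (f s))"
      by (rule generator_change[OF G(1) H(1) G(2) H(2) f(4)])
    have "velocity d f s = u *s change_coords c d (f s) (X (f s))"
      using velocity_change_coords[OF f(1-3) cd] G(3) change_coords_scale[OF cd(1,3,2,4)] by simp
    also have "\<dots> = (u / a) *s Y (f s)" using a by (simp add: vec_eq_iff)
    finally show ?thesis ..
  qed
  then show ?thesis unfolding tangent_at_def by auto
qed

lemma tangent_atD:
  "\<lbrakk>tangent_at F f s; (c, W, X) \<in> F; f s \<in> W\<rbrakk> \<Longrightarrow> \<exists>u. velocity c f s = u *s X (f s)"
  unfolding tangent_at_def by auto

lemma integral_curve_tangent:
  assumes G: "(c, W, X) \<in> F" and \<gamma>: "integral_curve E c W X \<gamma> r"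
  shows "tangent_curve A E F (ball 0 r) \<gamma>"
proof -
  note h = integral_curve_holomorphic[OF generator(1,3)[OF G] \<gamma>]
  have sub: "\<gamma> t \<in> W" "\<gamma> t \<notin> E" if "t \<in> ball 0 r" for t
    using integral_curveD[OF \<gamma> that] by auto
  have "tangent_at F \<gamma> t" if "t \<in> ball 0 r" for t
    by (rule tangent_atI[OF h(1) open_ball that sub(2)[OF that] G sub(1)[OF that], of 1])
      (simp add: h(2)[OF that])
  then show ?thesis unfolding tangent_curve_def using h(1) sub by auto
qed

text \<open>The differential equation is solved in the chart image of
  \<open>W \<inter> V - E\<close>, so the solutions avoid \<open>E\<close> and stay in
  \<open>V\<close> by construction. The restriction to \<open>V\<close> serves the restricted
  foliations in the definition of an invariant hypersurface.\<close>

lemma local_flow: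
  assumes G: "(c, W, X) \<in> F" and V: "open V" and p: "p \<in> W" "p \<in> V" "p \<notin> E"
  obtains N r where "open N" "p \<in> N" "N \<subseteq> W \<inter> V - E" "0 < r"
    "\<And>p'. p' \<in> N \<Longrightarrow> \<exists>\<gamma>. integral_curve E c (W \<inter> V) X \<gamma> r \<and> \<gamma> 0 = p'"
proof -
  note c = generator(1)[OF G]
  let ?i = "inv_into (fst c) (snd c)"
  let ?O = "W \<inter> V - E"
  have O: "open ?O" "?O \<subseteq> fst c" using generator(2,3)[OF G] V closed_singular_set by auto
  have X: "holomorphic_map_on (X \<circ> ?i) (snd c ` ?O)" by (rule generator_map[OF G]) auto
  have "snd c p \<in> snd c ` ?O" using p by auto
  then obtain \<delta> r where dr: "0 < \<delta>" "0 < r" "ball (snd c p) \<delta> \<subseteq> snd c ` ?O"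
    and flow: "\<And>x. x \<in> ball (snd c p) \<delta> \<Longrightarrow> \<exists>y. y 0 = x \<and> y ` ball 0 r \<subseteq> snd c ` ?O \<and>
       (\<forall>t\<in>ball 0 r. \<forall>i. ((\<lambda>s. y s $ i) has_field_derivative (X \<circ> ?i) (y t) $ i) (at t))"
    using holomorphic_ode_existence[OF X chart_image_open[OF c O]] by metis
  define N where "N = snd c -` ball (snd c p) \<delta> \<inter> ?O"
  have "open N" unfolding N_def
    using continuous_on_subset[OF chart_continuous[OF c] O(2)] O(1) by (simp add: continuous_on_open_vimage)
  moreover have "p \<in> N" using p dr by (auto simp: N_def)
  moreover have "\<exists>\<gamma>. integral_curve E c (W \<inter> V) X \<gamma> r \<and> \<gamma> 0 = p'" if p': "p' \<in> N" for p'
  proof -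
    have "snd c p' \<in> ball (snd c p) \<delta>" using p' by (auto simp: N_def)
    from flow[OF this] obtain y where y: "y 0 = snd c p'" "y ` ball 0 r \<subseteq> snd c ` ?O"
       "\<And>t i. t \<in> ball 0 r \<Longrightarrow> ((\<lambda>s. y s $ i) has_field_derivative (X \<circ> ?i) (y t) $ i) (at t)"
      by (elim exE conjE) simp
    have yO: "?i (y t) \<in> ?O" "snd c (?i (y t)) = y t" if "t \<in> ball 0 r" for t
    proof -
      have "y t \<in> snd c ` ?O" using y(2) imageI[OF that] by (rule subsetD)
      then obtain q where "q \<in> ?O" "y t = snd c q" by (rule imageE)
      then show "?i (y t) \<in> ?O" "snd c (?i (y t)) = y t" using O(2) chart_inv[OF c, of q] by auto
    qed
    have "integral_curve E c (W \<inter> V) X (?i \<circ> y) r"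
      unfolding integral_curve_def
    proof (intro conjI ballI allI)
      show "(?i \<circ> y) ` ball 0 r \<subseteq> W \<inter> V - E" using yO by auto
      fix t :: complex and i :: 'n assume t: "t \<in> ball 0 r"
      show "((\<lambda>s. snd c ((?i \<circ> y) s) $ i) has_field_derivative X ((?i \<circ> y) t) $ i) (at t)"
        unfolding o_def
        by (rule has_field_derivative_transform_within_open[OF y(3)[OF t, of i, unfolded o_def] open_ball t])
          (simp add: yO)
    qed (rule dr)
    moreover have "(?i \<circ> y) 0 = p'" using y(1) chart_inv[OF c, of p'] p' O(2) by (auto simp: N_def)
    ultimately show ?thesis by blast
  qed
  ultimately show ?thesis using dr(2) by (intro that[of N r]) (auto simp: N_def)
qed

text \<open>In coordinates \<open>\<beta>\<close> solves \<open>y' = u X(y)\<close> with a scalar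
  function \<open>u\<close>. If \<open>T\<close> is a primitive of \<open>u\<close> with
  \<open>T s0 = t0\<close>, then \<open>\<gamma> \<circ> T\<close> solves the same equation with the
  same initial value, so the two agree near \<open>s0\<close>.\<close>

lemma tangent_curve_in_plaque:
  assumes \<beta>: "tangent_curve A E F S \<beta>" "open S" "s0 \<in> S"
    and G: "(c, W, X) \<in> F" and \<gamma>: "integral_curve E c W X \<gamma> r" and t0: "t0 \<in> ball 0 r" "\<beta> s0 = \<gamma> t0"
  obtains e T where "0 < e" "ball s0 e \<subseteq> S" "T holomorphic_on ball s0 e" "T s0 = t0"
    "\<And>s. s \<in> ball s0 e \<Longrightarrow> T s \<in> ball 0 r \<and> \<beta> s = \<gamma> (T s)"
proof -
  note c = generator(1)[OF G]
  let ?i = "inv_into (fst c) (snd c)"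
  have hb: "holomorphic_curve_on A S \<beta>" and tb: "\<And>s. s \<in> S \<Longrightarrow> tangent_at F \<beta> s" "\<And>s. s \<in> S \<Longrightarrow> \<beta> s \<notin> E"
    using \<beta>(1) by (auto simp: tangent_curve_def)
  have \<gamma>W: "\<gamma> t \<in> W" "\<gamma> t \<notin> E" if "t \<in> ball 0 r" for t
    using integral_curveD[OF \<gamma> that] by auto
  have bW: "\<beta> s0 \<in> W" using \<gamma>W(1)[OF t0(1)] t0(2) by simp
  have "X (\<beta> s0) \<noteq> 0" using generator(5)[OF G bW] tb(2)[OF \<beta>(3)] by simp
  then obtain j where j: "X (\<beta> s0) $ j \<noteq> 0" by (auto simp: vec_eq_iff)
  let ?S1 = "{s \<in> S. \<beta> s \<in> W}"
  have S1: "open ?S1" "s0 \<in> ?S1"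
    using curve_in_chart_open[OF c hb \<beta>(2) generator(2)[OF G]] \<beta>(3) bW by auto
  have hS1: "holomorphic_curve_on A ?S1 \<beta>" by (rule holomorphic_curve_on_subset[OF hb]) auto
  have Xh: "(\<lambda>s. X (\<beta> s) $ j) holomorphic_on ?S1"
    by (rule holomorphic_fun_in_curve[OF generator(4,2)[OF G] hS1 S1(1)]) auto
  let ?S2 = "{s \<in> ?S1. X (\<beta> s) $ j \<noteq> 0}"
  have "open (?S1 \<inter> (\<lambda>s. X (\<beta> s) $ j) -` (- {0}))"
    by (rule continuous_open_preimage[OF holomorphic_on_imp_continuous_on[OF Xh] S1(1)]) auto
  moreover have "?S1 \<inter> (\<lambda>s. X (\<beta> s) $ j) -` (- {0}) = ?S2" by auto
  ultimately have S2: "open ?S2" "s0 \<in> ?S2" using S1(2) j by auto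
  \<comment> \<open>Tangency gives one factor per point with no regularity; dividing by a coordinate
    of \<open>X\<close> that does not vanish shows that the factor is holomorphic.\<close>
  define u where "u = (\<lambda>s. deriv (\<lambda>t. snd c (\<beta> t) $ j) s / X (\<beta> s) $ j)"
  have "(\<lambda>t. snd c (\<beta> t) $ j) holomorphic_on ?S1"
    by (rule curve_coord_holomorphic[OF c hS1]) (use generator(3)[OF G] in auto)
  then have dh: "deriv (\<lambda>t. snd c (\<beta> t) $ j) holomorphic_on ?S1" by (rule holomorphic_deriv[OF _ S1(1)])
  have uh: "u holomorphic_on ?S2"
    unfolding u_def
    by (rule holomorphic_on_divide[OF holomorphic_on_subset[OF dh] holomorphic_on_subset[OF Xh]]) auto
  have ub: "velocity c \<beta> s = u s *s X (\<beta> s)" if s: "s \<in> ?S2" for s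
  proof -
    obtain k where k: "velocity c \<beta> s = k *s X (\<beta> s)" using tangent_atD[OF tb(1) G] s by auto
    have "deriv (\<lambda>t. snd c (\<beta> t) $ j) s = velocity c \<beta> s $ j" by (simp add: velocity_def)
    then have "u s = k" using s by (simp add: u_def k)
    then show ?thesis using k by simp
  qed
  obtain e1 where e1: "0 < e1" "ball s0 e1 \<subseteq> ?S2" by (rule openE[OF S2]) (rule that)
  obtain T where T: "T s0 = t0" "\<And>t. t \<in> ball s0 e1 \<Longrightarrow> (T has_field_derivative u t) (at t)"
    by (rule holomorphic_primitive_ball[OF holomorphic_on_subset[OF uh e1(2)], of t0]) (rule that)
  have Th: "T holomorphic_on ball s0 e1" by (rule holomorphic_onI_DERIV) (rule T(2))
  \<comment> \<open>Here \<open>T\<close> takes values in the time disc of \<open>\<gamma>\<close>,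
    so that \<open>\<gamma> \<circ> T\<close> satisfies the equation.\<close>
  let ?S3 = "T -` ball 0 r \<inter> ball s0 e1"
  have S3: "open ?S3" "s0 \<in> ?S3"
    using holomorphic_on_imp_continuous_on[OF Th] T(1) t0(1) e1 by (auto simp: continuous_on_open_vimage)
  define y1 y2 where "y1 = (\<lambda>s. snd c (\<beta> s))" and "y2 = (\<lambda>s. snd c (\<gamma> (T s)))"
  have W: "W \<subseteq> fst c" by (rule generator(3)[OF G])
  have "\<exists>e>0. ball s0 e \<subseteq> ?S3 \<and> (\<forall>s\<in>ball s0 e. y1 s = y2 s)"
  proof (rule holomorphic_ode_unique[where X = "X \<circ> ?i" and \<Omega> = "snd c ` W" and S = ?S3 and ?s0.0 = s0
        and u = u and ?y1.0 = y1 and ?y2.0 = y2])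
    show "holomorphic_map_on (X \<circ> ?i) (snd c ` W)" by (rule generator_map[OF G order_refl])
    show "open (snd c ` W)" by (rule chart_image_open[OF c generator(2,3)[OF G]])
    show "continuous_on ?S3 u"
      by (rule holomorphic_on_imp_continuous_on[OF holomorphic_on_subset[OF uh]]) (use e1 in auto)
    show "y1 ` ?S3 \<subseteq> snd c ` W" using e1 by (auto simp: y1_def)
    show "y2 ` ?S3 \<subseteq> snd c ` W" using \<gamma>W(1) by (auto simp: y2_def)
    show "y1 s0 = y2 s0" by (simp add: y1_def y2_def T(1) t0(2))
    fix s :: complex and i :: 'n assume s: "s \<in> ?S3"
    then have s2: "s \<in> ?S2" using e1(2) by blast
    have "(X \<circ> ?i) (y1 s) = X (\<beta> s)"
      using s2 W chart_inv[OF c, of "\<beta> s"] by (auto simp: y1_def)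
    moreover have "((\<lambda>s. snd c (\<beta> s) $ i) has_field_derivative velocity c \<beta> s $ i) (at s)"
      by (rule curve_has_velocity[OF c hb \<beta>(2)]) (use s2 W in auto)
    ultimately show "((\<lambda>s. y1 s $ i) has_field_derivative u s * (X \<circ> ?i) (y1 s) $ i) (at s)"
      using ub[OF s2] by (simp add: y1_def)
    have Ts: "T s \<in> ball 0 r" "s \<in> ball s0 e1" using s by auto
    have "((\<lambda>t. snd c (\<gamma> t) $ i) has_field_derivative X (\<gamma> (T s)) $ i) (at (T s))"
      by (rule integral_curveD(3)[OF \<gamma> Ts(1)])
    from DERIV_chain2[OF this T(2)[OF Ts(2)]]
    have "((\<lambda>s. y2 s $ i) has_field_derivative X (\<gamma> (T s)) $ i * u s) (at s)" by (simp add: y2_def)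
    moreover have "(X \<circ> ?i) (y2 s) = X (\<gamma> (T s))"
      using \<gamma>W(1)[OF Ts(1)] W chart_inv[OF c, of "\<gamma> (T s)"] by (auto simp: y2_def)
    ultimately show "((\<lambda>s. y2 s $ i) has_field_derivative u s * (X \<circ> ?i) (y2 s) $ i) (at s)"
      by (simp add: mult.commute)
  next
    show "\<exists>e>0. ball s0 e \<subseteq> ?S3 \<and> (\<forall>s\<in>ball s0 e. y1 s = y2 s)"
      if "0 < e" "ball s0 e \<subseteq> ?S3" "\<And>s. s \<in> ball s0 e \<Longrightarrow> y1 s = y2 s" for e
      using that by blast
  qed (use S3 in auto)
  then obtain e where e: "0 < e" "ball s0 e \<subseteq> ?S3" "\<And>s. s \<in> ball s0 e \<Longrightarrow> y1 s = y2 s" by auto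
  show ?thesis
  proof (rule that[of e T])
    show "ball s0 e \<subseteq> S" using e(2) e1(2) by blast
    show "T holomorphic_on ball s0 e" by (rule holomorphic_on_subset[OF Th]) (use e(2) in blast)
    fix s assume s: "s \<in> ball s0 e"
    then have Ts: "T s \<in> ball 0 r" "s \<in> ?S2" using e(2) e1(2) by blast+
    have "\<beta> s \<in> fst c" "\<gamma> (T s) \<in> fst c" using Ts(2) \<gamma>W(1)[OF Ts(1)] W by auto
    moreover have "snd c (\<beta> s) = snd c (\<gamma> (T s))" using e(3)[OF s] by (simp add: y1_def y2_def)
    ultimately have "\<beta> s = \<gamma> (T s)" using chart_inj[OF c] by (meson inj_onD)
    then show "T s \<in> ball 0 r \<and> \<beta> s = \<gamma> (T s)" using Ts(1) by simp
  qed (use e(1) T(1) in auto)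
qed

end


section \<open>The leaf topology\<close>

lemma plaque_restrictE:
  assumes "plaque E (restrict_foliation F V) P"
  obtains c W X \<gamma> r where "(c, W, X) \<in> F" "integral_curve E c (W \<inter> V) X \<gamma> r" "P = \<gamma> ` ball 0 r"
  using assms unfolding plaque_restrict_iff by (elim exE conjE) (rule that)

lemma plaque_restrictI:
  "\<lbrakk>(c, W, X) \<in> F; integral_curve E c (W \<inter> V) X \<gamma> r\<rbrakk> \<Longrightarrow> plaque E (restrict_foliation F V) (\<gamma> ` ball 0 r)"
  unfolding plaque_restrict_iff by (intro exI conjI, assumption, assumption, rule refl)

context foliation
begin

lemma topspace_leaf_topology_restrict:
  assumes V: "open V"
  shows "topspace (leaf_topology E (restrict_foliation F V)) = V - E"
proof -
  have "topspace (leaf_topology E (restrict_foliation F V)) = \<Union> (Collect (plaque E (restrict_foliation F V)))"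
    by (simp add: leaf_topology_def topology_generated_by_topspace)
  also have "\<dots> = V - E"
  proof (intro equalityI subsetI)
    fix p assume "p \<in> \<Union> (Collect (plaque E (restrict_foliation F V)))"
    then obtain P where P: "plaque E (restrict_foliation F V) P" "p \<in> P" by auto
    obtain c W X \<gamma> r where "(c, W, X) \<in> F"
      and \<gamma>: "integral_curve E c (W \<inter> V) X \<gamma> r" "P = \<gamma> ` ball 0 r"
      by (rule plaque_restrictE[OF P(1)]) (rule that)
    obtain t where "p = \<gamma> t" "t \<in> ball 0 r" using P(2) unfolding \<gamma>(2) by (rule imageE)
    then show "p \<in> V - E" using integral_curveD(1,2)[OF \<gamma>(1), of t] by simp
  next
    fix p assume p: "p \<in> V - E"
    obtain c W X where G: "(c, W, X) \<in> F" "p \<in> W" by (rule ex_generator)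
    obtain N r where N: "p \<in> N" "\<And>p'. p' \<in> N \<Longrightarrow> \<exists>\<gamma>. integral_curve E c (W \<inter> V) X \<gamma> r \<and> \<gamma> 0 = p'" "0 < r"
      using local_flow[OF G(1) V G(2)] p by (metis Diff_iff)
    obtain \<gamma> where \<gamma>: "integral_curve E c (W \<inter> V) X \<gamma> r" "\<gamma> 0 = p" using N by blast
    then have "plaque E (restrict_foliation F V) (\<gamma> ` ball 0 r)"
      by (intro plaque_restrictI[OF G(1)])
    moreover have "p \<in> \<gamma> ` ball 0 r" using \<gamma>(2) N(3) by force
    ultimately show "p \<in> \<Union> (Collect (plaque E (restrict_foliation F V)))" by blast
  qed
  finally show ?thesis .
qed

lemma topspace_leaf_topology: "topspace (leaf_topology E F) = - E"
  using topspace_leaf_topology_restrict[of UNIV] by auto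

text \<open>Plaques generate the topology, so it suffices that their preimages are open, and
  \<open>tangent_curve_in_plaque\<close> says just that: a tangent curve that meets a plaque stays
  in it for a while.\<close>

lemma tangent_curve_leaf_continuous_restrict:
  assumes \<beta>: "tangent_curve A E F S \<beta>" "open S" and V: "open V" "\<beta> ` S \<subseteq> V"
  shows "continuous_map (top_of_set S) (leaf_topology E (restrict_foliation F V)) \<beta>"
  unfolding leaf_topology_def
proof (rule continuous_on_generated_topo)
  show "\<beta> ` topspace (top_of_set S) \<subseteq> \<Union> (Collect (plaque E (restrict_foliation F V)))"
    using topspace_leaf_topology_restrict[OF V(1)] V(2) \<beta>(1)
    by (auto simp: leaf_topology_def topology_generated_by_topspace tangent_curve_def)
  fix P assume "P \<in> Collect (plaque E (restrict_foliation F V))"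
  then have "plaque E (restrict_foliation F V) P" by simp
  then obtain c W X \<gamma> r where G: "(c, W, X) \<in> F" and \<gamma>: "integral_curve E c (W \<inter> V) X \<gamma> r"
    and P: "P = \<gamma> ` ball 0 r"
    by (rule plaque_restrictE) (rule that)
  have \<gamma>': "integral_curve E c W X \<gamma> r" by (rule integral_curve_mono[OF \<gamma>]) auto
  have "\<exists>e>0. ball s e \<subseteq> \<beta> -` P \<inter> S" if s: "s \<in> \<beta> -` P \<inter> S" for s
  proof -
    obtain t where t: "t \<in> ball 0 r" "\<beta> s = \<gamma> t" using s P by auto
    have "s \<in> S" using s by auto
    from tangent_curve_in_plaque[OF \<beta> this G \<gamma>' t]
    obtain e T where "0 < e" "ball s e \<subseteq> S" "\<And>u. u \<in> ball s e \<Longrightarrow> T u \<in> ball 0 r \<and> \<beta> u = \<gamma> (T u)"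
      by metis
    then show ?thesis using P by (intro exI[of _ e]) auto
  qed
  then have "open (\<beta> -` P \<inter> S)" by (subst open_contains_ball) blast
  then show "openin (top_of_set S) (\<beta> -` P \<inter> topspace (top_of_set S))"
    using \<beta>(2) by (simp add: openin_open_eq)
qed

lemma tangent_curve_leaf_continuous:
  assumes "tangent_curve A E F S \<beta>" "open S"
  shows "continuous_map (top_of_set S) (leaf_topology E F) \<beta>"
  using tangent_curve_leaf_continuous_restrict[OF assms, of UNIV] by simp

lemma tangent_curve_in_leaf_restrict:
  assumes \<beta>: "tangent_curve A E F S \<beta>" "open S" and V: "open V" "\<beta> ` S \<subseteq> V"
    and S: "connected S" "s \<in> S" "t \<in> S"
  shows "\<beta> t \<in> leaf E (restrict_foliation F V) (\<beta> s)"
proof -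
  have "connectedin (leaf_topology E (restrict_foliation F V)) (\<beta> ` S)"
    by (rule connectedin_continuous_map_image[OF tangent_curve_leaf_continuous_restrict[OF \<beta> V]])
      (use S(1) in \<open>simp add: connectedin_subtopology\<close>)
  then have "connected_component_of (leaf_topology E (restrict_foliation F V)) (\<beta> s) (\<beta> t)"
    unfolding connected_component_of_def using S by blast
  moreover have "\<beta> s \<notin> E" using \<beta>(1) S by (auto simp: tangent_curve_def)
  ultimately show ?thesis by (simp add: leaf_def)
qed

lemma tangent_curve_in_leaf:
  assumes "tangent_curve A E F S \<beta>" "open S" "connected S" "s \<in> S" "t \<in> S"
  shows "\<beta> t \<in> leaf E F (\<beta> s)"
  using tangent_curve_in_leaf_restrict[OF assms(1,2) _ _ assms(3-5), of UNIV] by simp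

lemma leaf_disjoint_singular: "\<lbrakk>p \<notin> E; q \<in> leaf E F p\<rbrakk> \<Longrightarrow> q \<notin> E"
  using connected_component_in_topspace[of "leaf_topology E F" p q]
  by (simp add: leaf_def topspace_leaf_topology)

lemma leaf_eq: "\<lbrakk>p \<notin> E; q \<in> leaf E F p\<rbrakk> \<Longrightarrow> leaf E F q = leaf E F p"
  using leaf_disjoint_singular[of p q] connected_component_of_equiv[of "leaf_topology E F" p q]
  by (simp add: leaf_def)

lemma leaf_refl: "p \<in> leaf E F p"
  using connected_component_of_refl[of "leaf_topology E F" p]
  by (simp add: leaf_def topspace_leaf_topology)

text \<open>Some coordinate of \<open>X p\<close> is nonzero, so that coordinate of the integral
  curve has nonzero derivative at 0 and is injective on a smaller disc. Inverting it recovers the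
  time from the point holomorphically.\<close>

lemma embedded_plaque:
  assumes G: "(c, W, X) \<in> F" and p: "p \<in> W" "p \<notin> E"
  obtains \<gamma> r i where "integral_curve E c W X \<gamma> r" "\<gamma> 0 = p" "inj_on (\<lambda>t. snd c (\<gamma> t) $ i) (ball 0 r)"
proof -
  obtain N r0 where N: "p \<in> N" "\<And>p'. p' \<in> N \<Longrightarrow> \<exists>\<gamma>. integral_curve E c (W \<inter> UNIV) X \<gamma> r0 \<and> \<gamma> 0 = p'" "0 < r0"
    using local_flow[OF G open_UNIV p(1) UNIV_I p(2)] by metis
  then obtain \<gamma> where \<gamma>: "integral_curve E c W X \<gamma> r0" "\<gamma> 0 = p" by auto
  have "X p \<noteq> 0" using generator(5)[OF G p(1)] p(2) by simp
  then obtain i where i: "X p $ i \<noteq> 0" by (auto simp: vec_eq_iff)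
  have h: "(\<lambda>t. snd c (\<gamma> t) $ i) holomorphic_on ball 0 r0"
    by (rule holomorphic_onI_DERIV) (rule integral_curveD(3)[OF \<gamma>(1)])
  have "deriv (\<lambda>t. snd c (\<gamma> t) $ i) 0 = X p $ i"
    using integral_curveD(3)[OF \<gamma>(1), of 0 i] N(3) \<gamma>(2) by (intro DERIV_imp_deriv) simp
  then have "deriv (\<lambda>t. snd c (\<gamma> t) $ i) 0 \<noteq> 0" using i by simp
  moreover have "(0::complex) \<in> ball 0 r0" using N(3) by simp
  ultimately obtain r1 where r1: "0 < r1" "inj_on (\<lambda>t. snd c (\<gamma> t) $ i) (ball 0 r1)"
    using has_complex_derivative_locally_injective[OF h _ open_ball] by metis
  show ?thesis
  proof (rule that[of \<gamma> "min r0 r1" i])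
    show "integral_curve E c W X \<gamma> (min r0 r1)"
      by (rule integral_curve_subset[OF \<gamma>(1)]) (use r1 N(3) in auto)
    show "inj_on (\<lambda>t. snd c (\<gamma> t) $ i) (ball 0 (min r0 r1))"
      by (rule inj_on_subset[OF r1(2)]) auto
  qed (rule \<gamma>)
qed

text \<open>The hypothesis concerns the image of \<open>\<beta>\<close> as a set, with no continuity
  for the leaf topology. The injective coordinate reads off the time \<open>T s\<close> from
  \<open>\<beta> s\<close>, whence \<open>\<beta> = \<gamma> \<circ> T\<close> with \<open>T\<close>
  holomorphic, and tangency follows from the chain rule.\<close>

lemma curve_in_embedded_plaque:
  assumes \<beta>: "holomorphic_curve_on A S \<beta>" "open S"
    and G: "(c, W, X) \<in> F" and \<gamma>: "integral_curve E c W X \<gamma> r"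
    and inj: "inj_on (\<lambda>t. snd c (\<gamma> t) $ i) (ball 0 r)" and sub: "\<beta> ` S \<subseteq> \<gamma> ` ball 0 r"
  obtains T where "T holomorphic_on S" "\<And>s. s \<in> S \<Longrightarrow> T s \<in> ball 0 r \<and> \<beta> s = \<gamma> (T s)"
    "tangent_curve A E F S \<beta>"
proof -
  note c = generator(1)[OF G]
  note gh = integral_curve_holomorphic[OF c generator(3)[OF G] \<gamma>]
  let ?k = "\<lambda>t. snd c (\<gamma> t) $ i"
  have k: "?k holomorphic_on ball 0 r"
    by (rule holomorphic_onI_DERIV) (rule integral_curveD(3)[OF \<gamma>])
  obtain l where l: "l holomorphic_on ?k ` ball 0 r" "\<And>t. t \<in> ball 0 r \<Longrightarrow> l (?k t) = t"
    by (rule holomorphic_has_inverse[OF k open_ball inj]) (rule that)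
  define T where "T = (\<lambda>s. l (snd c (\<beta> s) $ i))"
  have T: "T s \<in> ball 0 r \<and> \<beta> s = \<gamma> (T s)" if s: "s \<in> S" for s
  proof -
    obtain t where "t \<in> ball 0 r" "\<beta> s = \<gamma> t" using sub s by blast
    then show ?thesis using l(2) by (simp add: T_def)
  qed
  have bW: "\<beta> s \<in> W" "\<beta> s \<notin> E" if "s \<in> S" for s
    using integral_curveD(1,2)[OF \<gamma>, of "T s"] T[OF that] by auto
  have bh: "(\<lambda>s. snd c (\<beta> s) $ i) holomorphic_on S"
    by (rule curve_coord_holomorphic[OF c \<beta>(1)]) (use bW generator(3)[OF G] in auto)
  have "(l \<circ> (\<lambda>s. snd c (\<beta> s) $ i)) holomorphic_on S"
    by (rule holomorphic_on_compose_gen[OF bh l(1)]) (use T in auto)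
  then have Th: "T holomorphic_on S" by (simp add: T_def o_def)
  have "tangent_at F \<beta> s" if s: "s \<in> S" for s
  proof (rule tangent_atI[OF \<beta> s bW(2)[OF s] G bW(1)[OF s]])
    have "velocity c \<beta> s = velocity c (\<gamma> \<circ> T) s"
      by (rule velocity_cong[OF \<beta>(2) s]) (use T in auto)
    also have "\<dots> = deriv T s *s velocity c \<gamma> (T s)"
    proof (rule velocity_compose[OF c gh(1) open_ball])
      show "T s \<in> ball 0 r" using T[OF s] by simp
      then show "\<gamma> (T s) \<in> fst c" using integral_curveD(1)[OF \<gamma>] generator(3)[OF G] by auto
      show "(T has_field_derivative deriv T s) (at s)" by (rule holomorphic_derivI[OF Th \<beta>(2) s])
    qed
    also have "velocity c \<gamma> (T s) = X (\<beta> s)" using gh(2)[of "T s"] T[OF s] by simp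
    finally show "velocity c \<beta> s = deriv T s *s X (\<beta> s)" .
  qed
  then have "tangent_curve A E F S \<beta>"
    unfolding tangent_curve_def using \<beta>(1) bW(2) by auto
  with Th T show ?thesis by (rule that)
qed

lemma openin_plaque:
  "\<lbrakk>(c, W, X) \<in> F; integral_curve E c W X \<gamma> r\<rbrakk> \<Longrightarrow> openin (leaf_topology E F) (\<gamma> ` ball 0 r)"
  unfolding leaf_topology_def
  using plaque_restrictI[of c W X F E UNIV] by (intro topology_generated_by_Basis) simp

text \<open>The converse of \<open>tangent_curve_leaf_continuous\<close>: leaf continuity makes the
  preimage of an embedded plaque open, and there \<open>curve_in_embedded_plaque\<close>
  applies.\<close>

lemma leaf_continuous_imp_tangent:
  assumes \<beta>: "holomorphic_curve_on A S \<beta>" "open S"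
    and cont: "continuous_map (top_of_set S) (leaf_topology E F) \<beta>"
  shows "tangent_curve A E F S \<beta>"
proof -
  have bE: "\<beta> s \<notin> E" if "s \<in> S" for s
    using continuous_map_image_subset_topspace[OF cont] that by (auto simp: topspace_leaf_topology)
  have "tangent_at F \<beta> s" if s: "s \<in> S" for s
  proof -
    obtain c W X where G: "(c, W, X) \<in> F" "\<beta> s \<in> W" by (rule ex_generator)
    obtain \<gamma> r i where \<gamma>: "integral_curve E c W X \<gamma> r" "\<gamma> 0 = \<beta> s" "inj_on (\<lambda>t. snd c (\<gamma> t) $ i) (ball 0 r)"
      by (rule embedded_plaque[OF G bE[OF s]])
    let ?N = "{x \<in> S. \<beta> x \<in> \<gamma> ` ball 0 r}"
    have "openin (top_of_set S) ?N"
      using openin_continuous_map_preimage[OF cont openin_plaque[OF G(1) \<gamma>(1)]] by simp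
    then have N: "open ?N" using \<beta>(2) openin_open_trans by blast
    have "0 < r" using \<gamma>(1) unfolding integral_curve_def ..
    then have "\<gamma> 0 \<in> \<gamma> ` ball 0 r" by (intro imageI) simp
    then have "s \<in> ?N" using s \<gamma>(2) by simp
    moreover have hN: "holomorphic_curve_on A ?N \<beta>" by (rule holomorphic_curve_on_subset[OF \<beta>(1)]) blast
    have sub: "\<beta> ` ?N \<subseteq> \<gamma> ` ball 0 r" by blast
    have "tangent_curve A E F ?N \<beta>"
      by (rule curve_in_embedded_plaque[OF hN N G(1) \<gamma>(1,3) sub])
    ultimately show ?thesis unfolding tangent_curve_def by blast
  qed
  with \<beta>(1) bE show ?thesis unfolding tangent_curve_def by auto
qed

text \<open>Off \<open>E\<close> the field is nonzero, so tangency is the vanishing of the 2x2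
  minors formed from the velocity and the field. Along \<open>f\<close> these are holomorphic, and
  the identity theorem spreads their vanishing from ball to ball.\<close>

lemma tangent_curve_extend:
  assumes f: "holomorphic_curve_on A S f" "open S" "connected S" "f ` S \<inter> E = {}"
    and O: "open O'" "O' \<noteq> {}" "O' \<subseteq> S" "\<And>s. s \<in> O' \<Longrightarrow> tangent_at F f s"
  shows "tangent_curve A E F S f"
proof -
  \<comment> \<open>Tangency on a whole ball is what propagates, because the identity theorem starts
    from a nonempty open set.\<close>
  define P where "P = (\<lambda>s. \<exists>e>0. ball s e \<subseteq> S \<and> (\<forall>t\<in>ball s e. tangent_at F f t))"
  obtain a where a: "a \<in> O'" using O(2) by auto
  obtain e0 where "0 < e0" "ball a e0 \<subseteq> O'" by (rule openE[OF O(1) a])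
  then have "P a" unfolding P_def using O(3,4) by (intro exI[of _ e0]) blast
  have fE: "f s \<notin> E" if "s \<in> S" for s using f(4) that by blast
  have "P b" if b: "b \<in> S" for b
  proof (rule connected_induction_simple[OF f(3) _ b, of a P])
    show "a \<in> S" "P a" using a O(3) \<open>P a\<close> by auto
  next
    fix s assume s: "s \<in> S"
    obtain c W X where G: "(c, W, X) \<in> F" "f s \<in> W" by (rule ex_generator)
    note c = generator(1)[OF G(1)]
    have "open {z \<in> S. f z \<in> W}" by (rule curve_in_chart_open[OF c f(1,2) generator(2)[OF G(1)]])
    moreover have "s \<in> {z \<in> S. f z \<in> W}" using s G(2) by simp
    ultimately obtain e where e: "0 < e" "ball s e \<subseteq> {z \<in> S. f z \<in> W}" by (rule openE)
    let ?B = "ball s e"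
    have BS: "?B \<subseteq> S" "f ` ?B \<subseteq> W" using e(2) by auto
    have hB: "holomorphic_curve_on A ?B f" by (rule holomorphic_curve_on_subset[OF f(1) BS(1)])
    have vh: "(\<lambda>t. velocity c f t $ i) holomorphic_on ?B" for i
    proof -
      have "(\<lambda>z. snd c (f z) $ i) holomorphic_on ?B"
        by (rule curve_coord_holomorphic[OF c hB]) (use BS generator(3)[OF G(1)] in blast)
      from holomorphic_deriv[OF this open_ball] show ?thesis by (simp add: velocity_def)
    qed
    have Xh: "(\<lambda>t. X (f t) $ i) holomorphic_on ?B" for i
      by (rule holomorphic_fun_in_curve[OF generator(4,2)[OF G(1)] hB open_ball BS(2)])
    have main: "P y" if xy: "x \<in> ?B" "y \<in> ?B" "P x" for x y
    proof -
      obtain e' where e': "0 < e'" "\<And>t. t \<in> ball x e' \<Longrightarrow> tangent_at F f t"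
        using xy(3) unfolding P_def by blast
      \<comment> \<open>The minors vanish where \<open>?B\<close> meets the ball about
        \<open>x\<close>, hence on all of \<open>?B\<close>.\<close>
      have cross: "velocity c f t $ i * X (f t) $ j = velocity c f t $ j * X (f t) $ i" if t: "t \<in> ?B" for t i j
      proof (rule analytic_continuation_open[of "?B \<inter> ball x e'" "?B"
            "\<lambda>t. velocity c f t $ i * X (f t) $ j" "\<lambda>t. velocity c f t $ j * X (f t) $ i"])
        show "?B \<inter> ball x e' \<noteq> {}" using xy(1) e'(1) by (metis IntI centre_in_ball empty_iff)
        show "(\<lambda>t. velocity c f t $ i * X (f t) $ j) holomorphic_on ?B"
          by (rule holomorphic_on_mult[OF vh Xh])
        show "(\<lambda>t. velocity c f t $ j * X (f t) $ i) holomorphic_on ?B"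
          by (rule holomorphic_on_mult[OF vh Xh])
        fix z assume z: "z \<in> ?B \<inter> ball x e'"
        then have "f z \<in> W" using BS by blast
        then obtain u where "velocity c f z = u *s X (f z)"
          using tangent_atD[OF e'(2) G(1)] z by blast
        then show "velocity c f z $ i * X (f z) $ j = velocity c f z $ j * X (f z) $ i" by simp
      qed (use t in auto)
      have "tangent_at F f t" if t: "t \<in> ?B" for t
      proof -
        have tt: "t \<in> S" "f t \<in> W" "f t \<notin> E" using t BS fE by blast+
        then obtain j where j: "X (f t) $ j \<noteq> 0" using generator(5)[OF G(1) tt(2)] by (auto simp: vec_eq_iff)
        show ?thesis
        proof (rule tangent_atI[OF f(1,2) tt(1,3) G(1) tt(2)])
          show "velocity c f t = (velocity c f t $ j / X (f t) $ j) *s X (f t)"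
            using cross[OF t, of _ j] j by (simp add: vec_eq_iff field_simps)
        qed
      qed
      moreover obtain e2 where "0 < e2" "ball y e2 \<subseteq> ?B" by (rule openE[OF open_ball xy(2)])
      ultimately show ?thesis unfolding P_def using BS(1) by blast
    qed
    show "\<exists>T. openin (top_of_set S) T \<and> s \<in> T \<and> (\<forall>x\<in>T. \<forall>y\<in>T. P x \<longrightarrow> P y)"
    proof (intro exI[of _ ?B] conjI)
      show "openin (top_of_set S) ?B" using BS(1) f(2) by (simp add: openin_open_eq)
      show "s \<in> ?B" using e(1) by simp
      show "\<forall>x\<in>?B. \<forall>y\<in>?B. P x \<longrightarrow> P y" using main by blast
    qed
  qed
  then have "tangent_at F f b" if "b \<in> S" for b using that unfolding P_def by (meson centre_in_ball)
  then show ?thesis unfolding tangent_curve_def using f by auto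
qed

end


section \<open>Uniformizations and lifting of discs\<close>

lemma evenly_covered:
  assumes cov: "covering_map_top X Y \<alpha>" and y: "y \<in> topspace Y"
  obtains T \<V> where "openin Y T" "y \<in> T" "\<Union>\<V> = {x \<in> topspace X. \<alpha> x \<in> T}"
    "\<And>V. V \<in> \<V> \<Longrightarrow> openin X V" "pairwise disjnt \<V>"
    "\<And>V. V \<in> \<V> \<Longrightarrow> homeomorphic_map (subtopology X V) (subtopology Y T) \<alpha>"
proof -
  have "\<forall>y\<in>topspace Y. \<exists>T. openin Y T \<and> y \<in> T \<and>
        (\<exists>\<V>. \<Union>\<V> = {x \<in> topspace X. \<alpha> x \<in> T} \<and> (\<forall>V\<in>\<V>. openin X V) \<and> pairwise disjnt \<V> \<and>
           (\<forall>V\<in>\<V>. homeomorphic_map (subtopology X V) (subtopology Y T) \<alpha>))"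
    using cov unfolding covering_map_top_def by (rule conjunct2[THEN conjunct2])
  from bspec[OF this y] obtain T \<V> where "openin Y T" "y \<in> T" "\<Union>\<V> = {x \<in> topspace X. \<alpha> x \<in> T}"
    "\<forall>V\<in>\<V>. openin X V" "pairwise disjnt \<V>"
    "\<forall>V\<in>\<V>. homeomorphic_map (subtopology X V) (subtopology Y T) \<alpha>"
    by (elim exE conjE) (rule that)
  then show ?thesis by (intro that[of T \<V>]) simp_all
qed

section \<open>Tangency of discs in leaves and their lifts through uniformizations\<close>

context foliation
begin

lemma uniformization_ofD:
  assumes \<alpha>: "uniformization_of A E F p \<alpha>" and p: "p \<notin> E"
  shows "holomorphic_curve_on A (ball 0 1) \<alpha>"
    and "\<alpha> ` ball 0 1 = leaf E F p"
    and "tangent_curve A E F (ball 0 1) \<alpha>"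
proof -
  let ?Y = "subtopology (leaf_topology E F) (leaf E F p)"
  have cov: "covering_map_top (top_of_set (ball 0 1)) ?Y \<alpha>"
    using \<alpha> by (simp add: uniformization_of_def)
  show h: "holomorphic_curve_on A (ball 0 1) \<alpha>"
    using \<alpha> by (simp add: uniformization_of_def discs_def)
  have "topspace ?Y = leaf E F p"
    using leaf_disjoint_singular[OF p] by (auto simp: topspace_leaf_topology)
  then show "\<alpha> ` ball 0 1 = leaf E F p"
    using cov unfolding covering_map_top_def by simp
  have "continuous_map (top_of_set (ball 0 1)) ?Y \<alpha>"
    using cov by (simp add: covering_map_top_def)
  then have "continuous_map (top_of_set (ball 0 1)) (leaf_topology E F) \<alpha>"
    by (simp add: continuous_map_in_subtopology)
  then show "tangent_curve A E F (ball 0 1) \<alpha>"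
    by (rule leaf_continuous_imp_tangent[OF h open_ball])
qed

lemma uniformization_locally_injective:
  assumes \<alpha>: "uniformization_of A E F p \<alpha>" and w: "w \<in> ball 0 1"
  obtains N where "open N" "w \<in> N" "N \<subseteq> ball 0 1" "inj_on \<alpha> N"
proof -
  let ?X = "top_of_set (ball (0::complex) 1)"
  let ?Y = "subtopology (leaf_topology E F) (leaf E F p)"
  have cov: "covering_map_top ?X ?Y \<alpha>"
    using \<alpha> by (simp add: uniformization_of_def)
  then have "\<alpha> ` topspace ?X = topspace ?Y" by (simp add: covering_map_top_def)
  then have "\<alpha> w \<in> topspace ?Y" using w by auto
  then obtain T \<V> where T: "\<alpha> w \<in> T" "\<Union>\<V> = {x \<in> topspace ?X. \<alpha> x \<in> T}"
    "\<And>V. V \<in> \<V> \<Longrightarrow> openin ?X V"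
    "\<And>V. V \<in> \<V> \<Longrightarrow> homeomorphic_map (subtopology ?X V) (subtopology ?Y T) \<alpha>"
    by (rule evenly_covered[OF cov]) (rule that)
  have "w \<in> \<Union>\<V>" using T(1,2) w by simp
  then obtain V where V: "V \<in> \<V>" "w \<in> V" by blast
  have oV: "open V" "V \<subseteq> ball 0 1" using T(3)[OF V(1)] by (auto simp: openin_open_eq)
  have "inj_on \<alpha> (topspace (subtopology ?X V))"
    using T(4)[OF V(1)] homeomorphic_imp_injective_map by blast
  also have "topspace (subtopology ?X V) = V" using oV(2) by auto
  finally show ?thesis using that oV V(2) by blast
qed

text \<open>\<open>f\<close> might jump between the plaques of its leaf. Hyperbolicity makes the
  leaf an image of the disc under \<open>\<alpha>\<close>, hence a union of countably many pieces of
  embedded plaques that are compact in the manifold. Their preimages under \<open>f\<close> are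
  closed and cover the disc, so by Baire one of them has interior; there \<open>f\<close> is
  tangent, and \<open>tangent_curve_extend\<close> does the rest.\<close>

lemma disc_tangent:
  assumes f: "f \<in> discs A E F" and hyp: "hyperbolic_foliation A E F"
  shows "tangent_curve A E F (ball 0 1) f"
proof -
  obtain p where p: "p \<notin> E" "f ` ball 0 1 \<subseteq> leaf E F p"
    using f by (auto simp: discs_def)
  have hf: "holomorphic_curve_on A (ball 0 1) f" using f by (simp add: discs_def)
  have "\<exists>\<alpha>. uniformization_of A E F p \<alpha>" using hyp p(1) by (simp add: hyperbolic_foliation_def)
  then obtain \<alpha> where \<alpha>: "uniformization_of A E F p \<alpha>" ..
  note a = uniformization_ofD[OF \<alpha> p(1)]
  have fE: "f ` ball 0 1 \<inter> E = {}" using leaf_disjoint_singular[OF p(1)] p(2) by blast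
  have ac: "continuous_on (ball 0 1) \<alpha>" using a(1) by (simp add: holomorphic_curve_on_def)
  have fc: "continuous_on (ball 0 1) f" using hf by (simp add: holomorphic_curve_on_def)
  define good where "good = (\<lambda>B. \<exists>O'. open O' \<and> O' \<noteq> {} \<and> O' \<subseteq> ball 0 1 \<and> f ` O' \<subseteq> \<alpha> ` closure B)"
  \<comment> \<open>Discs whose closures \<open>\<alpha>\<close> maps into one embedded plaque.
    Lindelof extracts a countable subfamily with the same union.\<close>
  define \<B> where "\<B> = {ball w \<delta> | w \<delta>. 0 < \<delta> \<and> cball w \<delta> \<subseteq> ball (0::complex) 1 \<and>
     (\<exists>c W X \<gamma> r i. (c, W, X) \<in> F \<and> integral_curve E c W X \<gamma> r \<and>
       inj_on (\<lambda>t. snd c (\<gamma> t) $ i) (ball 0 r) \<and> \<alpha> ` cball w \<delta> \<subseteq> \<gamma> ` ball 0 r)}"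
  have "open B" if "B \<in> \<B>" for B using that unfolding \<B>_def by auto
  then obtain \<B>' where B': "\<B>' \<subseteq> \<B>" "countable \<B>'" "\<Union>\<B>' = \<Union>\<B>" by (rule Lindelof)
  have cover: "w \<in> \<Union>\<B>" if w: "w \<in> ball 0 1" for w
  proof -
    obtain c W X where G: "(c, W, X) \<in> F" "\<alpha> w \<in> W" by (rule ex_generator)
    have aE: "\<alpha> w \<notin> E" using a(3) w unfolding tangent_curve_def by blast
    obtain \<gamma> r i where \<gamma>: "integral_curve E c W X \<gamma> r" "\<gamma> 0 = \<alpha> w" "inj_on (\<lambda>t. snd c (\<gamma> t) $ i) (ball 0 r)"
      by (rule embedded_plaque[OF G aE])
    have r: "0 < r" using \<gamma>(1) unfolding integral_curve_def ..
    then have "(0::complex) \<in> ball 0 r" by simp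
    from tangent_curve_in_plaque[OF a(3) open_ball w G(1) \<gamma>(1) this \<gamma>(2)[symmetric]]
    obtain e T where e: "0 < e" "ball w e \<subseteq> ball 0 1" "\<And>s. s \<in> ball w e \<Longrightarrow> T s \<in> ball 0 r \<and> \<alpha> s = \<gamma> (T s)"
      by metis
    have sub: "cball w (e / 2) \<subseteq> ball w e" using e(1) by auto
    then have "\<alpha> ` cball w (e / 2) \<subseteq> \<gamma> ` ball 0 r" using e(3) by fastforce
    then have "ball w (e / 2) \<in> \<B>"
      unfolding \<B>_def mem_Collect_eq
    proof (intro exI conjI)
      show "ball w (e / 2) = ball w (e / 2)" ..
      show "cball w (e / 2) \<subseteq> ball 0 1" using sub e(2) by blast
    qed (use e(1) G(1) \<gamma> in simp_all)
    then show ?thesis using e(1) by (intro UnionI[of "ball w (e / 2)"]) auto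
  qed
  let ?X = "top_of_set (ball (0::complex) 1)"
  let ?C = "\<lambda>B. ball 0 1 \<inter> f -` (\<alpha> ` closure B)"
  have "\<exists>B\<in>\<B>'. ?X interior_of ?C B \<noteq> {}"
  proof (rule ccontr)
    assume neg: "\<not> (\<exists>B\<in>\<B>'. ?X interior_of ?C B \<noteq> {})"
    have "?X interior_of \<Union>(?C ` \<B>') = {}"
    proof (rule Baire_category_alt)
      have "completely_metrizable_space ?X"
        by (rule completely_metrizable_space_openin[OF completely_metrizable_space_euclidean]) simp
      then show "completely_metrizable_space ?X \<or> locally_compact_space ?X \<and> regular_space ?X" ..
      show "countable (?C ` \<B>')" using B'(2) by simp
      fix T assume "T \<in> ?C ` \<B>'"
      then obtain B where B: "B \<in> \<B>'" "T = ?C B" by blast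
      have "B \<in> \<B>" using B(1) B'(1) by blast
      then obtain w \<delta> where wd: "B = ball w \<delta>" "0 < \<delta>" "cball w \<delta> \<subseteq> ball (0::complex) 1"
        unfolding \<B>_def by blast
      then have "closure B = cball w \<delta>" by simp
      \<comment> \<open>Closed discs are used because their images are compact, hence closed in the
        Hausdorff manifold topology, the one for which \<open>f\<close> is continuous.\<close>
      then have "compact (\<alpha> ` closure B)"
        using compact_continuous_image[OF continuous_on_subset[OF ac wd(3)] compact_cball] by simp
      then have "closed (\<alpha> ` closure B)" by (rule compact_imp_closed)
      then have "closedin ?X T" unfolding B(2) by (rule continuous_closedin_preimage[OF fc])
      then show "closedin ?X T \<and> ?X interior_of T = {}" using neg B by blast
    qed
    moreover have "\<Union>(?C ` \<B>') = ball 0 1"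
    proof
      show "ball 0 1 \<subseteq> \<Union>(?C ` \<B>')"
      proof
        fix s :: complex assume s: "s \<in> ball 0 1"
        then have "f s \<in> \<alpha> ` ball 0 1" using p(2) a(2) by blast
        then obtain w where w: "w \<in> ball 0 1" "f s = \<alpha> w" by blast
        then obtain B where "B \<in> \<B>'" "w \<in> B" using cover[OF w(1)] B'(3) by auto
        then show "s \<in> \<Union>(?C ` \<B>')" using s w closure_subset[of B] by blast
      qed
    qed blast
    ultimately have "?X interior_of (ball 0 1) = {}" by simp
    moreover have "?X interior_of (ball 0 1) = ball 0 1"
      using interior_of_topspace[of ?X] by simp
    ultimately show False by (metis centre_in_ball empty_iff zero_less_one)
  qed
  then obtain B where B: "B \<in> \<B>'" "?X interior_of ?C B \<noteq> {}" by blast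
  define O' where "O' = ?X interior_of ?C B"
  have "openin ?X O'" unfolding O'_def by (rule openin_interior_of)
  then have O': "open O'" "O' \<subseteq> ball 0 1" "O' \<noteq> {}" "O' \<subseteq> ?C B"
    using openin_open_eq[OF open_ball] B(2) interior_of_subset[of ?X "?C B"]
    unfolding O'_def by blast+
  have "B \<in> \<B>" using B(1) B'(1) by blast
  then obtain w \<delta> c W X \<gamma> r i where wd: "B = ball w \<delta>" "0 < \<delta>"
    and G: "(c, W, X) \<in> F" and \<gamma>: "integral_curve E c W X \<gamma> r"
       "inj_on (\<lambda>t. snd c (\<gamma> t) $ i) (ball 0 r)" "\<alpha> ` cball w \<delta> \<subseteq> \<gamma> ` ball 0 r"
    unfolding \<B>_def mem_Collect_eq by (elim exE conjE) (rule that)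
  have "f ` O' \<subseteq> \<gamma> ` ball 0 r" using O'(4) \<gamma>(3) wd by auto
  then have "tangent_curve A E F O' f"
    using curve_in_embedded_plaque[OF holomorphic_curve_on_subset[OF hf O'(2)] O'(1) G \<gamma>(1,2)] by metis
  then have "tangent_at F f s" if "s \<in> O'" for s using that by (simp add: tangent_curve_def)
  then show ?thesis
    by (rule tangent_curve_extend[OF hf open_ball connected_ball fE O'(1,3,2)])
qed

text \<open>The pullback \<open>P\<close> of the covering \<open>\<alpha>\<close> along
  \<open>f\<close> is a set of pairs of complex numbers, and its projection to \<open>S\<close> is a
  \<open>covering_space\<close> even though the leaf carries an abstract topology. A section of this
  projection is the same as a lift of \<open>f\<close>.\<close>

lemma disc_lift_continuous:
  assumes \<alpha>: "uniformization_of A E F p \<alpha>"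
    and f: "continuous_map (top_of_set S) (subtopology (leaf_topology E F) (leaf E F p)) f"
    and S: "open S" "simply_connected S" "s0 \<in> S"
    and w0: "w0 \<in> ball 0 1" "f s0 = \<alpha> w0"
  obtains h :: "complex \<Rightarrow> complex"
    where "continuous_on S h" "h ` S \<subseteq> ball 0 1" "h s0 = w0" "\<And>s. s \<in> S \<Longrightarrow> \<alpha> (h s) = f s"
proof -
  let ?X = "top_of_set (ball (0::complex) 1)"
  let ?Y = "subtopology (leaf_topology E F) (leaf E F p)"
  have cov: "covering_map_top ?X ?Y \<alpha>"
    using \<alpha> by (simp add: uniformization_of_def)
  then have surj: "\<alpha> ` topspace ?X = topspace ?Y" by (simp add: covering_map_top_def)
  have fY: "f s \<in> topspace ?Y" if "s \<in> S" for s
    using continuous_map_image_subset_topspace[OF f] that by auto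
  define P where "P = {(s, w). s \<in> S \<and> w \<in> ball 0 1 \<and> f s = \<alpha> w}"
  have Pmem: "x \<in> P \<longleftrightarrow> fst x \<in> S \<and> snd x \<in> ball 0 1 \<and> f (fst x) = \<alpha> (snd x)" for x
    unfolding P_def by (cases x) simp
  have "covering_space P fst S"
    unfolding covering_space_def
  proof (intro conjI ballI)
    show "continuous_on P fst" by (intro continuous_intros)
    show "fst ` P = S"
    proof
      show "S \<subseteq> fst ` P"
      proof
        fix s assume s: "s \<in> S"
        then obtain w where "w \<in> ball 0 1" "f s = \<alpha> w" using fY[OF s] surj by fastforce
        then have "(s, w) \<in> P" using s by (simp add: Pmem)
        then show "s \<in> fst ` P" by force
      qed
    qed (auto simp: Pmem)
    fix s assume s: "s \<in> S"
    obtain T \<V> where T: "openin ?Y T" "f s \<in> T" "\<Union>\<V> = {x \<in> topspace ?X. \<alpha> x \<in> T}"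
      "\<And>V. V \<in> \<V> \<Longrightarrow> openin ?X V" "pairwise disjnt \<V>"
      "\<And>V. V \<in> \<V> \<Longrightarrow> homeomorphic_map (subtopology ?X V) (subtopology ?Y T) \<alpha>"
      by (rule evenly_covered[OF cov fY[OF s]]) (rule that)
    define N where "N = {s \<in> S. f s \<in> T}"
    have N: "openin (top_of_set S) N"
      using openin_continuous_map_preimage[OF f T(1)] by (simp add: N_def)
    \<comment> \<open>The sheet over \<open>N\<close> that belongs to \<open>V\<close>. With
      \<open>l\<close> the inverse of \<open>\<alpha>\<close> from \<open>T\<close> to
      \<open>V\<close>, the projection is inverted there by
      \<open>s \<mapsto> (s, l (f s))\<close>.\<close>
    define L where "L = (\<lambda>V. {x \<in> P. snd x \<in> V})"
    have V: "open V" "V \<subseteq> ball 0 1" "\<And>w. w \<in> V \<Longrightarrow> \<alpha> w \<in> T" if "V \<in> \<V>" for V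
      using T(4)[OF that] T(3) that by (auto simp: openin_open_eq)
    have hom: "\<exists>q. homeomorphism (L V) N fst q" if VV: "V \<in> \<V>" for V
    proof -
      obtain l where l: "homeomorphic_maps (subtopology ?X V) (subtopology ?Y T) \<alpha> l"
        using T(6)[OF VV] unfolding homeomorphic_map_maps ..
      have lV: "l y \<in> V \<and> \<alpha> (l y) = y" if y: "y \<in> T" for y
      proof -
        have "y \<in> topspace (subtopology ?Y T)" using y T(1) openin_subset by fastforce
        then show ?thesis using l
          unfolding homeomorphic_maps_def continuous_map_def by auto
      qed
      have la: "l (\<alpha> w) = w" if "w \<in> V" for w
        using l that V(2)[OF VV] unfolding homeomorphic_maps_def by auto
      have fN: "continuous_map (top_of_set N) (subtopology ?Y T) f"
        unfolding continuous_map_in_subtopology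
      proof
        have "continuous_map (subtopology (top_of_set S) N) ?Y f" by (rule continuous_map_from_subtopology[OF f])
        moreover have "subtopology (top_of_set S) N = top_of_set N"
          by (simp add: subtopology_subtopology N_def Int_absorb1 Collect_conj_eq)
        ultimately show "continuous_map (top_of_set N) (leaf_topology E F) f \<and>
            f \<in> topspace (top_of_set N) \<rightarrow> leaf E F p"
          by (simp add: continuous_map_in_subtopology)
      qed (auto simp: N_def)
      have "continuous_map (subtopology ?Y T) (subtopology ?X V) l"
        using l by (simp add: homeomorphic_maps_def)
      from continuous_map_compose[OF fN this]
      have "continuous_on N (l \<circ> f)"
        by (simp add: subtopology_subtopology continuous_map_in_subtopology)
      then have lf: "continuous_on N (\<lambda>s. l (f s))" by (simp add: o_def)
      have "homeomorphism (L V) N fst (\<lambda>s. (s, l (f s)))"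
        unfolding homeomorphism_def
      proof (intro conjI ballI)
        show "continuous_on (L V) fst" by (intro continuous_intros)
        show "continuous_on N (\<lambda>s. (s, l (f s)))" by (intro continuous_intros lf)
        have in_L: "(s, l (f s)) \<in> L V" if "s \<in> N" for s
          using that lV[of "f s"] V(2)[OF VV] unfolding L_def N_def Pmem by auto
        have in_N: "fst x \<in> N" if "x \<in> L V" for x
          using that V(3)[OF VV] unfolding L_def N_def by (auto simp: Pmem)
        show "fst ` L V = N"
        proof
          show "N \<subseteq> fst ` L V" using in_L by force
        qed (use in_N in blast)
        show eq: "(fst x, l (f (fst x))) = x" if "x \<in> L V" for x
          using that la unfolding L_def by (auto simp: Pmem prod_eq_iff)
        show "(\<lambda>s. (s, l (f s))) ` N = L V"
        proof
          show "L V \<subseteq> (\<lambda>s. (s, l (f s))) ` N" using eq in_N by force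
        qed (use in_L in blast)
        show "fst (s, l (f s)) = s" for s by simp
      qed
      then show ?thesis by (rule exI[of _ "\<lambda>s. (s, l (f s))"])
    qed
    show "\<exists>T. s \<in> T \<and> openin (top_of_set S) T \<and>
      (\<exists>v. \<Union>v = P \<inter> fst -` T \<and> (\<forall>u\<in>v. openin (top_of_set P) u) \<and> pairwise disjnt v \<and>
        (\<forall>u\<in>v. \<exists>q. homeomorphism u T fst q))"
    proof (rule exI[of _ N], intro conjI exI[of _ "L ` \<V>"] ballI)
      show "s \<in> N" using s T(2) by (simp add: N_def)
      show "openin (top_of_set S) N" by (rule N)
      show "\<Union>(L ` \<V>) = P \<inter> fst -` N"
      proof (intro equalityI subsetI)
        fix x assume "x \<in> \<Union>(L ` \<V>)"
        then obtain V where "V \<in> \<V>" "x \<in> P" "snd x \<in> V" unfolding L_def by blast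
        then show "x \<in> P \<inter> fst -` N" using V(3) by (auto simp: N_def Pmem)
      next
        fix x assume x: "x \<in> P \<inter> fst -` N"
        then have "snd x \<in> \<Union>\<V>" unfolding T(3) by (auto simp: N_def Pmem)
        then show "x \<in> \<Union>(L ` \<V>)" using x unfolding L_def by blast
      qed
      show "pairwise disjnt (L ` \<V>)"
      proof (rule pairwiseI)
        fix a b assume "a \<in> L ` \<V>" "b \<in> L ` \<V>" "a \<noteq> b"
        then obtain V V' where "V \<in> \<V>" "V' \<in> \<V>" "V \<noteq> V'" "a = L V" "b = L V'" by blast
        then show "disjnt a b" using T(5) unfolding pairwise_def disjnt_iff L_def by blast
      qed
      fix u assume "u \<in> L ` \<V>"
      then obtain W where W: "W \<in> \<V>" "u = L W" by blast
      then show "\<exists>q. homeomorphism u N fst q" using hom by blast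
      have "L W = P \<inter> (UNIV \<times> W)" unfolding L_def by auto
      then show "openin (top_of_set P) u"
        using W V(1)[OF W(1)] by (metis openin_open_Int open_Times open_UNIV)
    qed
  qed
  moreover have "(s0, w0) \<in> P" using S(3) w0 by (simp add: Pmem)
  \<comment> \<open>Lifting the identity map of \<open>S\<close> through the projection gives the
    section; its second component is the lift.\<close>
  ultimately obtain k where k: "continuous_on S k" "k \<in> S \<rightarrow> P" "k s0 = (s0, w0)" "\<And>s. s \<in> S \<Longrightarrow> fst (k s) = s"
    using covering_space_lift_strong[of P fst S "(s0, w0)" s0 S "\<lambda>s. s"] S
      open_imp_locally_path_connected[OF S(1)] by auto
  show ?thesis
  proof (rule that[of "\<lambda>s. snd (k s)"])
    show "continuous_on S (\<lambda>s. snd (k s))" by (intro continuous_on_snd k(1))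
    have "k s \<in> P" if "s \<in> S" for s using k(2) that by (rule Pi_mem)
    then show "(\<lambda>s. snd (k s)) ` S \<subseteq> ball 0 1"
      using Pmem by blast
    show "snd (k s0) = w0" by (simp add: k(3))
    show "\<alpha> (snd (k s)) = f s" if "s \<in> S" for s
    proof -
      have "k s \<in> P" using k(2) that by auto
      then show ?thesis using k(4)[OF that] Pmem[of "k s"] by simp
    qed
  qed
qed

text \<open>To see that the continuous lift is holomorphic, write
  \<open>f = \<gamma> \<circ> Tf\<close> and \<open>\<alpha> = \<gamma> \<circ> Ta\<close> near a
  point, with the same embedded plaque \<open>\<gamma>\<close>. Since \<open>\<alpha>\<close> is
  locally injective, so is \<open>Ta\<close>, and the lift is locally the inverse of
  \<open>Ta\<close> after \<open>Tf\<close>.\<close>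

lemma disc_lift:
  assumes \<alpha>: "uniformization_of A E F p \<alpha>" and p: "p \<notin> E"
    and f: "tangent_curve A E F S f" "f ` S \<subseteq> leaf E F p"
    and S: "open S" "simply_connected S" "s0 \<in> S"
    and w0: "w0 \<in> ball 0 1" "f s0 = \<alpha> w0"
  obtains h where "h holomorphic_on S" "h ` S \<subseteq> ball 0 1" "h s0 = w0" "\<And>s. s \<in> S \<Longrightarrow> \<alpha> (h s) = f s"
proof -
  note a = uniformization_ofD[OF \<alpha> p]
  have "continuous_map (top_of_set S) (subtopology (leaf_topology E F) (leaf E F p)) f"
    using tangent_curve_leaf_continuous[OF f(1) S(1)] f(2)
    by (auto simp: continuous_map_in_subtopology)
  then obtain h where h: "continuous_on S h" "h ` S \<subseteq> ball 0 1" "h s0 = w0" "\<And>s. s \<in> S \<Longrightarrow> \<alpha> (h s) = f s"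
    by (rule disc_lift_continuous[of p \<alpha> S f s0 w0, OF \<alpha> _ S w0]) (rule that)
  have hf: "holomorphic_curve_on A S f" using f(1) by (simp add: tangent_curve_def)
  have "\<exists>M. open M \<and> s1 \<in> M \<and> h holomorphic_on M" if s1: "s1 \<in> S" for s1
  proof -
    have w1: "h s1 \<in> ball 0 1" using h(2) s1 by blast
    obtain c W X where G: "(c, W, X) \<in> F" "f s1 \<in> W" by (rule ex_generator)
    have fE: "f s1 \<notin> E" using f(1) s1 unfolding tangent_curve_def by blast
    obtain \<gamma> r i where \<gamma>: "integral_curve E c W X \<gamma> r" "\<gamma> 0 = f s1" "inj_on (\<lambda>t. snd c (\<gamma> t) $ i) (ball 0 r)"
      by (rule embedded_plaque[OF G fE])
    have r: "0 < r" using \<gamma>(1) unfolding integral_curve_def ..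
    have gi: "inj_on \<gamma> (ball 0 r)" by (rule inj_onI) (use inj_onD[OF \<gamma>(3)] in metis)
    have "(0::complex) \<in> ball 0 r" using r by simp
    moreover have "\<alpha> (h s1) = \<gamma> 0" using h(4)[OF s1] \<gamma>(2) by simp
    ultimately obtain e Ta where e: "0 < e" "ball (h s1) e \<subseteq> ball 0 1" "Ta holomorphic_on ball (h s1) e"
       "\<And>s. s \<in> ball (h s1) e \<Longrightarrow> Ta s \<in> ball 0 r \<and> \<alpha> s = \<gamma> (Ta s)"
      by (rule tangent_curve_in_plaque[OF a(3) open_ball w1 G(1) \<gamma>(1)]) (rule that)
    obtain N0 where N0: "open N0" "h s1 \<in> N0" "inj_on \<alpha> N0"
      by (rule uniformization_locally_injective[OF \<alpha> w1]) (rule that)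
    let ?N = "N0 \<inter> ball (h s1) e"
    have N: "open ?N" "h s1 \<in> ?N" using N0 e(1) by auto
    have Ti: "inj_on Ta ?N"
    proof (rule inj_onI)
      fix x y assume xy: "x \<in> ?N" "y \<in> ?N" "Ta x = Ta y"
      then have "\<alpha> x = \<alpha> y" using e(4) by (metis IntD2)
      then show "x = y" using inj_onD[OF N0(3)] xy by blast
    qed
    have TN: "Ta holomorphic_on ?N" by (rule holomorphic_on_subset[OF e(3)]) blast
    obtain l where l: "l holomorphic_on Ta ` ?N" "\<And>w. w \<in> ?N \<Longrightarrow> l (Ta w) = w"
      by (rule holomorphic_has_inverse[OF TN N(1) Ti]) (rule that)
    let ?M = "S \<inter> h -` ?N"
    have M: "open ?M" "s1 \<in> ?M" using continuous_open_preimage[OF h(1) S(1) N(1)] s1 N(2) by auto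
    have fM: "f s = \<gamma> (Ta (h s)) \<and> Ta (h s) \<in> ball 0 r" if "s \<in> ?M" for s
      using e(4)[of "h s"] h(4)[of s] that by auto
    have hM: "holomorphic_curve_on A ?M f" by (rule holomorphic_curve_on_subset[OF hf]) blast
    have "f ` ?M \<subseteq> \<gamma> ` ball 0 r" using fM by blast
    then obtain Tf where Tf: "Tf holomorphic_on ?M" "\<And>s. s \<in> ?M \<Longrightarrow> Tf s \<in> ball 0 r \<and> f s = \<gamma> (Tf s)"
      by (rule curve_in_embedded_plaque[OF hM M(1) G(1) \<gamma>(1,3)]) (rule that)
    have TT: "Tf s = Ta (h s)" if s: "s \<in> ?M" for s
    proof (rule inj_onD[OF gi])
      show "\<gamma> (Tf s) = \<gamma> (Ta (h s))" using fM[OF s] Tf(2)[OF s] by metis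
    qed (use fM[OF s] Tf(2)[OF s] in simp_all)
    have "(l \<circ> Tf) holomorphic_on ?M"
      by (rule holomorphic_on_compose_gen[OF Tf(1) l(1)]) (use TT in auto)
    then have "h holomorphic_on ?M"
      by (rule holomorphic_transform) (use TT l(2) in auto)
    then show ?thesis using M by blast
  qed
  then have "h field_differentiable at s" if "s \<in> S" for s
    using that holomorphic_on_imp_differentiable_at by blast
  then have "h holomorphic_on S"
    unfolding holomorphic_on_def by (simp add: field_differentiable_at_within)
  then show ?thesis using h(2-4) by (rule that)
qed

end


section \<open>Hyperbolic derivatives of holomorphic functions\<close>

lemma Moebius_denominator_nonzero:
  assumes "cmod w < 1" "cmod z < 1"
  shows "1 - cnj w * z \<noteq> 0"
proof
  assume "1 - cnj w * z = 0"
  then have "cmod (cnj w * z) = 1" by simp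
  moreover have "cmod (cnj w * z) < 1"
    using assms by (simp add: norm_mult) (metis mult_strict_mono' norm_ge_zero mult_1)
  ultimately show False by simp
qed

lemma Moebius_has_field_derivative:
  assumes "cmod w < 1" "cmod z < 1"
  shows "(Moebius_function 0 w has_field_derivative (1 - of_real ((cmod w)\<^sup>2)) / (1 - cnj w * z)\<^sup>2) (at z)"
proof -
  note nz = Moebius_denominator_nonzero[OF assms]
  have "((\<lambda>z. (z - w) / (1 - cnj w * z)) has_field_derivative
      (1 * (1 - cnj w * z) - (z - w) * (- cnj w)) / ((1 - cnj w * z) * (1 - cnj w * z))) (at z)"
    using nz by (auto intro!: derivative_eq_intros)
  moreover have "1 * (1 - cnj w * z) - (z - w) * (- cnj w) = 1 - of_real ((cmod w)\<^sup>2)"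
    by (simp add: complex_norm_square algebra_simps del: of_real_power)
  ultimately have "((\<lambda>z. (z - w) / (1 - cnj w * z)) has_field_derivative
      (1 - of_real ((cmod w)\<^sup>2)) / (1 - cnj w * z)\<^sup>2) (at z)"
    by (simp only: power2_eq_square[of "1 - cnj w * z"])
  then show ?thesis by (simp add: Moebius_function_simple[abs_def])
qed

text \<open>Invariance of the hyperbolic metric of the unit disc under its automorphisms; the first
  factor is the modulus of the derivative computed in
  \<open>Moebius_has_field_derivative\<close>.\<close>

lemma Moebius_norm_identity:
  assumes "cmod w < 1" "cmod z < 1"
  shows "cmod ((1 - of_real ((cmod w)\<^sup>2)) / (1 - cnj w * z)\<^sup>2) * (1 - (cmod z)\<^sup>2) =
    1 - (cmod (Moebius_function 0 w z))\<^sup>2"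
proof -
  note nz = Moebius_denominator_nonzero[OF assms]
  have "of_real ((cmod (1 - cnj w * z))\<^sup>2 - (cmod (z - w))\<^sup>2) = (of_real ((1 - (cmod w)\<^sup>2) * (1 - (cmod z)\<^sup>2)) :: complex)"
    by (simp add: complex_norm_square algebra_simps del: of_real_power)
  then have eq: "(cmod (1 - cnj w * z))\<^sup>2 - (cmod (z - w))\<^sup>2 = (1 - (cmod w)\<^sup>2) * (1 - (cmod z)\<^sup>2)"
    by (rule of_real_eq_iff[THEN iffD1])
  have "(cmod w)\<^sup>2 \<le> 1" using assms by (simp add: power_le_one)
  then have "cmod (1 - of_real ((cmod w)\<^sup>2)) = 1 - (cmod w)\<^sup>2"
    using norm_of_real[of "1 - (cmod w)\<^sup>2", where 'a = complex] by simp
  then have "cmod ((1 - of_real ((cmod w)\<^sup>2)) / (1 - cnj w * z)\<^sup>2) * (1 - (cmod z)\<^sup>2)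
    = ((1 - (cmod w)\<^sup>2) * (1 - (cmod z)\<^sup>2)) / (cmod (1 - cnj w * z))\<^sup>2"
    by (simp add: norm_divide norm_power)
  also have "\<dots> = 1 - (cmod (z - w))\<^sup>2 / (cmod (1 - cnj w * z))\<^sup>2"
    unfolding eq[symmetric] using nz by (simp add: diff_divide_distrib)
  finally show ?thesis by (simp add: Moebius_function_simple norm_divide power_divide)
qed

lemma one_minus_norm_square_pos: "cmod z < 1 \<Longrightarrow> 0 < 1 - (cmod z)\<^sup>2"
  by (simp add: power_less_one_iff abs_square_less_1)

lemma Schwarz_Pick:
  assumes h: "h holomorphic_on ball 0 1" "h ` ball 0 1 \<subseteq> ball 0 1" and s: "cmod s < 1"
  shows "cmod (deriv h s) * (1 - (cmod s)\<^sup>2) \<le> 1 - (cmod (h s))\<^sup>2"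
proof -
  define M where "M = Moebius_function 0 (- s)"
  define N where "N = Moebius_function 0 (h s)"
  have hs: "cmod (h s) < 1" using h(2) s by force
  have M0: "M 0 = s" by (simp add: M_def Moebius_function_of_zero)
  have Mb: "cmod (M z) < 1" if "cmod z < 1" for z
    unfolding M_def by (rule Moebius_function_norm_lt_1) (use s that in auto)
  have hb: "cmod (h z) < 1" if "cmod z < 1" for z using h(2) that by force
  have "((N \<circ> h) \<circ> M) holomorphic_on ball 0 1"
  proof (rule holomorphic_on_compose_gen)
    show "M holomorphic_on ball 0 1" unfolding M_def by (rule Moebius_function_holomorphic) (use s in simp)
    show "(N \<circ> h) holomorphic_on ball 0 1"
      unfolding N_def using hb
      by (intro holomorphic_on_compose_gen[OF h(1) Moebius_function_holomorphic[OF hs]]) auto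
  qed (use Mb in auto)
  moreover have "cmod (((N \<circ> h) \<circ> M) z) < 1" if "cmod z < 1" for z
    using Moebius_function_norm_lt_1[OF hs hb[OF Mb[OF that]]] by (simp add: N_def)
  moreover have "((N \<circ> h) \<circ> M) 0 = 0" by (simp add: M0 N_def Moebius_function_eq_zero)
  ultimately have "cmod (deriv ((N \<circ> h) \<circ> M) 0) \<le> 1"
    using Schwarz_Lemma(2)[of "(N \<circ> h) \<circ> M" 0] by simp
  moreover
  have dM: "(M has_field_derivative 1 - of_real ((cmod s)\<^sup>2)) (at 0)"
    using Moebius_has_field_derivative[of "- s" 0] s by (simp add: M_def)
  have dh: "(h has_field_derivative deriv h s) (at (M 0))"
    using holomorphic_derivI[OF h(1) open_ball, of s] s by (simp add: M0)
  define a where "a = (1 - of_real ((cmod (h s))\<^sup>2)) / (1 - cnj (h s) * h s)\<^sup>2"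
  define b where "b = (1 - of_real ((cmod s)\<^sup>2) :: complex)"
  have dN: "(N has_field_derivative a) (at (h (M 0)))"
    unfolding N_def M0 a_def by (rule Moebius_has_field_derivative[OF hs hs])
  have "deriv ((N \<circ> h) \<circ> M) 0 = a * deriv h s * b"
    by (rule DERIV_imp_deriv, rule DERIV_chain[OF DERIV_chain[OF dN dh] dM[folded b_def]])
  moreover have "cmod a * (1 - (cmod (h s))\<^sup>2) = 1"
    unfolding a_def Moebius_norm_identity[OF hs hs] by (simp add: Moebius_function_eq_zero)
  then have "cmod a = 1 / (1 - (cmod (h s))\<^sup>2)"
    using one_minus_norm_square_pos[OF hs] by (simp add: field_simps)
  moreover have "cmod b = 1 - (cmod s)\<^sup>2"
    using norm_of_real[of "1 - (cmod s)\<^sup>2", where 'a = complex] one_minus_norm_square_pos[OF s]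
    by (simp add: b_def)
  ultimately have "cmod (deriv h s) * (1 - (cmod s)\<^sup>2) / (1 - (cmod (h s))\<^sup>2) \<le> 1"
    by (simp add: norm_mult)
  then show ?thesis using one_minus_norm_square_pos[OF hs] by simp
qed

text \<open>If \<open>|k'(0)| < 1\<close>, then \<open>k\<close> strictly contracts near 0, so
  \<open>1 - |k z|\<^sup>2\<close> exceeds \<open>1 - |z|\<^sup>2\<close> for
  \<open>z \<noteq> 0\<close> and minimality forces \<open>|k'(z)| > |k'(0)|\<close>. Thus
  \<open>1 / k'\<close> would have a strict maximum of its modulus at 0.\<close>

lemma hyperbolic_derivative_local_min_0:
  assumes k: "k holomorphic_on S" "open S" "0 \<in> S" "k 0 = 0" and d0: "deriv k 0 \<noteq> 0"
    and min: "\<And>z. z \<in> S \<Longrightarrow> cmod (deriv k 0) * (1 - (cmod (k z))\<^sup>2) \<le> cmod (deriv k z) * (1 - (cmod z)\<^sup>2)"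
  shows "1 \<le> cmod (deriv k 0)"
proof (rule ccontr)
  define l where "l = cmod (deriv k 0)"
  assume "\<not> 1 \<le> cmod (deriv k 0)"
  then have l: "0 < l" "l < 1" using d0 by (auto simp: l_def)
  \<comment> \<open>Any number strictly between \<open>l\<close> and 1 serves; it bounds
    \<open>|k'|\<close> near 0 and hence gives \<open>|k z| \<le> m |z| < |z|\<close>.\<close>
  define m where "m = (1 + l) / 2"
  have m: "l < m" "m < 1" using l by (auto simp: m_def)
  have dh: "deriv k holomorphic_on S" by (rule holomorphic_deriv[OF k(1,2)])
  have "open (S \<inter> deriv k -` ball 0 m)"
    by (rule continuous_open_preimage[OF holomorphic_on_imp_continuous_on[OF dh] k(2) open_ball])
  moreover have "0 \<in> S \<inter> deriv k -` ball 0 m" using k(3) m by (simp add: l_def)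
  ultimately obtain e0 where e0: "0 < e0" "ball 0 e0 \<subseteq> S \<inter> deriv k -` ball 0 m" by (rule openE)
  \<comment> \<open>The cap 1 keeps \<open>1 - |z|\<^sup>2\<close> positive, so that one may divide
    by it.\<close>
  define e where "e = min e0 1"
  have e: "0 < e" "e \<le> 1" "ball 0 e \<subseteq> S" "\<And>z. z \<in> ball 0 e \<Longrightarrow> cmod (deriv k z) \<le> m"
  proof -
    show "0 < e" "e \<le> 1" using e0(1) by (auto simp: e_def)
    have sub: "ball 0 e \<subseteq> S \<inter> deriv k -` ball 0 m"
      by (rule order_trans[OF subset_ball e0(2)]) (simp add: e_def)
    then show "ball 0 e \<subseteq> S" by blast
    show "cmod (deriv k z) \<le> m" if "z \<in> ball 0 e" for z :: complex
    proof -
      have "deriv k z \<in> ball 0 m" using sub that by blast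
      then show ?thesis by simp
    qed
  qed
  have kb: "cmod (k z) \<le> m * cmod z" if z: "z \<in> ball 0 e" for z
  proof -
    have "cmod (k z - k 0) \<le> m * cmod (z - 0)"
    proof (rule field_differentiable_bound[of "ball 0 e" k "deriv k"])
      show "(k has_field_derivative deriv k x) (at x within ball 0 e)" if "x \<in> ball 0 e" for x
        by (rule has_field_derivative_at_within, rule holomorphic_derivI[OF k(1,2)]) (use that e(3) in blast)
    qed (use z e in auto)
    then show ?thesis by (simp add: k(4))
  qed
  have strict: "l < cmod (deriv k z)" if z: "z \<in> ball 0 e" "z \<noteq> 0" for z
  proof -
    have z1: "cmod z < 1" using z e(2) by simp
    have "m * cmod z < 1 * cmod z" by (rule mult_strict_right_mono[OF m(2)]) (use z(2) in simp)
    then have "cmod (k z) < cmod z" using kb[OF z(1)] by simp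
    then have "(cmod (k z))\<^sup>2 < (cmod z)\<^sup>2" by (simp add: power_strict_mono)
    then have "l * (1 - (cmod z)\<^sup>2) < l * (1 - (cmod (k z))\<^sup>2)" using l by simp
    also have "\<dots> \<le> cmod (deriv k z) * (1 - (cmod z)\<^sup>2)" using min[of z] z(1) e(3) by (auto simp: l_def)
    finally show ?thesis using one_minus_norm_square_pos[OF z1] by simp
  qed
  have nz: "deriv k z \<noteq> 0" if "z \<in> ball 0 e" for z :: complex
    using strict[OF that] d0 l by (cases "z = 0") auto
  define q where "q = (\<lambda>z. 1 / deriv k z)"
  have "q constant_on ball 0 e"
  proof (rule maximum_modulus_principle[of q "ball 0 e" "ball 0 e" 0])
    show "q holomorphic_on ball 0 e"
      unfolding q_def by (intro holomorphic_intros holomorphic_on_subset[OF dh e(3)] nz)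
    fix z :: complex assume "z \<in> ball 0 e"
    then have "l \<le> cmod (deriv k z)" using strict[of z] by (cases "z = 0") (auto simp: l_def)
    then show "cmod (q z) \<le> cmod (q 0)" using l by (simp add: q_def norm_divide l_def[symmetric] frac_le)
  qed (use e in auto)
  moreover have "of_real (e / 2) \<in> ball (0::complex) e" "(0::complex) \<in> ball 0 e" using e(1) by auto
  ultimately have "q (of_real (e / 2)) = q 0" unfolding constant_on_def by metis
  then have "cmod (deriv k (of_real (e / 2))) = l"
    by (simp add: q_def l_def)
  moreover have "l < cmod (deriv k (of_real (e / 2)))" by (rule strict) (use e(1) in auto)
  ultimately show False by simp
qed

text \<open>Reduction to a map fixing 0: divide \<open>h\<close> by \<open>r\<close> and move
  \<open>h 0 / r\<close> to 0 by a Moebius map to get \<open>k\<close>. Invariance of the hyperbolic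
  metric gives \<open>|k'| / (1 - |k|\<^sup>2) = r |h'| / (r\<^sup>2 - |h|\<^sup>2)\<close>, so
  minimality passes to \<open>k\<close>.\<close>

lemma hyperbolic_derivative_local_min:
  assumes r: "0 < r" and h: "h holomorphic_on S" "open S" "0 \<in> S" and d0: "deriv h 0 \<noteq> 0"
    and b: "\<And>z. z \<in> S \<Longrightarrow> cmod (h z) < r"
    and min: "\<And>z. z \<in> S \<Longrightarrow>
      cmod (deriv h 0) * (r\<^sup>2 - (cmod (h z))\<^sup>2) \<le> cmod (deriv h z) * (1 - (cmod z)\<^sup>2) * (r\<^sup>2 - (cmod (h 0))\<^sup>2)"
  shows "r\<^sup>2 - (cmod (h 0))\<^sup>2 \<le> r * cmod (deriv h 0)"
proof -
  define j where "j = (\<lambda>z. h z / of_real r)"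
  have jb: "cmod (j z) < 1" if "z \<in> S" for z using b[OF that] r by (simp add: j_def norm_divide)
  define w where "w = j 0"
  have w: "cmod w < 1" using jb h(3) by (simp add: w_def)
  define k where "k = Moebius_function 0 w \<circ> j"
  have jh: "j holomorphic_on S" unfolding j_def using r h(1) by (intro holomorphic_intros) auto
  have kh: "k holomorphic_on S"
    unfolding k_def
    by (rule holomorphic_on_compose_gen[OF jh Moebius_function_holomorphic[OF w]]) (use jb in auto)
  have dk: "cmod (deriv k z) * (r\<^sup>2 - (cmod (h z))\<^sup>2) = (1 - (cmod (k z))\<^sup>2) * r * cmod (deriv h z)" if z: "z \<in> S" for z
  proof -
    have "(j has_field_derivative deriv h z / of_real r) (at z)"
      unfolding j_def by (rule DERIV_cdivide[OF holomorphic_derivI[OF h(1,2) z]])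
    moreover define d where "d = (1 - of_real ((cmod w)\<^sup>2)) / (1 - cnj w * j z)\<^sup>2"
    moreover have "(Moebius_function 0 w has_field_derivative d) (at (j z))"
      unfolding d_def by (rule Moebius_has_field_derivative[OF w jb[OF z]])
    ultimately have "deriv k z = d * (deriv h z / of_real r)"
      unfolding k_def by (intro DERIV_imp_deriv DERIV_chain)
    then have "cmod (deriv k z) = cmod d * (cmod (deriv h z) / r)"
      using r by (simp add: norm_mult norm_divide)
    moreover have "cmod d * (1 - (cmod (j z))\<^sup>2) = 1 - (cmod (k z))\<^sup>2"
      using Moebius_norm_identity[OF w jb[OF z]] by (simp add: d_def k_def)
    ultimately have "cmod (deriv k z) * (1 - (cmod (j z))\<^sup>2) = (1 - (cmod (k z))\<^sup>2) * (cmod (deriv h z) / r)"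
      by (metis mult.assoc mult.commute)
    moreover have "1 - (cmod (j z))\<^sup>2 = (r\<^sup>2 - (cmod (h z))\<^sup>2) / r\<^sup>2"
      using r by (simp add: j_def norm_divide power_divide diff_divide_distrib)
    ultimately have "cmod (deriv k z) * ((r\<^sup>2 - (cmod (h z))\<^sup>2) / r\<^sup>2) = (1 - (cmod (k z))\<^sup>2) * (cmod (deriv h z) / r)"
      by simp
    moreover have "a * X = K * r * d" if "a * (X / r\<^sup>2) = K * (d / r)" for a X K d :: real
      using that r by (simp add: field_simps power2_eq_square)
    ultimately show ?thesis by blast
  qed
  have k0: "k 0 = 0" by (simp add: k_def w_def Moebius_function_eq_zero)
  have pos: "0 < r\<^sup>2 - (cmod (h z))\<^sup>2" if "z \<in> S" for z
    using b[OF that] r by (simp add: power_strict_mono)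
  have dk0: "cmod (deriv k 0) = r * cmod (deriv h 0) / (r\<^sup>2 - (cmod (h 0))\<^sup>2)"
    using dk[OF h(3)] pos[OF h(3)] by (simp add: k0 field_simps)
  have "1 \<le> cmod (deriv k 0)"
  proof (rule hyperbolic_derivative_local_min_0[OF kh h(2,3) k0])
    show "deriv k 0 \<noteq> 0" using dk0 r d0 pos[OF h(3)] by auto
    fix z assume z: "z \<in> S"
    have kz: "0 \<le> 1 - (cmod (k z))\<^sup>2"
      using Moebius_function_norm_lt_1[OF w jb[OF z], of 0] one_minus_norm_square_pos[of "k z"]
      by (simp add: k_def)
    have "cmod (deriv k 0) * (1 - (cmod (k z))\<^sup>2) * (r\<^sup>2 - (cmod (h z))\<^sup>2)
      = (r * (1 - (cmod (k z))\<^sup>2) / (r\<^sup>2 - (cmod (h 0))\<^sup>2)) * (cmod (deriv h 0) * (r\<^sup>2 - (cmod (h z))\<^sup>2))"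
      by (simp add: dk0)
    also have "\<dots> \<le> (r * (1 - (cmod (k z))\<^sup>2) / (r\<^sup>2 - (cmod (h 0))\<^sup>2)) * (cmod (deriv h z) * (1 - (cmod z)\<^sup>2) * (r\<^sup>2 - (cmod (h 0))\<^sup>2))"
      by (rule mult_left_mono[OF min[OF z]])
        (intro divide_nonneg_nonneg mult_nonneg_nonneg less_imp_le[OF r] kz less_imp_le[OF pos[OF h(3)]])
    also have "\<dots> = ((1 - (cmod (k z))\<^sup>2) * r * cmod (deriv h z)) * (1 - (cmod z)\<^sup>2)"
      using pos[OF h(3)] by simp
    also have "\<dots> = cmod (deriv k z) * (1 - (cmod z)\<^sup>2) * (r\<^sup>2 - (cmod (h z))\<^sup>2)"
      unfolding dk[OF z, symmetric] by simp
    finally show "cmod (deriv k 0) * (1 - (cmod (k z))\<^sup>2) \<le> cmod (deriv k z) * (1 - (cmod z)\<^sup>2)"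
      using pos[OF z] by simp
  qed
  then show ?thesis using dk0 pos[OF h(3)] by (simp add: field_simps)
qed


section \<open>Limits of uniformizations\<close>

lemma covering_map_top_compose_homeomorphic:
  assumes cov: "covering_map_top X Y \<alpha>" and M: "homeomorphic_map X' X M"
  shows "covering_map_top X' Y (\<alpha> \<circ> M)"
proof -
  have Ms: "M ` topspace X' = topspace X" and Mi: "inj_on M (topspace X')"
    using M by (simp_all add: homeomorphic_imp_surjective_map homeomorphic_imp_injective_map)
  have "continuous_map X Y \<alpha>" "\<alpha> ` topspace X = topspace Y"
    using cov by (simp_all add: covering_map_top_def)
  then have 1: "continuous_map X' Y (\<alpha> \<circ> M)" and 2: "(\<alpha> \<circ> M) ` topspace X' = topspace Y"
    using continuous_map_compose[OF homeomorphic_imp_continuous_map[OF M]]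
    by (simp_all only: image_comp[symmetric] Ms)
  have 3: "\<exists>T. openin Y T \<and> y \<in> T \<and>
        (\<exists>\<V>. \<Union>\<V> = {x \<in> topspace X'. (\<alpha> \<circ> M) x \<in> T} \<and> (\<forall>V\<in>\<V>. openin X' V) \<and> pairwise disjnt \<V> \<and>
           (\<forall>V\<in>\<V>. homeomorphic_map (subtopology X' V) (subtopology Y T) (\<alpha> \<circ> M)))"
    if y: "y \<in> topspace Y" for y
  proof -
    obtain T \<V> where T: "openin Y T" "y \<in> T" "\<Union>\<V> = {x \<in> topspace X. \<alpha> x \<in> T}"
      "\<And>V. V \<in> \<V> \<Longrightarrow> openin X V" "pairwise disjnt \<V>"
      "\<And>V. V \<in> \<V> \<Longrightarrow> homeomorphic_map (subtopology X V) (subtopology Y T) \<alpha>"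
      by (rule evenly_covered[OF cov y]) (rule that)
    let ?L = "\<lambda>V. {x \<in> topspace X'. M x \<in> V}"
    have "homeomorphic_map (subtopology X' (?L V)) (subtopology Y T) (\<alpha> \<circ> M)" if V: "V \<in> \<V>" for V
    proof (rule homeomorphic_map_compose[OF _ T(6)[OF V]])
      show "homeomorphic_map (subtopology X' (?L V)) (subtopology X V) M"
        by (rule homeomorphic_map_subtopologies_alt[OF M]) auto
    qed
    moreover have "openin X' (?L V)" if "V \<in> \<V>" for V
      by (rule openin_continuous_map_preimage[OF homeomorphic_imp_continuous_map[OF M] T(4)[OF that]])
    moreover have "pairwise disjnt (?L ` \<V>)"
    proof (rule pairwiseI)
      fix a b assume "a \<in> ?L ` \<V>" "b \<in> ?L ` \<V>" "a \<noteq> b"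
      then obtain V V' where "V \<in> \<V>" "V' \<in> \<V>" "V \<noteq> V'" "a = ?L V" "b = ?L V'" by blast
      then show "disjnt a b" using T(5) unfolding pairwise_def disjnt_iff by blast
    qed
    moreover have "\<Union>(?L ` \<V>) = {x \<in> topspace X'. (\<alpha> \<circ> M) x \<in> T}"
    proof -
      have "M x \<in> \<Union>\<V> \<longleftrightarrow> \<alpha> (M x) \<in> T" if "x \<in> topspace X'" for x
        using that Ms unfolding T(3) by auto
      then show ?thesis by auto
    qed
    ultimately show ?thesis using T(1,2)
      by (intro exI[of _ T] conjI exI[of _ "?L ` \<V>"]) auto
  qed
  show ?thesis unfolding covering_map_top_def using 1 2 3 by simp
qed

lemma Moebius_homeomorphic_map:
  assumes w: "cmod w < 1"
  shows "homeomorphic_map (top_of_set (ball 0 1)) (top_of_set (ball 0 1)) (Moebius_function 0 w)"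
  unfolding homeomorphic_map_maps homeomorphic_maps_def
proof (rule exI[of _ "Moebius_function 0 (- w)"], intro conjI ballI)
  have c: "continuous_map (top_of_set (ball 0 1)) (top_of_set (ball 0 1)) (Moebius_function 0 v)"
    if "cmod v < 1" for v
    using holomorphic_on_imp_continuous_on[OF Moebius_function_holomorphic[OF that]]
      Moebius_function_norm_lt_1[OF that] by (auto simp: continuous_map_in_subtopology)
  show "continuous_map (top_of_set (ball 0 1)) (top_of_set (ball 0 1)) (Moebius_function 0 w)"
    "continuous_map (top_of_set (ball 0 1)) (top_of_set (ball 0 1)) (Moebius_function 0 (- w))"
    using c[of w] c[of "- w"] w by simp_all
qed (use w Moebius_function_compose[of "- w" w] Moebius_function_compose[of w "- w"] in auto)

context foliation
begin

text \<open>\<open>hyperbolic_foliation\<close> prescribes no base point. A preimage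
  \<open>w\<close> of \<open>p\<close> exists by surjectivity, and precomposition with the
  automorphism of the disc that sends 0 to \<open>w\<close> remains a covering.\<close>

lemma uniformization_at:
  assumes hyp: "hyperbolic_foliation A E F" and p: "p \<notin> E"
  obtains \<alpha> where "uniformization_of A E F p \<alpha>" "\<alpha> 0 = p"
proof -
  have "\<exists>\<beta>. uniformization_of A E F p \<beta>" using hyp p by (simp add: hyperbolic_foliation_def)
  then obtain \<beta> where \<beta>: "uniformization_of A E F p \<beta>" ..
  note b = uniformization_ofD[OF \<beta> p]
  have "p \<in> \<beta> ` ball 0 1" using b(2) leaf_refl by blast
  then obtain w where w: "w \<in> ball 0 1" "p = \<beta> w" by blast
  let ?M = "Moebius_function 0 (- w)"
  have w': "cmod (- w) < 1" using w(1) by simp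
  have Mb: "?M ` ball 0 1 \<subseteq> ball 0 1" using Moebius_function_norm_lt_1[OF w'] by auto
  have "holomorphic_curve_on A (ball 0 1) (\<beta> \<circ> ?M)"
    by (rule holomorphic_curve_on_compose[OF b(1) Moebius_function_holomorphic[OF w'] Mb])
  moreover have "(\<beta> \<circ> ?M) ` ball 0 1 \<subseteq> leaf E F p" using Mb b(2) by auto
  moreover have "covering_map_top (top_of_set (ball 0 1)) (subtopology (leaf_topology E F) (leaf E F p)) (\<beta> \<circ> ?M)"
    by (rule covering_map_top_compose_homeomorphic[OF _ Moebius_homeomorphic_map[OF w']])
      (use \<beta> in \<open>simp add: uniformization_of_def\<close>)
  ultimately have "uniformization_of A E F p (\<beta> \<circ> ?M)"
    unfolding uniformization_of_def discs_def using p by blast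
  moreover have "(\<beta> \<circ> ?M) 0 = p" by (simp add: Moebius_function_of_zero w(2))
  ultimately show ?thesis by (rule that)
qed

end

text \<open>The metric in \<open>compactly_convergent_on\<close> is an arbitrary one inducing the
  topology, so estimates are transferred to a continuous \<open>\<phi>\<close> such as a coordinate
  or a defining function. Compactness of \<open>K\<close> provides one tolerance for all its points,
  as in the Lebesgue number lemma.\<close>

lemma compactly_convergent_uniform:
  fixes \<sigma> :: "nat \<Rightarrow> complex \<Rightarrow> 'm::topological_space" and \<phi> :: "'m \<Rightarrow> 'b::metric_space"
  assumes conv: "compactly_convergent_on S \<sigma> f" and fc: "continuous_on S f" and S: "open S"
    and K: "compact K" "K \<subseteq> S" and W: "open W" "f ` K \<subseteq> W" and \<phi>: "continuous_on W \<phi>" and e: "0 < e"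
  shows "\<forall>\<^sub>F k in sequentially. \<forall>z\<in>K. \<sigma> k z \<in> W \<and> dist (\<phi> (\<sigma> k z)) (\<phi> (f z)) < e"
proof -
  obtain d where d: "Metric_space UNIV d" "Metric_space.mtopology UNIV d = euclidean"
    and ev: "\<And>K \<epsilon>. \<lbrakk>compact K; K \<subseteq> S; 0 < \<epsilon>\<rbrakk> \<Longrightarrow> \<forall>\<^sub>F k in sequentially. \<forall>z\<in>K. d (\<sigma> k z) (f z) < \<epsilon>"
    using conv unfolding compactly_convergent_on_def by blast
  interpret Metric_space UNIV d by (rule d(1))
  have ball_open: "open (mball x r)" for x r using openin_mball[of x r] d(2) by simp
  have ball_in: "\<exists>r>0. mball x r \<subseteq> O'" if "open O'" "x \<in> O'" for O' x
    using openin_mtopology[of O'] d(2) that by simp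
  have "\<exists>\<delta>>0. \<forall>y. d (f x) y < \<delta> \<longrightarrow> y \<in> W \<and> dist (\<phi> y) (\<phi> (f x)) < e / 2" if x: "x \<in> K" for x
  proof -
    have "open (W \<inter> \<phi> -` ball (\<phi> (f x)) (e / 2))"
      by (rule continuous_open_preimage[OF \<phi> W(1) open_ball])
    moreover have "f x \<in> W \<inter> \<phi> -` ball (\<phi> (f x)) (e / 2)" using x W(2) e by auto
    ultimately obtain r where "r > 0" "mball (f x) r \<subseteq> W \<inter> \<phi> -` ball (\<phi> (f x)) (e / 2)"
      using ball_in by blast
    then show ?thesis by (intro exI[of _ r]) (auto simp: dist_commute subset_iff)
  qed
  then obtain \<delta> where \<delta>: "\<And>x. x \<in> K \<Longrightarrow> 0 < \<delta> x"
    "\<And>x y. \<lbrakk>x \<in> K; d (f x) y < \<delta> x\<rbrakk> \<Longrightarrow> y \<in> W \<and> dist (\<phi> y) (\<phi> (f x)) < e / 2"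
    by metis
  \<comment> \<open>Half of \<open>\<delta> x\<close> is reserved for the distance from
    \<open>f x\<close> to \<open>f z\<close>, the other half for that from \<open>f z\<close> to the
    approximating point.\<close>
  define N where "N = (\<lambda>x. S \<inter> f -` mball (f x) (\<delta> x / 2))"
  have No: "open (N x)" for x
    unfolding N_def by (rule continuous_open_preimage[OF fc S ball_open])
  have KN: "K \<subseteq> \<Union>(N ` K)"
  proof
    fix x assume x: "x \<in> K"
    then have "x \<in> N x" using \<delta>(1)[OF x] K(2) by (auto simp: N_def)
    then show "x \<in> \<Union>(N ` K)" using x by blast
  qed
  obtain C where C: "C \<subseteq> K" "finite C" "K \<subseteq> \<Union>(N ` C)"
    by (rule compactE_image[OF K(1) No KN]) (rule that)
  \<comment> \<open>The element 1 keeps the set nonempty when \<open>K\<close> is empty.\<close>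
  define \<epsilon> where "\<epsilon> = Min (insert 1 ((\<lambda>x. \<delta> x / 2) ` C))"
  have \<epsilon>: "0 < \<epsilon>" "\<And>x. x \<in> C \<Longrightarrow> \<epsilon> \<le> \<delta> x / 2"
  proof -
    show "0 < \<epsilon>" using C(1,2) \<delta>(1) by (auto simp: \<epsilon>_def subset_iff)
    show "\<epsilon> \<le> \<delta> x / 2" if "x \<in> C" for x
      unfolding \<epsilon>_def by (rule Min_le) (use C(2) that in auto)
  qed
  show ?thesis
  proof (rule eventually_mono[OF ev[OF K \<epsilon>(1)]], rule ballI)
    fix k z assume close: "\<forall>z\<in>K. d (\<sigma> k z) (f z) < \<epsilon>" and z: "z \<in> K"
    obtain x where x: "x \<in> C" "z \<in> N x" using C(3) z by blast
    have xK: "x \<in> K" using x(1) C(1) by blast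
    have 1: "d (f x) (f z) < \<delta> x / 2" using x(2) by (simp add: N_def)
    moreover have "d (f z) (\<sigma> k z) < \<epsilon>" using close z commute by metis
    ultimately have "d (f x) (\<sigma> k z) < \<delta> x"
      using triangle[of "f x" "f z" "\<sigma> k z"] \<epsilon>(2)[OF x(1)] by simp
    from \<delta>(2)[OF xK this] have 2: "\<sigma> k z \<in> W" "dist (\<phi> (\<sigma> k z)) (\<phi> (f x)) < e / 2" by auto
    have "dist (\<phi> (f z)) (\<phi> (f x)) < e / 2" using \<delta>(2)[OF xK, of "f z"] 1 \<delta>(1)[OF xK] by simp
    then show "\<sigma> k z \<in> W \<and> dist (\<phi> (\<sigma> k z)) (\<phi> (f z)) < e"
      using 2 dist_triangle_half_r[of "\<phi> (f x)" "\<phi> (\<sigma> k z)" e "\<phi> (f z)"] by (simp add: dist_commute)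
  qed
qed

lemma compactly_convergent_tendsto:
  assumes "compactly_convergent_on S \<sigma> f" "continuous_on S f" "open S" "z \<in> S"
  shows "(\<lambda>k. \<sigma> k z) \<longlonglongrightarrow> f z"
proof (rule topological_tendstoI)
  fix W assume "open W" "f z \<in> W"
  then show "\<forall>\<^sub>F k in sequentially. \<sigma> k z \<in> W"
    using compactly_convergent_uniform[OF assms(1-3), of "{z}" W "\<lambda>_. 0::real" 1] assms(4)
    by (auto elim: eventually_mono)
qed

lemma compact_insert_range:
  fixes f :: "nat \<Rightarrow> 'a::topological_space"
  assumes "f \<longlonglongrightarrow> l"
  shows "compact (insert l (range f))"
proof (rule compactI)
  fix C assume C: "\<forall>t\<in>C. open t" "insert l (range f) \<subseteq> \<Union>C"
  then obtain T where T: "T \<in> C" "l \<in> T" by blast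
  then obtain N where N: "\<And>n. n \<ge> N \<Longrightarrow> f n \<in> T"
    using topological_tendstoD[OF assms] C(1) by (metis eventually_sequentially)
  have "\<exists>t\<in>C. f n \<in> t" for n using C(2) by blast
  then obtain t where t: "\<And>n. t n \<in> C \<and> f n \<in> t n" by metis
  show "\<exists>C'\<subseteq>C. finite C' \<and> insert l (range f) \<subseteq> \<Union>C'"
  proof (intro exI[of _ "insert T (t ` {..<N})"] conjI)
    show "insert l (range f) \<subseteq> \<Union>(insert T (t ` {..<N}))"
      using T N t by (auto simp: not_less[symmetric])
  qed (use T t in auto)
qed

context foliation
begin

text \<open>Near \<open>s\<close> the chart coordinates of \<open>\<sigma> k\<close> are eventually
  defined and converge uniformly, so Weierstrass' theorem gives convergence of their
  derivatives.\<close>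

lemma velocity_tendsto:
  assumes conv: "compactly_convergent_on S \<sigma> f" and S: "open S" "s \<in> S"
    and \<sigma>: "\<And>k. holomorphic_curve_on A S (\<sigma> k)" and f: "holomorphic_curve_on A S f"
    and c: "c \<in> A" "f s \<in> fst c"
  shows "(\<lambda>k. velocity c (\<sigma> k) s) \<longlonglongrightarrow> velocity c f s"
proof (rule vec_tendstoI)
  fix i
  have fc: "continuous_on S f" using f by (simp add: holomorphic_curve_on_def)
  have "open {z \<in> S. f z \<in> fst c}" by (rule curve_in_chart_open[OF c(1) f S(1) chart_open[OF c(1)]])
  then obtain e where e: "0 < e" "cball s e \<subseteq> {z \<in> S. f z \<in> fst c}"
    using open_contains_cball S(2) c(2) by (metis (mono_tags, lifting) mem_Collect_eq)
  have eS: "cball s e \<subseteq> S" "f ` cball s e \<subseteq> fst c" using e(2) by auto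
  let ?\<phi> = "\<lambda>p. snd c p $ i"
  have \<phi>: "continuous_on (fst c) ?\<phi>" by (intro continuous_intros chart_continuous[OF c(1)])
  have ev: "\<forall>\<^sub>F k in sequentially. \<forall>z\<in>cball s e. \<sigma> k z \<in> fst c \<and> dist (?\<phi> (\<sigma> k z)) (?\<phi> (f z)) < d"
    if "0 < d" for d
    by (rule compactly_convergent_uniform[OF conv fc S(1) compact_cball eS(1) chart_open[OF c(1)] eS(2) \<phi> that])
  have ul: "uniform_limit (cball s e) (\<lambda>k z. ?\<phi> (\<sigma> k z)) (\<lambda>z. ?\<phi> (f z)) sequentially"
    unfolding uniform_limit_iff by (intro allI impI eventually_mono[OF ev]) auto
  have "\<forall>\<^sub>F k in sequentially. continuous_on (cball s e) (\<lambda>z. ?\<phi> (\<sigma> k z)) \<and>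
      (\<forall>w\<in>ball s e. ((\<lambda>z. ?\<phi> (\<sigma> k z)) has_field_derivative velocity c (\<sigma> k) w $ i) (at w))"
  proof (rule eventually_mono[OF ev[OF zero_less_one]], intro conjI ballI)
    fix k assume k: "\<forall>z\<in>cball s e. \<sigma> k z \<in> fst c \<and> dist (?\<phi> (\<sigma> k z)) (?\<phi> (f z)) < 1"
    have "continuous_on (cball s e) (\<sigma> k)"
      using \<sigma>[of k] eS(1) continuous_on_subset by (auto simp: holomorphic_curve_on_def)
    from continuous_on_compose2[OF \<phi> this] show "continuous_on (cball s e) (\<lambda>z. ?\<phi> (\<sigma> k z))"
      using k by blast
    fix w assume "w \<in> ball s e"
    then have w: "w \<in> cball s e" by simp
    show "((\<lambda>z. ?\<phi> (\<sigma> k z)) has_field_derivative velocity c (\<sigma> k) w $ i) (at w)"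
      by (rule curve_has_velocity[OF c(1) \<sigma> S(1)]) (use w k eS(1) in auto)
  qed
  then obtain g' where g': "\<And>w. w \<in> ball s e \<Longrightarrow> ((\<lambda>z. ?\<phi> (f z)) has_field_derivative g' w) (at w) \<and>
      (\<lambda>k. velocity c (\<sigma> k) w $ i) \<longlonglongrightarrow> g' w"
    by (rule has_complex_derivative_uniform_limit[OF _ ul sequentially_bot e(1)]) (rule that)
  have "((\<lambda>z. ?\<phi> (f z)) has_field_derivative velocity c f s $ i) (at s)"
    by (rule curve_has_velocity[OF c(1) f S c(2)])
  then have "g' s = velocity c f s $ i" using g'[of s] e(1) DERIV_unique by fastforce
  then show "(\<lambda>k. velocity c (\<sigma> k) s $ i) \<longlonglongrightarrow> velocity c f s $ i" using g'[of s] e(1) by simp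
qed

text \<open>The factors of proportionality need not be followed to the limit: the 2x2 minors of
  velocity and field vanish for each \<open>\<sigma> k\<close>, hence for \<open>f\<close>, and the
  field is nonzero at \<open>f s\<close>.\<close>

lemma tangent_at_limit:
  assumes conv: "compactly_convergent_on S \<sigma> f" and S: "open S" "s \<in> S"
    and \<sigma>: "\<And>k. tangent_curve A E F S (\<sigma> k)" and f: "holomorphic_curve_on A S f" and E: "f s \<notin> E"
  shows "tangent_at F f s"
proof -
  obtain c W X where G: "(c, W, X) \<in> F" "f s \<in> W" by (rule ex_generator)
  note c = generator(1)[OF G(1)]
  have cf: "f s \<in> fst c" using generator(3)[OF G(1)] G(2) by blast
  have h\<sigma>: "holomorphic_curve_on A S (\<sigma> k)" for k using \<sigma>[of k] by (simp add: tangent_curve_def)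
  have vt: "(\<lambda>k. velocity c (\<sigma> k) s $ i) \<longlonglongrightarrow> velocity c f s $ i" for i
    by (intro tendsto_vec_nth velocity_tendsto[OF conv S h\<sigma> f c cf])
  have fc: "continuous_on S f" using f by (simp add: holomorphic_curve_on_def)
  have st: "(\<lambda>k. \<sigma> k s) \<longlonglongrightarrow> f s" by (rule compactly_convergent_tendsto[OF conv fc S])
  have Xt: "(\<lambda>k. X (\<sigma> k s) $ i) \<longlonglongrightarrow> X (f s) $ i" for i
  proof -
    have "continuous_on W (\<lambda>p. X p $ i)"
      by (rule holomorphic_fun_in_imp_continuous_on[OF generator(4,2)[OF G(1)]])
    then have "isCont (\<lambda>p. X p $ i) (f s)"
      using generator(2)[OF G(1)] G(2) by (simp add: continuous_on_eq_continuous_at)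
    from isCont_tendsto_compose[OF this st] show ?thesis .
  qed
  have cross: "velocity c f s $ i * X (f s) $ j = velocity c f s $ j * X (f s) $ i" for i j
  proof (rule tendsto_unique[OF sequentially_bot])
    show "(\<lambda>k. velocity c (\<sigma> k) s $ i * X (\<sigma> k s) $ j) \<longlonglongrightarrow> velocity c f s $ i * X (f s) $ j"
      by (intro tendsto_mult vt Xt)
    have t: "(\<lambda>k. velocity c (\<sigma> k) s $ j * X (\<sigma> k s) $ i) \<longlonglongrightarrow> velocity c f s $ j * X (f s) $ i"
      by (intro tendsto_mult vt Xt)
    have "\<forall>\<^sub>F k in sequentially. velocity c (\<sigma> k) s $ j * X (\<sigma> k s) $ i = velocity c (\<sigma> k) s $ i * X (\<sigma> k s) $ j"
      using topological_tendstoD[OF st generator(2)[OF G(1)] G(2)]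
    proof (rule eventually_mono)
      fix k assume k: "\<sigma> k s \<in> W"
      have "tangent_at F (\<sigma> k) s" using \<sigma>[of k] S(2) by (simp add: tangent_curve_def)
      from tangent_atD[OF this G(1) k] obtain u where "velocity c (\<sigma> k) s = u *s X (\<sigma> k s)" ..
      then show "velocity c (\<sigma> k) s $ j * X (\<sigma> k s) $ i = velocity c (\<sigma> k) s $ i * X (\<sigma> k s) $ j" by simp
    qed
    with t show "(\<lambda>k. velocity c (\<sigma> k) s $ i * X (\<sigma> k s) $ j) \<longlonglongrightarrow> velocity c f s $ j * X (f s) $ i"
      by (rule Lim_transform_eventually)
  qed
  obtain j where j: "X (f s) $ j \<noteq> 0" using generator(5)[OF G] E by (auto simp: vec_eq_iff)
  show ?thesis
  proof (rule tangent_atI[OF f S E G])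
    show "velocity c f s = (velocity c f s $ j / X (f s) $ j) *s X (f s)"
      using cross[of _ j] j by (simp add: vec_eq_iff field_simps)
  qed
qed

end

section \<open>Limits of uniformizations stay off the singular set\<close>

locale ncp_foliation = foliation A E F
  for A :: "('m::{t2_space, second_countable_topology}, 'n::finite) chart set"
    and E :: "'m set" and F :: "('m, 'n) generator set" +
  fixes U \<Sigma> :: "'m \<Rightarrow> 'm set"
  assumes hyperbolic: "hyperbolic_foliation A E F"
    and NCP: "NCP A (uniformizations A E F)"
    and nbhd: "\<And>q. q \<in> E \<Longrightarrow> open (U q) \<and> q \<in> U q"
    and hypersurface: "\<And>q. q \<in> E \<Longrightarrow> invariant_hypersurface A E F (U q) (\<Sigma> q) \<and> q \<in> \<Sigma> q"
begin

definition regular :: "'m \<Rightarrow> bool" where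
  "regular z \<longleftrightarrow> z \<notin> (\<Union>p \<in> (\<Union>q\<in>E. \<Sigma> q). leaf E F p)"

lemma regular_not_singular: "regular z \<Longrightarrow> z \<notin> E"
  using hypersurface leaf_refl unfolding regular_def by blast

lemma regular_leaf:
  assumes z: "regular z" and w: "w \<in> leaf E F z"
  shows "regular w"
  unfolding regular_def
proof
  have zE: "z \<notin> E" by (rule regular_not_singular[OF z])
  note wE = leaf_disjoint_singular[OF zE w]
  assume "w \<in> (\<Union>p \<in> (\<Union>q\<in>E. \<Sigma> q). leaf E F p)"
  then obtain p where p: "p \<in> (\<Union>q\<in>E. \<Sigma> q)" "w \<in> leaf E F p" by blast
  have "p \<notin> E"
  proof
    assume "p \<in> E"
    then have "leaf E F p = {p}" by (simp add: leaf_def)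
    then show False using p(2) \<open>p \<in> E\<close> wE by simp
  qed
  from leaf_eq[OF this p(2)] leaf_eq[OF zE w] have "z \<in> leaf E F p" using leaf_refl[of z] by simp
  then show False using z p(1) unfolding regular_def by blast
qed

text \<open>Near a point where the limit meets \<open>E\<close>, the defining function of the invariant hypersurface
  vanishes nowhere or everywhere along each approximating disc, so by Hurwitz the limit stays in the
  hypersurface.\<close>

lemma limit_in_hypersurface:
  assumes conv: "compactly_convergent_on (ball 0 1) \<sigma> f"
    and \<sigma>: "\<And>k. tangent_curve A E F (ball 0 1) (\<sigma> k)"
    and f: "holomorphic_curve_on A (ball 0 1) f" and x: "x \<in> ball 0 1" "f x \<in> E"
  obtains e where "0 < e" "f ` ball x e \<subseteq> \<Sigma> (f x)"
proof -
  define q where "q = f x"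
  have qE: "q \<in> E" using x by (simp add: q_def)
  have inv: "invariant_hypersurface A E F (U q) (\<Sigma> q)" and qS: "q \<in> \<Sigma> q" using hypersurface[OF qE] by auto
  have "\<exists>g. holomorphic_fun_in A (U q) g \<and>
      (\<forall>V. open V \<and> V \<noteq> {} \<and> V \<subseteq> U q \<longrightarrow> (\<exists>x\<in>V. g x \<noteq> 0)) \<and> \<Sigma> q = {x \<in> U q. g x = 0}"
    using inv unfolding invariant_hypersurface_def by (rule conjunct1)
  then obtain g where g: "holomorphic_fun_in A (U q) g" "\<Sigma> q = {x \<in> U q. g x = 0}"
    by (elim exE conjE) (rule that)
  have "\<forall>p\<in>\<Sigma> q - E. leaf E (restrict_foliation F (U q)) p \<subseteq> \<Sigma> q"
    using inv unfolding invariant_hypersurface_def by (rule conjunct2)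
  then have leafS: "\<And>p. p \<in> \<Sigma> q - E \<Longrightarrow> leaf E (restrict_foliation F (U q)) p \<subseteq> \<Sigma> q" by (rule bspec)
  have Uq: "open (U q)" "q \<in> U q" using nbhd[OF qE] by auto
  have fc: "continuous_on (ball 0 1) f" using f by (simp add: holomorphic_curve_on_def)
  have "open (ball 0 1 \<inter> f -` U q)" by (rule continuous_open_preimage[OF fc open_ball Uq(1)])
  moreover have "x \<in> ball 0 1 \<inter> f -` U q" using x Uq(2) by (simp add: q_def)
  ultimately obtain e where e: "0 < e" "cball x e \<subseteq> ball 0 1 \<inter> f -` U q"
    using open_contains_cball by metis
  have eD: "cball x e \<subseteq> ball 0 1" "f ` cball x e \<subseteq> U q" using e(2) by auto
  have bD: "ball x e \<subseteq> ball 0 1" "f ` ball x e \<subseteq> U q" using eD ball_subset_cball[of x e] by auto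
  have gc: "continuous_on (U q) g" by (rule holomorphic_fun_in_imp_continuous_on[OF g(1) Uq(1)])
  have ev: "\<forall>\<^sub>F k in sequentially. \<forall>z\<in>cball x e. \<sigma> k z \<in> U q \<and> dist (g (\<sigma> k z)) (g (f z)) < d" if "0 < d" for d
    by (rule compactly_convergent_uniform[OF conv fc open_ball compact_cball eD(1) Uq(1) eD(2) gc that])
  then obtain N where N: "\<And>k z. \<lbrakk>k \<ge> N; z \<in> cball x e\<rbrakk> \<Longrightarrow> \<sigma> k z \<in> U q"
    unfolding eventually_sequentially by (meson zero_less_one)
  have h\<sigma>: "holomorphic_curve_on A (ball x e) (\<sigma> k)" for k
    using \<sigma>[of k] bD(1) holomorphic_curve_on_subset by (auto simp: tangent_curve_def)
  have dich: "g (\<sigma> k t) = 0" if k: "k \<ge> N" and s: "s \<in> ball x e" "g (\<sigma> k s) = 0" and t: "t \<in> ball x e" for k s t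
  proof -
    have "\<sigma> k s \<in> \<Sigma> q" using N[OF k, of s] s by (simp add: g(2))
    moreover have "\<sigma> k s \<notin> E" using \<sigma>[of k] s(1) bD(1) unfolding tangent_curve_def by blast
    ultimately have "leaf E (restrict_foliation F (U q)) (\<sigma> k s) \<subseteq> \<Sigma> q" using leafS by blast
    moreover have "\<sigma> k t \<in> leaf E (restrict_foliation F (U q)) (\<sigma> k s)"
      by (rule tangent_curve_in_leaf_restrict[OF tangent_curve_subset[OF \<sigma> bD(1)] open_ball Uq(1) _ connected_ball s(1) t])
        (use N[OF k] in auto)
    ultimately show ?thesis by (auto simp: g(2))
  qed
  have gf: "(\<lambda>z. g (f z)) holomorphic_on ball x e"
    by (rule holomorphic_fun_in_curve[OF g(1) Uq(1) holomorphic_curve_on_subset[OF f bD(1)] open_ball bD(2)])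
  have "g q = 0" using qS unfolding g(2) by simp
  then have gx: "g (f x) = 0" unfolding q_def .
  have "g (f t) = 0" if t: "t \<in> ball x e" for t
  proof (rule ccontr)
    assume nz: "g (f t) \<noteq> 0"
    have "\<forall>\<^sub>F k in sequentially. \<forall>z\<in>cball x e. \<sigma> k z \<in> U q \<and> dist (g (\<sigma> k z)) (g (f z)) < cmod (g (f t))"
      by (rule ev) (use nz in simp)
    then obtain N' where N': "\<And>k. k \<ge> N' \<Longrightarrow> dist (g (\<sigma> k t)) (g (f t)) < cmod (g (f t))"
      unfolding eventually_sequentially using t by (metis ball_subset_cball subsetD)
    define M where "M = max N N'"
    \<comment> \<open>After this shift every term of the sequence takes its values in
      \<open>U q\<close> and is nonzero at \<open>t\<close>, so by \<open>dich\<close> it has no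
      zero on the ball and Hurwitz applies.\<close>
    have NM: "N \<le> k + M" "N' \<le> k + M" for k by (simp_all add: M_def trans_le_add2)
    have "g (f x) \<noteq> 0"
    proof (rule Hurwitz_no_zeros[of "ball x e" "\<lambda>k z. g (\<sigma> (k + M) z)" "\<lambda>z. g (f z)" x])
      show "(\<lambda>z. g (\<sigma> (k + M) z)) holomorphic_on ball x e" for k
        by (rule holomorphic_fun_in_curve[OF g(1) Uq(1) h\<sigma> open_ball])
          (use N[OF NM(1)] ball_subset_cball in auto)
      show "\<not> (\<lambda>z. g (f z)) constant_on ball x e"
        using nz gx t e(1) unfolding constant_on_def by (metis centre_in_ball)
      show "g (\<sigma> (k + M) z) \<noteq> 0" if z: "z \<in> ball x e" for k z
      proof
        assume "g (\<sigma> (k + M) z) = 0"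
        from dich[OF NM(1) z this t] have "g (\<sigma> (k + M) t) = 0" .
        then show False using N'[OF NM(2), of k] by simp
      qed
      show "uniform_limit K (\<lambda>k z. g (\<sigma> (k + M) z)) (\<lambda>z. g (f z)) sequentially"
        if K: "compact K" "K \<subseteq> ball x e" for K
      proof -
        have "uniform_limit K (\<lambda>k z. g (\<sigma> k z)) (\<lambda>z. g (f z)) sequentially"
          unfolding uniform_limit_iff
        proof (intro allI impI eventually_mono[OF ev])
          fix d :: real and k
          assume "\<forall>z\<in>cball x e. \<sigma> k z \<in> U q \<and> dist (g (\<sigma> k z)) (g (f z)) < d"
          then show "\<forall>z\<in>K. dist (g (\<sigma> k z)) (g (f z)) < d"
            using K(2) ball_subset_cball[of x e] by blast
        qed
        from filterlim_compose[OF this filterlim_add_const_nat_at_top[of M]] show ?thesis .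
      qed
    qed (use e(1) gf in auto)
    then show False using gx by simp
  qed
  then have "f ` ball x e \<subseteq> \<Sigma> q" using bD(2) by (auto simp: g(2))
  then show ?thesis using e(1) that unfolding q_def by blast
qed

text \<open>On the component \<open>V\<close> of \<open>0\<close> in the preimage of the complement
  of \<open>E\<close>, the limit is tangent and stays in the leaf of \<open>z\<close>. A boundary
  point of \<open>V\<close> inside the disc would be mapped to \<open>E\<close>, and
  \<open>f\<close> would carry nearby points of \<open>V\<close> into a hypersurface, putting
  \<open>z\<close> on an excluded leaf. So \<open>V\<close> is clopen in the disc.\<close>

lemma uniformization_limit:
  assumes z: "regular z" and p: "p \<longlonglongrightarrow> z" "\<And>n. p n \<notin> E"
    and \<alpha>: "\<And>n. uniformization_of A E F (p n) (\<alpha> n)" "\<And>n. \<alpha> n 0 = p n"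
  obtains r f where "strict_mono r" "tangent_curve A E F (ball 0 1) f" "f 0 = z"
    "f ` ball 0 1 \<subseteq> leaf E F z" "compactly_convergent_on (ball 0 1) (\<alpha> \<circ> r) f"
proof -
  let ?D = "ball (0::complex) 1"
  have H: "range \<alpha> \<subseteq> uniformizations A E F" using \<alpha>(1) p(2) by (auto simp: uniformizations_def)
  have im: "(\<lambda>\<beta>. \<beta> 0) ` range \<alpha> = range p" using \<alpha>(2) by (auto simp: image_iff)
  \<comment> \<open>NCP asks for relatively compact centres: a convergent sequence together with its
    limit is compact.\<close>
  have "closure (range p) \<subseteq> insert z (range p)"
    using compact_imp_closed[OF compact_insert_range[OF p(1)]] by (intro closure_minimal) auto
  then have "compact (closure (range p))"
    using compact_Int_closed[OF compact_insert_range[OF p(1)] closed_closure[of "range p"]]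
    by (simp add: Int_absorb1)
  then have "normal_family A (range \<alpha>)" using NCP H unfolding NCP_def im[symmetric] by blast
  then obtain r f where r: "strict_mono r" and f: "holomorphic_curve_on A ?D f"
    and conv: "compactly_convergent_on ?D (\<alpha> \<circ> r) f"
    unfolding normal_family_def by blast
  have fc: "continuous_on ?D f" using f by (simp add: holomorphic_curve_on_def)
  have zero: "0 \<in> ?D" by simp
  have "(\<lambda>k. (\<alpha> \<circ> r) k 0) \<longlonglongrightarrow> f 0" by (rule compactly_convergent_tendsto[OF conv fc open_ball zero])
  moreover have "(\<lambda>k. (\<alpha> \<circ> r) k 0) \<longlonglongrightarrow> z" using LIMSEQ_subseq_LIMSEQ[OF p(1) r] by (simp add: o_def \<alpha>(2))
  ultimately have f0: "f 0 = z" by (rule tendsto_unique[OF sequentially_bot])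
  have \<sigma>: "tangent_curve A E F ?D ((\<alpha> \<circ> r) k)" for k
    using uniformization_ofD(3)[OF \<alpha>(1) p(2)] by simp
  have zE: "z \<notin> E" by (rule regular_not_singular[OF z])
  define O' where "O' = ?D \<inter> f -` (- E)"
  have O': "open O'" "O' \<subseteq> ?D"
    unfolding O'_def using closed_singular_set
    by (auto intro!: continuous_open_preimage[OF fc open_ball])
  have t: "tangent_at F f s" if "s \<in> O'" for s
    by (rule tangent_at_limit[OF conv open_ball _ \<sigma> f]) (use that in \<open>auto simp: O'_def\<close>)
  have tO: "tangent_curve A E F O' f"
    unfolding tangent_curve_def using t holomorphic_curve_on_subset[OF f O'(2)] by (auto simp: O'_def)
  define V where "V = connected_component_set O' 0"
  have zO: "0 \<in> O'" using zE by (simp add: O'_def f0)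
  have V: "open V" "V \<subseteq> O'" "connected V" "0 \<in> V"
    using O'(1) zO connected_component_subset[of O' 0]
    by (auto simp: V_def open_connected_component connected_component_refl)
  have VL: "f s \<in> leaf E F z" if "s \<in> V" for s
    using tangent_curve_in_leaf[OF tangent_curve_subset[OF tO V(2)] V(1,3,4) that] by (simp add: f0)
  \<comment> \<open>Relative closedness of \<open>V\<close> in the disc; this is where regularity of
    \<open>z\<close> is used.\<close>
  have "x \<in> V" if x: "x \<in> ?D" "x \<in> closure V" for x
  proof (rule ccontr)
    assume "x \<notin> V"
    then have "x \<notin> O'" using in_closure_connected_component[OF _ O'(1)] x(2) unfolding V_def by blast
    then have "f x \<in> E" using x(1) by (simp add: O'_def)
    then obtain e where e: "0 < e" "f ` ball x e \<subseteq> \<Sigma> (f x)"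
      by (rule limit_in_hypersurface[OF conv \<sigma> f x(1)]) (rule that)
    obtain y where y: "y \<in> V" "dist y x < e" using x(2) e(1) unfolding closure_approachable by blast
    then have "f y \<in> \<Sigma> (f x)" using e(2) by (auto simp: dist_commute)
    moreover have "z \<in> leaf E F (f y)" using leaf_eq[OF zE VL[OF y(1)]] leaf_refl[of z] by simp
    ultimately show False using z \<open>f x \<in> E\<close> unfolding regular_def by blast
  qed
  then have "V = ?D \<inter> closure V" using V(2) O'(2) closure_subset[of V] by blast
  then have "closedin (top_of_set ?D) V" by (metis closed_closure closedin_closed_Int)
  moreover have "openin (top_of_set ?D) V" using V(1,2) O'(2) by (simp add: openin_open_eq)
  ultimately have "V = ?D" using connected_clopen[of ?D] connected_ball V(4) by blast
  then show ?thesis using that[OF r tangent_curve_subset[OF tO] f0 _ conv] V(2) VL by blast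
qed

end


section \<open>Length of velocities and the modulus of uniformization\<close>

definition metric_norm ::
    "(('m, 'n::finite) chart \<Rightarrow> 'm \<Rightarrow> complex^'n \<Rightarrow> complex^'n \<Rightarrow> complex)
      \<Rightarrow> ('m, 'n) chart \<Rightarrow> 'm \<Rightarrow> complex^'n \<Rightarrow> real" where
  "metric_norm g c p v = sqrt (Re (g c p v v))"

text \<open>\<open>initial_speed\<close> at an arbitrary parameter, with the chart chosen by the
  same \<open>SOME\<close> expression so that the two agree at 0 by unfolding.\<close>

definition speed ::
    "('m, 'n::finite) chart set \<Rightarrow> (('m, 'n) chart \<Rightarrow> 'm \<Rightarrow> complex^'n \<Rightarrow> complex^'n \<Rightarrow> complex)
      \<Rightarrow> (complex \<Rightarrow> 'm) \<Rightarrow> complex \<Rightarrow> real" where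
  "speed A g f s = (let c = SOME c. c \<in> A \<and> f s \<in> fst c in metric_norm g c (f s) (velocity c f s))"

lemma initial_speed_eq_speed: "initial_speed A g f = speed A g f 0"
  by (simp add: initial_speed_def speed_def metric_norm_def velocity_def Let_def)

section \<open>Hermitian norms and the speed of curves\<close>

context
  fixes B :: "complex^'n::finite \<Rightarrow> complex^'n \<Rightarrow> complex"
  assumes B: "hermitian_inner_product B"
begin

lemma hermitian_add_scale: "B (a *s u + v) w = a * B u w + B v w"
  and hermitian_cnj: "B w v = cnj (B v w)"
  and hermitian_pos: "v \<noteq> 0 \<Longrightarrow> 0 < Re (B v v)"
  using B unfolding hermitian_inner_product_def by blast+

lemma hermitian_zero: "B 0 w = 0"
  using hermitian_add_scale[of 1 0 0 w] by simp

lemma hermitian_scale: "B (a *s u) w = a * B u w"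
  using hermitian_add_scale[of a u 0 w] by (simp add: hermitian_zero)

lemma hermitian_sum:
  assumes "finite I"
  shows "B (\<Sum>i\<in>I. a i *s u i) w = (\<Sum>i\<in>I. a i * B (u i) w)"
  using assms by induction (simp_all add: hermitian_zero hermitian_add_scale)

lemma hermitian_expand:
  "B v v = (\<Sum>i\<in>UNIV. \<Sum>j\<in>UNIV. v $ i * (cnj (v $ j) * B (axis i 1) (axis j 1)))"
proof -
  have v: "v = (\<Sum>i\<in>UNIV. v $ i *s axis i 1)"
    by (simp add: vec_eq_iff axis_def if_distrib[of "\<lambda>x. _ * x"] cong: if_cong)
  have left: "B v w = (\<Sum>i\<in>UNIV. v $ i * B (axis i 1) w)" for w
    using hermitian_sum[of UNIV "\<lambda>i. v $ i" "\<lambda>i. axis i 1" w] v by simp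
  have right: "B w v = (\<Sum>j\<in>UNIV. cnj (v $ j) * B w (axis j 1))" for w
    using hermitian_cnj[of w v] hermitian_cnj[of w "axis _ 1"] by (simp add: left)
  have "B v v = (\<Sum>i\<in>UNIV. v $ i * B (axis i 1) v)" by (rule left)
  also have "\<dots> = (\<Sum>i\<in>UNIV. \<Sum>j\<in>UNIV. v $ i * (cnj (v $ j) * B (axis i 1) (axis j 1)))"
    by (simp only: right sum_distrib_left)
  finally show ?thesis .
qed

lemma hermitian_scale_both: "B (a *s v) (a *s v) = of_real ((cmod a)\<^sup>2) * B v v"
proof -
  have "B v (a *s v) = cnj a * B v v"
    using hermitian_cnj[of v "a *s v"] hermitian_cnj[of v v] by (simp add: hermitian_scale)
  then show ?thesis
    by (simp add: hermitian_scale complex_norm_square del: of_real_power)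
qed

end

locale hermitian_atlas = atlas A
  for A :: "('m::{t2_space, second_countable_topology}, 'n::finite) chart set" +
  fixes g :: "('m, 'n) chart \<Rightarrow> 'm \<Rightarrow> complex^'n \<Rightarrow> complex^'n \<Rightarrow> complex"
  assumes metric: "hermitian_metric A g"
begin

lemma metric_hermitian: "\<lbrakk>c \<in> A; p \<in> fst c\<rbrakk> \<Longrightarrow> hermitian_inner_product (g c p)"
  using metric unfolding hermitian_metric_def by (elim conjE) (drule (1) bspec, drule (1) bspec)

lemma metric_norm_pos: "\<lbrakk>c \<in> A; p \<in> fst c; v \<noteq> 0\<rbrakk> \<Longrightarrow> 0 < metric_norm g c p v"
  using hermitian_pos[OF metric_hermitian] by (simp add: metric_norm_def)

lemma metric_norm_nonneg: "\<lbrakk>c \<in> A; p \<in> fst c\<rbrakk> \<Longrightarrow> 0 \<le> metric_norm g c p v"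
  using metric_norm_pos[of c p v] hermitian_zero[OF metric_hermitian, of c p 0]
  by (cases "v = 0") (auto simp: metric_norm_def)

lemma metric_norm_scale:
  assumes "c \<in> A" "p \<in> fst c"
  shows "metric_norm g c p (a *s v) = cmod a * metric_norm g c p v"
  using hermitian_scale_both[OF metric_hermitian[OF assms], of a v]
  by (simp add: metric_norm_def real_sqrt_mult del: of_real_power)

lemma metric_norm_change:
  assumes "c \<in> A" "d \<in> A" "p \<in> fst c" "p \<in> fst d"
  shows "metric_norm g c p v = metric_norm g d p (change_coords c d p v)"
proof -
  have "\<forall>c\<in>A. \<forall>d\<in>A. \<forall>p\<in>fst c \<inter> fst d. \<forall>v w.
        g c p v w = g d p (change_coords c d p v) (change_coords c d p w)"
    using metric unfolding hermitian_metric_def by (rule conjunct2[THEN conjunct2])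
  from bspec[OF bspec[OF bspec[OF this assms(1)] assms(2)] IntI[OF assms(3,4)]]
  have "g c p v v = g d p (change_coords c d p v) (change_coords c d p v)" by (elim allE)
  then show ?thesis by (simp only: metric_norm_def)
qed

lemma metric_continuous:
  assumes c: "c \<in> A"
  shows "continuous_on (fst c) (\<lambda>p. g c p v w)"
proof -
  obtain U \<phi> where c': "c = (U, \<phi>)" by (cases c)
  have "\<forall>(U, \<phi>)\<in>A. \<forall>v w k. Ck_on k (\<lambda>x. g (U, \<phi>) (inv_into U \<phi> x) v w) (\<phi> ` U)"
    using metric unfolding hermitian_metric_def by (rule conjunct2[THEN conjunct1])
  from bspec[OF this c] have "\<forall>v w k. Ck_on k (\<lambda>x. g c (inv_into (fst c) (snd c) x) v w) (snd c ` fst c)"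
    unfolding c' by simp
  then have "Ck_on 0 (\<lambda>x. g c (inv_into (fst c) (snd c) x) v w) (snd c ` fst c)" by blast
  then have "continuous_on (snd c ` fst c) (\<lambda>x. g c (inv_into (fst c) (snd c) x) v w)" by simp
  from continuous_on_compose[OF chart_continuous[OF c] this]
  show ?thesis
    by (rule continuous_on_eq) (simp add: chart_inv[OF c])
qed

text \<open>The metric is continuous in the point for fixed coordinate vectors only. Expanding
  \<open>V k\<close> in the standard basis reduces the joint limit in point and vector to finitely
  many such functions.\<close>

lemma metric_norm_tendsto:
  assumes c: "c \<in> A" "p \<in> fst c" and P: "(P \<longlongrightarrow> p) Q" and V: "(V \<longlongrightarrow> v) Q"
  shows "((\<lambda>k. metric_norm g c (P k) (V k)) \<longlongrightarrow> metric_norm g c p v) Q"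
proof -
  have gt: "((\<lambda>k. g c (P k) u w) \<longlongrightarrow> g c p u w) Q" for u w
  proof -
    have "isCont (\<lambda>p. g c p u w) p"
      using metric_continuous[OF c(1)] chart_open[OF c(1)] c(2) by (simp add: continuous_on_eq_continuous_at)
    from isCont_tendsto_compose[OF this P] show ?thesis .
  qed
  let ?S = "\<lambda>p v. \<Sum>i\<in>UNIV. \<Sum>j\<in>UNIV. v $ i * (cnj (v $ j) * g c p (axis i 1) (axis j 1))"
  have "((\<lambda>k. sqrt (Re (?S (P k) (V k)))) \<longlongrightarrow> sqrt (Re (?S p v))) Q"
    by (intro tendsto_real_sqrt tendsto_Re tendsto_sum tendsto_mult tendsto_cnj tendsto_vec_nth V gt)
  moreover have "sqrt (Re (?S p v)) = metric_norm g c p v"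
    unfolding metric_norm_def hermitian_expand[OF metric_hermitian[OF c], symmetric] ..
  moreover have "\<forall>\<^sub>F k in Q. sqrt (Re (?S (P k) (V k))) = metric_norm g c (P k) (V k)"
    using topological_tendstoD[OF P chart_open[OF c(1)] c(2)]
  proof (rule eventually_mono)
    fix k assume k: "P k \<in> fst c"
    show "sqrt (Re (?S (P k) (V k))) = metric_norm g c (P k) (V k)"
      unfolding metric_norm_def hermitian_expand[OF metric_hermitian[OF c(1) k], symmetric] ..
  qed
  ultimately show ?thesis using Lim_transform_eventually by fastforce
qed

lemma speed_eq:
  assumes f: "holomorphic_curve_on A S f" "open S" "s \<in> S" and c: "c \<in> A" "f s \<in> fst c"
  shows "speed A g f s = metric_norm g c (f s) (velocity c f s)"
proof -
  define d where "d = (SOME c. c \<in> A \<and> f s \<in> fst c)"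
  have "d \<in> A \<and> f s \<in> fst d" unfolding d_def by (rule someI[of _ c]) (use c in simp)
  then have d: "d \<in> A" "f s \<in> fst d" by auto
  have "speed A g f s = metric_norm g d (f s) (velocity d f s)" unfolding speed_def Let_def d_def ..
  also have "\<dots> = metric_norm g c (f s) (velocity c f s)"
    using metric_norm_change[OF c(1) d(1) c(2) d(2)] velocity_change_coords[OF f c d] by simp
  finally show ?thesis .
qed

lemma speed_nonneg:
  assumes f: "holomorphic_curve_on A S f" "open S" "s \<in> S"
  shows "0 \<le> speed A g f s"
proof -
  obtain c where c: "c \<in> A" "f s \<in> fst c" by (rule ex_chart)
  show ?thesis unfolding speed_eq[OF f c] by (rule metric_norm_nonneg[OF c])
qed

lemma speed_cong:
  assumes S: "open S" "s \<in> S" and eq: "\<And>t. t \<in> S \<Longrightarrow> f t = f' t"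
  shows "speed A g f s = speed A g f' s"
proof -
  have "velocity c f s = velocity c f' s" for c :: "('m, 'n) chart" by (rule velocity_cong[OF S eq])
  then show ?thesis unfolding speed_def Let_def eq[OF S(2)] by simp
qed

lemma speed_compose:
  assumes f: "holomorphic_curve_on A S f" "open S"
    and h: "h holomorphic_on T" "h ` T \<subseteq> S" "open T" "s \<in> T"
  shows "speed A g (f \<circ> h) s = cmod (deriv h s) * speed A g f (h s)"
proof -
  have hs: "h s \<in> S" using h by blast
  obtain c where c: "c \<in> A" "f (h s) \<in> fst c" by (rule ex_chart)
  have "speed A g (f \<circ> h) s = metric_norm g c (f (h s)) (velocity c (f \<circ> h) s)"
    using speed_eq[OF holomorphic_curve_on_compose[OF f(1) h(1,2)] h(3,4) c(1)] c(2) by simp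
  also have "velocity c (f \<circ> h) s = deriv h s *s velocity c f (h s)"
    by (rule velocity_compose[OF c(1) f hs c(2) holomorphic_derivI[OF h(1,3,4)]])
  also have "metric_norm g c (f (h s)) (deriv h s *s velocity c f (h s)) = cmod (deriv h s) * speed A g f (h s)"
    unfolding metric_norm_scale[OF c] speed_eq[OF f hs c] ..
  finally show ?thesis .
qed

lemma speed_continuous:
  assumes f: "holomorphic_curve_on A S f" "open S"
  shows "continuous_on S (speed A g f)"
proof (rule continuous_at_imp_continuous_on, rule ballI)
  fix s assume s: "s \<in> S"
  obtain c where c: "c \<in> A" "f s \<in> fst c" by (rule ex_chart)
  let ?T = "{z \<in> S. f z \<in> fst c}"
  have T: "open ?T" "s \<in> ?T" using curve_in_chart_open[OF c(1) f chart_open[OF c(1)]] s c by auto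
  have hT: "holomorphic_curve_on A ?T f" by (rule holomorphic_curve_on_subset[OF f(1)]) auto
  have vh: "(\<lambda>t. velocity c f t $ i) holomorphic_on ?T" for i
  proof -
    have "(\<lambda>z. snd c (f z) $ i) holomorphic_on ?T"
      by (rule curve_coord_holomorphic[OF c(1) hT]) auto
    from holomorphic_deriv[OF this T(1)] show ?thesis by (simp add: velocity_def)
  qed
  have vt: "((\<lambda>t. velocity c f t) \<longlongrightarrow> velocity c f s) (at s)"
  proof (rule vec_tendstoI)
    fix i
    have "isCont (\<lambda>t. velocity c f t $ i) s"
      using holomorphic_on_imp_continuous_on[OF vh] T by (simp add: continuous_on_eq_continuous_at)
    then show "((\<lambda>t. velocity c f t $ i) \<longlongrightarrow> velocity c f s $ i) (at s)" by (simp add: isCont_def)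
  qed
  have "isCont f s"
    using hT T by (simp add: holomorphic_curve_on_def continuous_on_eq_continuous_at)
  then have ft: "(f \<longlongrightarrow> f s) (at s)" by (simp add: isCont_def)
  have "\<forall>\<^sub>F t in at s. t \<in> ?T" by (rule eventually_at_in_open'[OF T])
  then have "\<forall>\<^sub>F t in at s. metric_norm g c (f t) (velocity c f t) = speed A g f t"
  proof (rule eventually_mono)
    fix t assume "t \<in> ?T"
    then show "metric_norm g c (f t) (velocity c f t) = speed A g f t"
      using speed_eq[OF f _ c(1), of t] by simp
  qed
  with metric_norm_tendsto[OF c ft vt]
  have "((\<lambda>t. speed A g f t) \<longlongrightarrow> metric_norm g c (f s) (velocity c f s)) (at s)"
    by (rule Lim_transform_eventually)
  then show "isCont (speed A g f) s"
    unfolding isCont_def speed_eq[OF f s c, symmetric] .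
qed

end

locale hermitian_foliation = hermitian_atlas A g + foliation A E F
  for A :: "('m::{t2_space, second_countable_topology}, 'n::finite) chart set"
    and g :: "('m, 'n) chart \<Rightarrow> 'm \<Rightarrow> complex^'n \<Rightarrow> complex^'n \<Rightarrow> complex"
    and E :: "'m set" and F :: "('m, 'n) generator set"
begin

lemma speed_tendsto:
  assumes conv: "compactly_convergent_on S \<sigma> f" and S: "open S" "s \<in> S"
    and \<sigma>: "\<And>k. holomorphic_curve_on A S (\<sigma> k)" and f: "holomorphic_curve_on A S f"
  shows "(\<lambda>k. speed A g (\<sigma> k) s) \<longlonglongrightarrow> speed A g f s"
proof -
  obtain c where c: "c \<in> A" "f s \<in> fst c" by (rule ex_chart)
  have fc: "continuous_on S f" using f by (simp add: holomorphic_curve_on_def)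
  have st: "(\<lambda>k. \<sigma> k s) \<longlonglongrightarrow> f s" by (rule compactly_convergent_tendsto[OF conv fc S])
  have "\<forall>\<^sub>F k in sequentially. metric_norm g c (\<sigma> k s) (velocity c (\<sigma> k) s) = speed A g (\<sigma> k) s"
    using topological_tendstoD[OF st chart_open[OF c(1)] c(2)]
    by (rule eventually_mono) (simp add: speed_eq[OF \<sigma> S c(1)])
  with metric_norm_tendsto[OF c st velocity_tendsto[OF conv S \<sigma> f c]]
  have "(\<lambda>k. speed A g (\<sigma> k) s) \<longlonglongrightarrow> metric_norm g c (f s) (velocity c f s)"
    by (rule Lim_transform_eventually)
  then show ?thesis unfolding speed_eq[OF f S c, symmetric] .
qed

end

section \<open>The modulus as a speed, and its local lower bound\<close>

locale hermitian_hyperbolic_foliation = hermitian_foliation A g E F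
  for A :: "('m::{t2_space, second_countable_topology}, 'n::finite) chart set"
    and g :: "('m, 'n) chart \<Rightarrow> 'm \<Rightarrow> complex^'n \<Rightarrow> complex^'n \<Rightarrow> complex"
    and E :: "'m set" and F :: "('m, 'n) generator set" +
  assumes hyp: "hyperbolic_foliation A E F"
begin

abbreviation \<eta> :: "'m \<Rightarrow> real" where
  "\<eta> \<equiv> modulus_of_uniformization A E F g"

lemma disc_lift_speed:
  assumes \<alpha>: "uniformization_of A E F p \<alpha>" "p \<notin> E"
    and f: "tangent_curve A E F (ball 0 1) f" "f ` ball 0 1 \<subseteq> leaf E F p"
    and w: "w \<in> ball 0 1" "f 0 = \<alpha> w"
  obtains h where "h holomorphic_on ball 0 1" "h ` ball 0 1 \<subseteq> ball 0 1" "h 0 = w"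
    "\<And>s. s \<in> ball 0 1 \<Longrightarrow> f s = \<alpha> (h s)"
    "\<And>s. s \<in> ball 0 1 \<Longrightarrow> speed A g f s = cmod (deriv h s) * speed A g \<alpha> (h s)"
proof -
  have zero: "0 \<in> ball (0::complex) 1" by simp
  obtain h where h: "h holomorphic_on ball 0 1" "h ` ball 0 1 \<subseteq> ball 0 1" "h 0 = w"
    "\<And>s. s \<in> ball 0 1 \<Longrightarrow> \<alpha> (h s) = f s"
    by (rule disc_lift[OF \<alpha> f open_ball convex_imp_simply_connected[OF convex_ball] zero w]) (rule that)
  have "speed A g f s = cmod (deriv h s) * speed A g \<alpha> (h s)" if s: "s \<in> ball 0 1" for s
  proof -
    have "speed A g f s = speed A g (\<alpha> \<circ> h) s"
      by (rule speed_cong[OF open_ball s]) (simp add: h(4))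
    also have "\<dots> = cmod (deriv h s) * speed A g \<alpha> (h s)"
      by (rule speed_compose[OF uniformization_ofD(1)[OF \<alpha>] open_ball h(1,2) open_ball s])
    finally show ?thesis .
  qed
  then show ?thesis using that[of h] h by simp
qed

lemma disc_speed_le:
  assumes \<alpha>: "uniformization_of A E F p \<alpha>" "p \<notin> E"
    and f: "f \<in> discs A E F" and w: "w \<in> ball 0 1" "f 0 = \<alpha> w"
  shows "speed A g f 0 \<le> speed A g \<alpha> w * (1 - (cmod w)\<^sup>2)"
proof -
  obtain q where q: "q \<notin> E" "f ` ball 0 1 \<subseteq> leaf E F q" using f by (auto simp: discs_def)
  have "f 0 \<in> leaf E F q" using q(2) by force
  moreover have "f 0 \<in> leaf E F p" using uniformization_ofD(2)[OF \<alpha>] w by auto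
  ultimately have "leaf E F q = leaf E F p" using leaf_eq[OF q(1)] leaf_eq[OF \<alpha>(2)] by metis
  then have sub: "f ` ball 0 1 \<subseteq> leaf E F p" using q(2) by simp
  obtain h where h: "h holomorphic_on ball 0 1" "h ` ball 0 1 \<subseteq> ball 0 1" "h 0 = w"
    "\<And>s. s \<in> ball 0 1 \<Longrightarrow> f s = \<alpha> (h s)"
    "\<And>s. s \<in> ball 0 1 \<Longrightarrow> speed A g f s = cmod (deriv h s) * speed A g \<alpha> (h s)"
    \<comment> \<open>Tangency from \<open>disc_tangent\<close> is what allows an arbitrary member
      of \<open>discs\<close> to be lifted.\<close>
    by (rule disc_lift_speed[OF \<alpha> disc_tangent[OF f hyp] sub w]) (rule that)
  have "cmod (deriv h 0) \<le> 1 - (cmod w)\<^sup>2" using Schwarz_Pick[OF h(1,2), of 0] h(3) by simp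
  then have "cmod (deriv h 0) * speed A g \<alpha> w \<le> (1 - (cmod w)\<^sup>2) * speed A g \<alpha> w"
    by (rule mult_right_mono) (rule speed_nonneg[OF uniformization_ofD(1)[OF \<alpha>] open_ball w(1)])
  then show ?thesis using h(5)[of 0] h(3) by (simp add: mult.commute)
qed

text \<open>The supremum is attained by \<open>\<alpha>\<close> after the automorphism of the disc
  that sends 0 to \<open>w\<close>; its derivative at 0 has modulus \<open>1 - |w|\<^sup>2\<close>.
  The upper bound is \<open>disc_speed_le\<close>.\<close>

lemma modulus_eq_speed:
  assumes \<alpha>: "uniformization_of A E F p \<alpha>" "p \<notin> E" and w: "w \<in> ball 0 1"
  shows "\<eta> (\<alpha> w) = speed A g \<alpha> w * (1 - (cmod w)\<^sup>2)"
  unfolding modulus_of_uniformization_def initial_speed_eq_speed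
proof (rule cSup_eq_maximum)
  let ?M = "Moebius_function 0 (- w)"
  have w': "cmod (- w) < 1" using w by simp
  have Mb: "?M ` ball 0 1 \<subseteq> ball 0 1" using Moebius_function_norm_lt_1[OF w'] by auto
  note a = uniformization_ofD[OF \<alpha>]
  note Mh = Moebius_function_holomorphic[OF w', of 0]
  have M0: "?M 0 = w" by (simp add: Moebius_function_of_zero)
  have "holomorphic_curve_on A (ball 0 1) (\<alpha> \<circ> ?M)"
    by (rule holomorphic_curve_on_compose[OF a(1) Mh Mb])
  moreover have "(\<alpha> \<circ> ?M) ` ball 0 1 \<subseteq> leaf E F p" using Mb a(2) by auto
  ultimately have "\<alpha> \<circ> ?M \<in> discs A E F" unfolding discs_def using \<alpha>(2) by blast
  moreover have "(\<alpha> \<circ> ?M) 0 = \<alpha> w" by (simp add: M0)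
  moreover have "speed A g (\<alpha> \<circ> ?M) 0 = speed A g \<alpha> w * (1 - (cmod w)\<^sup>2)"
  proof -
    have "deriv ?M 0 = 1 - of_real ((cmod w)\<^sup>2)"
      using Moebius_has_field_derivative[OF w', of 0] by (intro DERIV_imp_deriv) simp
    then have "cmod (deriv ?M 0) = 1 - (cmod w)\<^sup>2"
      using norm_of_real[of "1 - (cmod w)\<^sup>2", where 'a = complex] one_minus_norm_square_pos[of w] w' by simp
    moreover have "speed A g (\<alpha> \<circ> ?M) 0 = cmod (deriv ?M 0) * speed A g \<alpha> (?M 0)"
      by (rule speed_compose[OF a(1) open_ball Mh Mb open_ball]) simp
    ultimately show ?thesis by (simp add: M0)
  qed
  ultimately show "speed A g \<alpha> w * (1 - (cmod w)\<^sup>2) \<in> (\<lambda>f. speed A g f 0) ` {f \<in> discs A E F. f 0 = \<alpha> w}"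
    by (metis (mono_tags, lifting) imageI mem_Collect_eq)
  fix x assume "x \<in> (\<lambda>f. speed A g f 0) ` {f \<in> discs A E F. f 0 = \<alpha> w}"
  then obtain f where f: "f \<in> discs A E F" "f 0 = \<alpha> w" "x = speed A g f 0" by blast
  show "x \<le> speed A g \<alpha> w * (1 - (cmod w)\<^sup>2)"
    unfolding f(3) by (rule disc_speed_le[OF \<alpha> f(1) w f(2)])
qed

lemma modulus_ge_disc_speed:
  assumes "f \<in> discs A E F" "f 0 = p" "p \<notin> E"
  shows "speed A g f 0 \<le> \<eta> p"
proof -
  obtain \<alpha> where \<alpha>: "uniformization_of A E F p \<alpha>" "\<alpha> 0 = p" by (rule uniformization_at[OF hyp assms(3)])
  then show ?thesis
    using modulus_eq_speed[OF \<alpha>(1) assms(3), of 0] disc_speed_le[OF \<alpha>(1) assms(3,1), of 0] assms(2)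
    by simp
qed

text \<open>For every \<open>q\<close> near \<open>p\<close> there is an integral curve through
  \<open>q\<close> of the same time \<open>r\<close>. Rescaled to the unit disc it has initial speed
  \<open>r\<close> times the length of \<open>X q\<close>, which stays above half its positive value
  at \<open>p\<close>.\<close>

lemma modulus_locally_bounded_below:
  assumes p: "p \<notin> E"
  obtains b where "0 < b" "\<forall>\<^sub>F q in nhds p. q \<notin> E \<longrightarrow> b \<le> \<eta> q"
proof -
  obtain c W X where G: "(c, W, X) \<in> F" "p \<in> W" by (rule ex_generator)
  note c = generator(1)[OF G(1)]
  obtain N r where N: "open N" "p \<in> N" "N \<subseteq> W \<inter> UNIV - E" "0 < r"
    "\<And>p'. p' \<in> N \<Longrightarrow> \<exists>\<gamma>. integral_curve E c (W \<inter> UNIV) X \<gamma> r \<and> \<gamma> 0 = p'"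
    by (rule local_flow[OF G(1) open_UNIV G(2) UNIV_I p]) (rule that)
  have pc: "p \<in> fst c" using generator(3)[OF G(1)] G(2) by blast
  define b0 where "b0 = metric_norm g c p (X p)"
  have "X p \<noteq> 0" using generator(5)[OF G] p by simp
  then have b0: "0 < b0" unfolding b0_def by (rule metric_norm_pos[OF c pc])
  have Xt: "(X \<longlongrightarrow> X p) (nhds p)"
  proof (rule vec_tendstoI)
    fix i
    have "continuous_on W (\<lambda>p. X p $ i)"
      by (rule holomorphic_fun_in_imp_continuous_on[OF generator(4,2)[OF G(1)]])
    then have "isCont (\<lambda>p. X p $ i) p"
      using generator(2)[OF G(1)] G(2) by (simp add: continuous_on_eq_continuous_at)
    then show "((\<lambda>p. X p $ i) \<longlongrightarrow> X p $ i) (nhds p)"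
      using tendsto_at_iff_tendsto_nhds[of "\<lambda>p. X p $ i" p] by (simp add: isCont_def)
  qed
  have "((\<lambda>q. metric_norm g c q (X q)) \<longlongrightarrow> b0) (nhds p)"
    unfolding b0_def by (rule metric_norm_tendsto[OF c pc _ Xt]) (rule filterlim_ident)
  then have "\<forall>\<^sub>F q in nhds p. b0 / 2 < metric_norm g c q (X q)"
    by (rule order_tendstoD(1)) (use b0 in simp)
  moreover have "\<forall>\<^sub>F q in nhds p. q \<in> N" using N(1,2) by (rule eventually_nhds_in_open)
  ultimately have "\<forall>\<^sub>F q in nhds p. q \<notin> E \<longrightarrow> r * (b0 / 2) \<le> \<eta> q"
  proof eventually_elim
    case (elim q)
    obtain \<gamma> where \<gamma>: "integral_curve E c W X \<gamma> r" "\<gamma> 0 = q" using N(5)[OF elim(2)] by auto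
    have qE: "q \<notin> E" "q \<in> fst c" using elim(2) N(3) generator(3)[OF G(1)] by auto
    note t = integral_curve_tangent[OF G(1) \<gamma>(1)]
    note gh = integral_curve_holomorphic[OF c generator(3)[OF G(1)] \<gamma>(1)]
    define h where "h = (\<lambda>s::complex. of_real r * s)"
    have h: "h holomorphic_on ball 0 1" "h ` ball 0 1 \<subseteq> ball 0 r"
      using N(4) by (auto simp: h_def norm_mult intro!: holomorphic_intros)
    have "deriv h 0 = of_real r" unfolding h_def by simp
    have zr: "(0::complex) \<in> ball 0 r" using N(4) by simp
    have "\<gamma> s \<in> leaf E F q" if "s \<in> ball 0 r" for s
      using tangent_curve_in_leaf[OF t open_ball connected_ball zr that] \<gamma>(2) by simp
    then have "(\<gamma> \<circ> h) ` ball 0 1 \<subseteq> leaf E F q" using h(2) by auto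
    moreover have "holomorphic_curve_on A (ball 0 1) (\<gamma> \<circ> h)"
      by (rule holomorphic_curve_on_compose[OF gh(1) h])
    ultimately have "\<gamma> \<circ> h \<in> discs A E F" unfolding discs_def using qE by blast
    then have "speed A g (\<gamma> \<circ> h) 0 \<le> \<eta> q"
      by (rule modulus_ge_disc_speed) (use qE \<gamma>(2) in \<open>simp_all add: h_def\<close>)
    moreover have "speed A g (\<gamma> \<circ> h) 0 = cmod (deriv h 0) * speed A g \<gamma> (h 0)"
      by (rule speed_compose[OF gh(1) open_ball h open_ball]) simp
    moreover have "speed A g \<gamma> (h 0) = metric_norm g c q (X q)"
      using speed_eq[OF gh(1) open_ball zr c] gh(2)[OF zr] \<gamma>(2) qE(2) by (simp add: h_def)
    ultimately have "r * metric_norm g c q (X q) \<le> \<eta> q" using \<open>deriv h 0 = of_real r\<close> N(4) by simp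
    moreover have "r * (b0 / 2) \<le> r * metric_norm g c q (X q)" using elim(1) N(4) by (intro mult_left_mono) auto
    ultimately show ?case by simp
  qed
  then show ?thesis using that[of "r * (b0 / 2)"] b0 N(4) by simp
qed

end


section \<open>Semicontinuity of the modulus\<close>

lemma frequently_imp_sequence:
  fixes p :: "'a::first_countable_topology"
  assumes "\<And>n. \<exists>\<^sub>F q in nhds p. P n q"
  obtains s where "\<And>n::nat. P n (s n)" "s \<longlonglongrightarrow> p"
proof -
  obtain B :: "nat \<Rightarrow> 'a set" where B: "\<And>i. open (B i)" "\<And>i. p \<in> B i"
    "\<And>s. (\<forall>n. s n \<in> B n) \<Longrightarrow> s \<longlonglongrightarrow> p"
    by (rule first_countable_topology_class.countable_basis[of p]) (rule that)
  have ex: "\<exists>q. q \<in> B n \<and> P n q" for n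
  proof (rule ccontr)
    assume neg: "\<nexists>q. q \<in> B n \<and> P n q"
    have "\<forall>\<^sub>F q in nhds p. q \<in> B n" using B(1,2) by (rule eventually_nhds_in_open)
    then have "\<forall>\<^sub>F q in nhds p. \<not> P n q" by (rule eventually_mono) (use neg in blast)
    then show False using assms[of n] by (simp add: frequently_def)
  qed
  define s where "s = (\<lambda>n. SOME q. q \<in> B n \<and> P n q)"
  have s: "s n \<in> B n \<and> P n (s n)" for n unfolding s_def by (rule someI_ex[OF ex])
  have 1: "\<forall>n. s n \<in> B n" using s by (intro allI) (rule conjunct1)
  have 2: "P n (s n)" for n using s by (rule conjunct2)
  show ?thesis by (rule that[of s, OF 2 B(3)[OF 1]])
qed

text \<open>\<open>a / m\<close> is upper semicontinuous, so it has a maximum on a compact set; the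
  conclusion is cross-multiplied for later use. If every \<open>x\<close> were beaten by some
  \<open>Y x\<close>, the sets where the quotient is below its value at \<open>Y x\<close> would
  form an open cover.\<close>

lemma semicontinuous_quotient_attains_max:
  fixes a m :: "'a::topological_space \<Rightarrow> real"
  assumes K: "compact K" "K \<noteq> {}" and a: "continuous_on K a"
    and pos: "\<And>x. x \<in> K \<Longrightarrow> 0 < m x"
    and lsc: "\<And>x c. \<lbrakk>x \<in> K; c < m x\<rbrakk> \<Longrightarrow> \<exists>T. open T \<and> x \<in> T \<and> (\<forall>y\<in>K \<inter> T. c < m y)"
    and nonneg: "\<And>x. x \<in> K \<Longrightarrow> 0 \<le> a x"
  shows "\<exists>x\<in>K. \<forall>y\<in>K. a y * m x \<le> a x * m y"
proof (rule ccontr)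
  assume neg: "\<not> (\<exists>x\<in>K. \<forall>y\<in>K. a y * m x \<le> a x * m y)"
  have "\<exists>y\<in>K. a x / m x < a y / m y" if x: "x \<in> K" for x
  proof -
    obtain y where "y \<in> K" "\<not> a y * m x \<le> a x * m y" using neg x by blast
    then show ?thesis using pos[OF x] pos[of y] by (intro bexI[of _ y]) (auto simp: field_simps)
  qed
  then obtain Y where Y: "\<And>x. x \<in> K \<Longrightarrow> Y x \<in> K" "\<And>x. x \<in> K \<Longrightarrow> a x / m x < a (Y x) / m (Y x)"
    by metis
  define q where "q = (\<lambda>x. a (Y x) / m (Y x))"
  have "\<exists>T. open T \<and> x \<in> T \<and> (\<forall>y\<in>K \<inter> T. a y / m y < q x)" if x: "x \<in> K" for x
  proof -
    have q0: "0 < q x"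
      using Y(2)[OF x] nonneg[OF x] pos[OF x] unfolding q_def
      by (meson divide_nonneg_pos le_less_trans)
    have "a x < q x * m x" using Y(2)[OF x] pos[OF x] by (simp add: q_def field_simps)
    \<comment> \<open>A threshold in between separates the two hypotheses: near \<open>x\<close> one
      has \<open>a < b\<close> by continuity and \<open>b / q x < m\<close> by
      semicontinuity.\<close>
    then obtain b where b: "a x < b" "b < q x * m x" using dense by blast
    have "b / q x < m x" using b(2) q0 by (simp add: field_simps)
    then obtain T where T: "open T" "x \<in> T" "\<forall>y\<in>K \<inter> T. b / q x < m y" using lsc[OF x] by blast
    have "openin (top_of_set K) (K \<inter> a -` {..<b})"
      by (rule continuous_openin_preimage_gen[OF a open_lessThan])
    then obtain T' where T': "open T'" "K \<inter> a -` {..<b} = K \<inter> T'" unfolding openin_open by blast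
    show ?thesis
    proof (intro exI[of _ "T \<inter> T'"] conjI ballI)
      show "open (T \<inter> T')" using T(1) T'(1) by (rule open_Int)
      show "x \<in> T \<inter> T'" using T(2) T'(2) x b(1) by blast
      fix y assume y: "y \<in> K \<inter> (T \<inter> T')"
      have "a y < b" using T'(2) y by blast
      moreover have "b < q x * m y" using T(3) y q0 by (auto simp: field_simps)
      ultimately have "a y < q x * m y" by simp
      then show "a y / m y < q x" using pos[of y] y by (simp add: field_simps)
    qed
  qed
  then obtain T where T: "\<And>x. x \<in> K \<Longrightarrow> open (T x)" "\<And>x. x \<in> K \<Longrightarrow> x \<in> T x"
    "\<And>x y. \<lbrakk>x \<in> K; y \<in> K \<inter> T x\<rbrakk> \<Longrightarrow> a y / m y < q x" by metis
  have KT: "K \<subseteq> \<Union>(T ` K)" using T(2) by blast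
  obtain C where C: "C \<subseteq> K" "finite C" "K \<subseteq> \<Union>(T ` C)"
    by (rule compactE_image[OF K(1) T(1) KT], assumption) (rule that)
  have "C \<noteq> {}" using C(3) K(2) by blast
  then obtain x where x: "x \<in> C" "\<And>y. y \<in> C \<Longrightarrow> q y \<le> q x"
    using finite_imageI[OF C(2), of q] Max_in[of "q ` C"] Max_ge[of "q ` C"]
    by (metis (no_types, lifting) image_iff image_is_empty)
  have xK: "x \<in> K" using x(1) C(1) by blast
  then obtain y where y: "y \<in> C" "Y x \<in> T y" using C(3) Y(1)[OF xK] by blast
  \<comment> \<open>\<open>Y x\<close> has quotient \<open>q x\<close> and lies in
    \<open>T y\<close>, where all quotients are below \<open>q y\<close>, although
    \<open>q x\<close> was the largest value on \<open>C\<close>.\<close>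
  have "q x < q y" using T(3)[of y "Y x"] y C(1) Y(1)[OF xK] by (auto simp: q_def)
  then show False using x(2)[OF y(1)] by simp
qed

section \<open>The lower semicontinuous envelope of the modulus\<close>

context hermitian_hyperbolic_foliation
begin

text \<open>A lower limit over full neighbourhoods: \<open>nhds\<close> counts the value at
  \<open>p\<close> itself, so \<open>\<eta> p\<close> bounds the set above for
  \<open>p \<notin> E\<close>. Points of \<open>E\<close> are left out because \<open>\<eta>\<close>
  is meaningful only off \<open>E\<close>.\<close>

definition lower_modulus :: "'m \<Rightarrow> real" where
  "lower_modulus p = Sup {b. \<forall>\<^sub>F q in nhds p. q \<notin> E \<longrightarrow> b \<le> \<eta> q}"

lemma lower_modulus_bdd:
  assumes "p \<notin> E"
  shows "bdd_above {b. \<forall>\<^sub>F q in nhds p. q \<notin> E \<longrightarrow> b \<le> \<eta> q}"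
  using assms by (intro bdd_aboveI[of _ "\<eta> p"]) (auto dest: eventually_nhds_x_imp_x)

lemma lower_modulus_ge:
  "\<lbrakk>p \<notin> E; \<forall>\<^sub>F q in nhds p. q \<notin> E \<longrightarrow> b \<le> \<eta> q\<rbrakk> \<Longrightarrow> b \<le> lower_modulus p"
  unfolding lower_modulus_def by (rule cSup_upper[OF _ lower_modulus_bdd]) auto

lemma lower_modulus_pos: "p \<notin> E \<Longrightarrow> 0 < lower_modulus p"
  by (rule modulus_locally_bounded_below[of p]) (auto dest: lower_modulus_ge)

lemma less_lower_modulusD:
  assumes p: "p \<notin> E" and b: "b < lower_modulus p"
  obtains b' where "b < b'" "\<forall>\<^sub>F q in nhds p. q \<notin> E \<longrightarrow> b' \<le> \<eta> q"
proof -
  let ?S = "{b. \<forall>\<^sub>F q in nhds p. q \<notin> E \<longrightarrow> b \<le> \<eta> q}"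
  have "?S \<noteq> {}"
    by (rule modulus_locally_bounded_below[OF p]) auto
  then obtain b' where "b' \<in> ?S" "b < b'"
    using b less_cSup_iff[OF _ lower_modulus_bdd[OF p]] unfolding lower_modulus_def by auto
  then show ?thesis using that by auto
qed

lemma lower_modulus_semicontinuous:
  assumes p: "p \<notin> E" and b: "b < lower_modulus p"
  shows "\<forall>\<^sub>F q in nhds p. q \<notin> E \<longrightarrow> b < lower_modulus q"
proof -
  obtain b' where b': "b < b'" "\<forall>\<^sub>F q in nhds p. q \<notin> E \<longrightarrow> b' \<le> \<eta> q"
    by (rule less_lower_modulusD[OF assms])
  then have "\<forall>\<^sub>F q in nhds p. \<forall>\<^sub>F q' in nhds q. q' \<notin> E \<longrightarrow> b' \<le> \<eta> q'"
    by (simp add: eventually_eventually)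
  then show ?thesis
    by (rule eventually_mono) (use b'(1) lower_modulus_ge in \<open>fastforce intro: less_le_trans\<close>)
qed

lemma lower_modulus_le_limit:
  assumes p: "p \<notin> E" and s: "s \<longlonglongrightarrow> p" "\<And>n. s n \<notin> E" and l: "(\<lambda>n. \<eta> (s n)) \<longlonglongrightarrow> l"
  shows "lower_modulus p \<le> l"
proof (rule dense_le)
  fix b assume "b < lower_modulus p"
  then obtain b' where b': "b < b'" "\<forall>\<^sub>F q in nhds p. q \<notin> E \<longrightarrow> b' \<le> \<eta> q"
    by (rule less_lower_modulusD[OF p])
  have "\<forall>\<^sub>F n in sequentially. b \<le> \<eta> (s n)"
    using eventually_compose_filterlim[OF b'(2) s(1)]
    by (rule eventually_mono) (use s(2) b'(1) in fastforce)
  then show "b \<le> l" using l by (intro tendsto_lowerbound[OF l]) auto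
qed

lemma lower_modulus_attained:
  assumes p: "p \<notin> E"
  obtains s where "s \<longlonglongrightarrow> p" "\<And>n::nat. s n \<notin> E" "(\<lambda>n. \<eta> (s n)) \<longlonglongrightarrow> lower_modulus p"
proof -
  let ?e = "\<lambda>n::nat. 1 / real (Suc n)"
  \<comment> \<open>Otherwise \<open>lower_modulus p + 1 / Suc n\<close> would be an eventual lower
    bound exceeding the supremum of all of them.\<close>
  have "\<exists>\<^sub>F q in nhds p. q \<notin> E \<and> \<eta> q < lower_modulus p + ?e n" for n
  proof (rule ccontr)
    assume "\<not> (\<exists>\<^sub>F q in nhds p. q \<notin> E \<and> \<eta> q < lower_modulus p + ?e n)"
    then have "\<forall>\<^sub>F q in nhds p. q \<notin> E \<longrightarrow> lower_modulus p + ?e n \<le> \<eta> q"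
      unfolding not_frequently by (rule eventually_mono) auto
    from lower_modulus_ge[OF p this] show False by (simp add: divide_le_0_iff)
  qed
  then obtain s where s: "\<And>n. s n \<notin> E \<and> \<eta> (s n) < lower_modulus p + ?e n" "s \<longlonglongrightarrow> p"
    by (rule frequently_imp_sequence[where p = p and P = "\<lambda>n q. q \<notin> E \<and> \<eta> q < lower_modulus p + ?e n"]) (rule that)
  have "(\<lambda>n. \<eta> (s n)) \<longlonglongrightarrow> lower_modulus p"
  proof (rule order_tendstoI)
    fix b assume "b < lower_modulus p"
    then obtain b' where b': "b < b'" "\<forall>\<^sub>F q in nhds p. q \<notin> E \<longrightarrow> b' \<le> \<eta> q"
      by (rule less_lower_modulusD[OF p])
    show "\<forall>\<^sub>F n in sequentially. b < \<eta> (s n)"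
      using eventually_compose_filterlim[OF b'(2) s(2)]
      by (rule eventually_mono) (use s(1) b'(1) in fastforce)
  next
    fix b assume b: "lower_modulus p < b"
    have "(\<lambda>n. lower_modulus p + ?e n) \<longlonglongrightarrow> lower_modulus p + 0"
      by (intro tendsto_add tendsto_const LIMSEQ_Suc[OF lim_1_over_n])
    then have "\<forall>\<^sub>F n in sequentially. lower_modulus p + ?e n < b"
      by (rule order_tendstoD(2)) (use b in simp)
    then show "\<forall>\<^sub>F n in sequentially. \<eta> (s n) < b"
      by (rule eventually_mono) (use s(1) less_trans in blast)
  qed
  then show ?thesis using that s by blast
qed

end

section \<open>Upper and lower bounds for the modulus at regular points\<close>

locale hermitian_ncp_foliation =
  hermitian_hyperbolic_foliation A g E F + ncp_foliation A E F U \<Sigma>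
  for A :: "('m::{t2_space, second_countable_topology}, 'n::finite) chart set"
    and g :: "('m, 'n) chart \<Rightarrow> 'm \<Rightarrow> complex^'n \<Rightarrow> complex^'n \<Rightarrow> complex"
    and E :: "'m set" and F :: "('m, 'n) generator set" and U \<Sigma> :: "'m \<Rightarrow> 'm set"
begin

text \<open>The moduli along the approximating discs are their speeds times
  \<open>1 - |s|\<^sup>2\<close>, so they converge at every \<open>s\<close> and not only at the
  centre. The values away from 0 are what bounds the envelope along the limit disc.\<close>

lemma limit_disc:
  assumes z: "regular z" and p: "p \<longlonglongrightarrow> z" "\<And>n. p n \<notin> E"
  obtains r f \<beta> where "strict_mono r" "tangent_curve A E F (ball 0 1) f" "f 0 = z"
    "f ` ball 0 1 \<subseteq> leaf E F z"
    "\<And>n s. s \<in> ball 0 1 \<Longrightarrow> \<beta> n s \<notin> E" "\<And>n. \<beta> n 0 = p n"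
    "\<And>s. s \<in> ball 0 1 \<Longrightarrow> (\<lambda>k. \<beta> (r k) s) \<longlonglongrightarrow> f s"
    "\<And>s. s \<in> ball 0 1 \<Longrightarrow> (\<lambda>k. \<eta> (\<beta> (r k) s)) \<longlonglongrightarrow> speed A g f s * (1 - (cmod s)\<^sup>2)"
proof -
  have "\<exists>\<beta>. uniformization_of A E F (p n) \<beta> \<and> \<beta> 0 = p n" for n
    by (rule uniformization_at[OF hyp p(2)]) blast
  then obtain \<beta> where \<beta>: "\<And>n. uniformization_of A E F (p n) (\<beta> n)" "\<And>n. \<beta> n 0 = p n" by metis
  obtain r f where r: "strict_mono r" and f: "tangent_curve A E F (ball 0 1) f" "f 0 = z"
    "f ` ball 0 1 \<subseteq> leaf E F z" and conv: "compactly_convergent_on (ball 0 1) (\<beta> \<circ> r) f"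
    by (rule uniformization_limit[OF z p \<beta>]) (rule that)
  note b = uniformization_ofD[OF \<beta>(1) p(2)]
  have hf: "holomorphic_curve_on A (ball 0 1) f" using f(1) by (simp add: tangent_curve_def)
  then have fc: "continuous_on (ball 0 1) f" by (simp add: holomorphic_curve_on_def)
  have "(\<lambda>k. \<eta> (\<beta> (r k) s)) \<longlonglongrightarrow> speed A g f s * (1 - (cmod s)\<^sup>2)" if s: "s \<in> ball 0 1" for s
  proof -
    have "(\<lambda>k. speed A g ((\<beta> \<circ> r) k) s) \<longlonglongrightarrow> speed A g f s"
      by (rule speed_tendsto[OF conv open_ball s _ hf]) (simp add: b(1))
    then have "(\<lambda>k. speed A g ((\<beta> \<circ> r) k) s * (1 - (cmod s)\<^sup>2)) \<longlonglongrightarrow> speed A g f s * (1 - (cmod s)\<^sup>2)"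
      by (rule tendsto_mult_right)
    then show ?thesis unfolding o_def modulus_eq_speed[OF \<beta>(1) p(2) s] .
  qed
  moreover have "(\<lambda>k. \<beta> (r k) s) \<longlonglongrightarrow> f s" if "s \<in> ball 0 1" for s
    using compactly_convergent_tendsto[OF conv fc open_ball that] by simp
  moreover have "\<beta> n s \<notin> E" if "s \<in> ball 0 1" for n s
    using b(3)[of n] that unfolding tangent_curve_def by blast
  ultimately show ?thesis using that[OF r f, of \<beta>] \<beta>(2) by blast
qed

text \<open>The moduli at the centres converge to the initial speed of the limit disc, which
  competes in the supremum defining \<open>\<eta> z\<close>.\<close>

lemma modulus_upper_limit:
  assumes z: "regular z" and p: "p \<longlonglongrightarrow> z" "\<And>n. p n \<notin> E" and c: "\<And>n. c \<le> \<eta> (p n)"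
  shows "c \<le> \<eta> z"
proof -
  have zero: "0 \<in> ball (0::complex) 1" by simp
  note zE = regular_not_singular[OF z]
  obtain r f \<beta> where f: "tangent_curve A E F (ball 0 1) f" "f 0 = z" "f ` ball 0 1 \<subseteq> leaf E F z"
    and \<beta>: "\<And>n. \<beta> n 0 = p n"
    "\<And>s. s \<in> ball 0 1 \<Longrightarrow> (\<lambda>k. \<eta> (\<beta> (r k) s)) \<longlonglongrightarrow> speed A g f s * (1 - (cmod s)\<^sup>2)"
    by (rule limit_disc[OF z p]) (rule that)
  have "(\<lambda>k. \<eta> (p (r k))) \<longlonglongrightarrow> speed A g f 0" using \<beta>(2)[OF zero] by (simp add: \<beta>(1))
  then have "c \<le> speed A g f 0" by (rule LIMSEQ_le_const) (use c in blast)
  also have "\<dots> \<le> \<eta> z"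
  proof (rule modulus_ge_disc_speed[of f z, OF _ f(2) zE])
    show "f \<in> discs A E F" unfolding discs_def using f zE by (auto simp: tangent_curve_def)
  qed
  finally show ?thesis .
qed

lemma modulus_lower_bound:
  assumes z: "regular z" and r: "0 < r" "r < 1"
  shows "r * \<eta> z \<le> lower_modulus z"
proof -
  note zE = regular_not_singular[OF z]
  obtain \<alpha> where \<alpha>: "uniformization_of A E F z \<alpha>" "\<alpha> 0 = z" by (rule uniformization_at[OF hyp zE])
  note a = uniformization_ofD[OF \<alpha>(1) zE]
  let ?D = "ball (0::complex) 1" and ?K = "cball (0::complex) r"
  let ?s = "speed A g \<alpha>"
  \<comment> \<open>Up to the constant \<open>r\<close>, this is the speed of
    \<open>\<alpha>\<close> measured against the hyperbolic metric of the disc of radius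
    \<open>r\<close>.\<close>
  define Q where "Q = (\<lambda>w. ?s w * (r\<^sup>2 - (cmod w)\<^sup>2))"
  define m where "m = (\<lambda>w. lower_modulus (\<alpha> w))"
  have KD: "?K \<subseteq> ?D" using r(2) by auto
  have aL: "\<alpha> w \<in> leaf E F z" if "w \<in> ?D" for w using a(2) that by blast
  have aE: "\<alpha> w \<notin> E" if "w \<in> ?D" for w by (rule leaf_disjoint_singular[OF zE aL[OF that]])
  have s0: "0 \<le> ?s w" if "w \<in> ?D" for w by (rule speed_nonneg[OF a(1) open_ball that])
  have mpos: "0 < m w" if "w \<in> ?D" for w unfolding m_def by (rule lower_modulus_pos[OF aE[OF that]])
  have ac: "continuous_on ?D \<alpha>" using a(1) by (simp add: holomorphic_curve_on_def)
  have rw: "0 \<le> r\<^sup>2 - (cmod w)\<^sup>2" if "w \<in> ?K" for w using that r by (simp add: power_mono)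
  have "\<exists>w\<in>?K. \<forall>y\<in>?K. Q y * m w \<le> Q w * m y"
  proof (rule semicontinuous_quotient_attains_max[of ?K Q m])
    show "compact ?K" "?K \<noteq> {}" using r by auto
    show "continuous_on ?K Q" unfolding Q_def
      by (intro continuous_intros continuous_on_subset[OF speed_continuous[OF a(1) open_ball] KD])
    show "0 < m x" if "x \<in> ?K" for x using mpos KD that by blast
    show "0 \<le> Q x" if "x \<in> ?K" for x
      unfolding Q_def using s0 rw[OF that] KD that by (intro mult_nonneg_nonneg) auto
    show "\<exists>T. open T \<and> x \<in> T \<and> (\<forall>y\<in>?K \<inter> T. c < m y)" if x: "x \<in> ?K" "c < m x" for x c
    proof -
      have xD: "x \<in> ?D" using x(1) KD by blast
      have "\<forall>\<^sub>F q in nhds (\<alpha> x). q \<notin> E \<longrightarrow> c < lower_modulus q"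
        by (rule lower_modulus_semicontinuous[OF aE[OF xD]]) (use x(2) in \<open>simp add: m_def\<close>)
      then obtain V where V: "open V" "\<alpha> x \<in> V" "\<And>q. q \<in> V \<Longrightarrow> q \<notin> E \<longrightarrow> c < lower_modulus q"
        unfolding eventually_nhds by blast
      have "open (?D \<inter> \<alpha> -` V)" by (rule continuous_open_preimage[OF ac open_ball V(1)])
      moreover have "x \<in> ?D \<inter> \<alpha> -` V" using xD V(2) by blast
      moreover have "c < m y" if "y \<in> ?K \<inter> (?D \<inter> \<alpha> -` V)" for y
        using V(3)[of "\<alpha> y"] aE[of y] that by (auto simp: m_def)
      ultimately show ?thesis by blast
    qed
  qed
  then obtain w where w: "w \<in> ?K" "\<And>y. y \<in> ?K \<Longrightarrow> Q y * m w \<le> Q w * m y" by blast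
  have wD: "w \<in> ?D" using w(1) KD by blast
  define p where "p = \<alpha> w"
  have p: "regular p" "p \<notin> E" using regular_leaf[OF z aL[OF wD]] aE[OF wD] by (simp_all add: p_def)
  have Lp: "leaf E F p = leaf E F z" unfolding p_def by (rule leaf_eq[OF zE aL[OF wD]])
  obtain q where q: "q \<longlonglongrightarrow> p" "\<And>n. q n \<notin> E" "(\<lambda>n. \<eta> (q n)) \<longlonglongrightarrow> lower_modulus p"
    by (rule lower_modulus_attained[OF p(2)]) (rule that)
  obtain \<rho> f \<beta> where \<rho>: "strict_mono \<rho>" and f: "tangent_curve A E F ?D f" "f 0 = p" "f ` ?D \<subseteq> leaf E F p"
    and \<beta>: "\<And>n s. s \<in> ?D \<Longrightarrow> \<beta> n s \<notin> E" "\<And>n. \<beta> n 0 = q n"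
    "\<And>s. s \<in> ?D \<Longrightarrow> (\<lambda>k. \<beta> (\<rho> k) s) \<longlonglongrightarrow> f s"
    "\<And>s. s \<in> ?D \<Longrightarrow> (\<lambda>k. \<eta> (\<beta> (\<rho> k) s)) \<longlonglongrightarrow> speed A g f s * (1 - (cmod s)\<^sup>2)"
    by (rule limit_disc[OF p(1) q(1,2)]) (rule that)
  have zero: "0 \<in> ?D" by simp
  have "(\<lambda>k. \<eta> (q (\<rho> k))) \<longlonglongrightarrow> speed A g f 0" using \<beta>(4)[OF zero] by (simp add: \<beta>(2))
  moreover have "(\<lambda>k. \<eta> (q (\<rho> k))) \<longlonglongrightarrow> lower_modulus p"
    using LIMSEQ_subseq_LIMSEQ[OF q(3) \<rho>] by (simp add: o_def)
  \<comment> \<open>The limit disc realizes the envelope at its centre, because the sequence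
    \<open>q\<close> was chosen to approach \<open>p\<close> with moduli tending to
    \<open>lower_modulus p\<close>.\<close>
  ultimately have f0: "speed A g f 0 = m w" using LIMSEQ_unique by (auto simp: m_def p_def)
  have fE: "f s \<notin> E" if "s \<in> ?D" for s using f(1) that unfolding tangent_curve_def by blast
  \<comment> \<open>Away from the centre only an inequality is available: the moduli converge along
    a sequence tending to \<open>f s\<close>, and any such limit is at least the envelope.\<close>
  have fm: "lower_modulus (f s) \<le> speed A g f s * (1 - (cmod s)\<^sup>2)" if s: "s \<in> ?D" for s
    by (rule lower_modulus_le_limit[OF fE[OF s] \<beta>(3)[OF s] \<beta>(1)[OF s] \<beta>(4)[OF s]])
  have fL: "f ` ?D \<subseteq> leaf E F z" using f(3) Lp by simp
  have "f 0 = \<alpha> w" using f(2) by (simp add: p_def)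
  then obtain h where h: "h holomorphic_on ?D" "h ` ?D \<subseteq> ?D" "h 0 = w" "\<And>s. s \<in> ?D \<Longrightarrow> f s = \<alpha> (h s)"
    and hs: "\<And>s. s \<in> ?D \<Longrightarrow> speed A g f s = cmod (deriv h s) * ?s (h s)"
    by (rule disc_lift_speed[OF \<alpha>(1) zE f(1) fL wD]) (rule that)
  have mw: "m w = cmod (deriv h 0) * ?s w" using f0 hs[OF zero] h(3) by simp
  have sw: "0 < ?s w" and d0: "deriv h 0 \<noteq> 0"
    using mpos[OF wD] s0[OF wD] unfolding mw by (auto simp: zero_less_mult_iff)
  have eta0: "\<eta> z = ?s 0" using modulus_eq_speed[OF \<alpha>(1) zE zero] \<alpha>(2) by simp
  have zK: "0 \<in> ?K" using r(1) by simp
  have m0: "m 0 = lower_modulus z" by (simp add: m_def \<alpha>(2))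
  \<comment> \<open>When \<open>|w| < r\<close>, this says that the hyperbolic derivative of
    \<open>h\<close> at 0, as a map into the disc of radius \<open>r\<close>, is at least 1.\<close>
  have rr: "r\<^sup>2 - (cmod w)\<^sup>2 \<le> r * cmod (deriv h 0)"
  proof (cases "cmod w < r")
    case False
    then have "cmod w = r" using w(1) by simp
    then show ?thesis using r(1) by simp
  next
    case True
    \<comment> \<open>The maximality of \<open>w\<close> is known on the closed disc of radius
      \<open>r\<close> only, so \<open>h s\<close> must stay there.\<close>
    let ?S = "?D \<inter> h -` ball 0 r"
    have "r\<^sup>2 - (cmod (h 0))\<^sup>2 \<le> r * cmod (deriv h 0)"
    proof (rule hyperbolic_derivative_local_min[OF r(1), of h ?S])
      show "h holomorphic_on ?S" by (rule holomorphic_on_subset[OF h(1)]) blast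
      show "open ?S" by (rule continuous_open_preimage[OF holomorphic_on_imp_continuous_on[OF h(1)] open_ball open_ball])
      show "0 \<in> ?S" using True h(3) by simp
      show "deriv h 0 \<noteq> 0" by (rule d0)
      show "cmod (h s) < r" if "s \<in> ?S" for s using that by simp
      fix s assume s: "s \<in> ?S"
      then have sD: "s \<in> ?D" and hK: "h s \<in> ?K" by auto
      have hD: "h s \<in> ?D" using h(2) sD by blast
      let ?d = "cmod (deriv h s)" and ?c = "1 - (cmod s)\<^sup>2"
      have mh: "m (h s) \<le> ?d * ?s (h s) * ?c" using fm[OF sD] h(4)[OF sD] hs[OF sD] by (simp add: m_def)
      then have sh: "0 < ?s (h s)" using mpos[OF hD] s0[OF hD] by (cases "?s (h s) = 0") auto
      have Qw: "0 \<le> Q w" unfolding Q_def using sw rw[OF w(1)] by simp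
      have "Q (h s) * m w \<le> Q w * m (h s)" by (rule w(2)[OF hK])
      also have "\<dots> \<le> Q w * (?d * ?s (h s) * ?c)" by (rule mult_left_mono[OF mh Qw])
      \<comment> \<open>After inserting \<open>m w = |h'(0)| * ?s w\<close>, both sides contain the
        speeds of \<open>\<alpha>\<close> at \<open>h s\<close> and at \<open>w\<close>; cancelling
        them leaves a statement about \<open>h\<close> alone.\<close>
      finally have "(?s (h s) * ?s w) * (cmod (deriv h 0) * (r\<^sup>2 - (cmod (h s))\<^sup>2)) \<le>
          (?s (h s) * ?s w) * (?d * ?c * (r\<^sup>2 - (cmod w)\<^sup>2))"
        by (simp add: Q_def mw mult_ac)
      then show "cmod (deriv h 0) * (r\<^sup>2 - (cmod (h s))\<^sup>2) \<le> ?d * ?c * (r\<^sup>2 - (cmod (h 0))\<^sup>2)"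
        using sh sw h(3) by simp
    qed
    then show ?thesis using h(3) by simp
  qed
  \<comment> \<open>The maximal quotient \<open>Q / m\<close> is thus at most \<open>r\<close>.
    Evaluated at 0, where \<open>Q 0 = r\<^sup>2 * \<eta> z\<close>, this gives the claim.\<close>
  have "Q w \<le> r * m w"
    using mult_left_mono[OF rr less_imp_le[OF sw]] by (simp add: Q_def mw mult_ac)
  then have "Q w * m 0 \<le> r * m w * m 0" using mpos[OF zero] by (intro mult_right_mono) auto
  then have "Q 0 * m w \<le> r * m 0 * m w" using w(2)[OF zK] by (simp add: mult_ac)
  then have "Q 0 \<le> r * m 0" using mpos[OF wD] by simp
  then have "r * (r * \<eta> z) \<le> r * lower_modulus z" by (simp add: Q_def eta0 m0 power2_eq_square mult_ac)
  then show ?thesis using r(1) by simp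
qed

lemma modulus_le_lower_modulus: "regular z \<Longrightarrow> \<eta> z \<le> lower_modulus z"
  by (rule field_le_mult_one_interval) (rule modulus_lower_bound)

text \<open>Lower bounds hold on a neighbourhood directly through the envelope. The upper half goes
  by contradiction through a sequence, since normality is a statement about sequences.\<close>

lemma modulus_continuous:
  assumes z: "regular z"
  shows "continuous (at z within - E) \<eta>"
  unfolding continuous_within
proof (rule order_tendstoI)
  note zE = regular_not_singular[OF z]
  fix b assume "b < \<eta> z"
  then have "b < lower_modulus z" using modulus_le_lower_modulus[OF z] by simp
  then obtain b' where b': "b < b'" "\<forall>\<^sub>F q in nhds z. q \<notin> E \<longrightarrow> b' \<le> \<eta> q"
    by (rule less_lower_modulusD[OF zE])
  show "\<forall>\<^sub>F q in at z within - E. b < \<eta> q"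
    unfolding eventually_at_filter using b'(2) by (rule eventually_mono) (use b'(1) in auto)
next
  fix b assume b: "\<eta> z < b"
  show "\<forall>\<^sub>F q in at z within - E. \<eta> q < b"
  proof (rule ccontr)
    assume "\<not> (\<forall>\<^sub>F q in at z within - E. \<eta> q < b)"
    then have "\<exists>\<^sub>F q in nhds z. q \<notin> E \<and> b \<le> \<eta> q"
      unfolding eventually_at_filter not_eventually by (rule frequently_elim1) auto
    then obtain s where "\<And>n. s n \<notin> E \<and> b \<le> \<eta> (s n)" "s \<longlonglongrightarrow> z"
      by (rule frequently_imp_sequence[where p = z and P = "\<lambda>n q. q \<notin> E \<and> b \<le> \<eta> q"]) (rule that)
    then have "b \<le> \<eta> z" using modulus_upper_limit[OF z] by blast
    then show False using b by simp
  qed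
qed

end

theorem theorem1p11:
  fixes A :: "('m::{t2_space, second_countable_topology}, 'n::finite) chart set"
    and E :: "'m set"
    and F :: "('m, 'n) generator set"
    and g :: "('m, 'n) chart \<Rightarrow> 'm \<Rightarrow> complex^'n \<Rightarrow> complex^'n \<Rightarrow> complex"
    and U \<Sigma> :: "'m \<Rightarrow> 'm set"
  assumes "complex_atlas A"
    and "shfc A E F"
    and "hyperbolic_foliation A E F"
    and "hermitian_metric A g"
    and "NCP A (uniformizations A E F)"
    and "\<And>q. q \<in> E \<Longrightarrow> open (U q) \<and> q \<in> U q"
    and "\<And>q. q \<in> E \<Longrightarrow> invariant_hypersurface A E F (U q) (\<Sigma> q) \<and> q \<in> \<Sigma> q"
  shows "\<forall>z \<in> - (\<Union>p \<in> (\<Union>q\<in>E. \<Sigma> q). leaf E F p).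
           continuous (at z within - E) (modulus_of_uniformization A E F g)"
proof -
  interpret hermitian_ncp_foliation A g E F U \<Sigma>
    by unfold_locales (fact assms)+
  show ?thesis using modulus_continuous by (simp add: regular_def)
qed

end
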